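(* Let $\mathfrak{M}$ be an efficient instrument in a Hilbert space $\mathcal{H}$ with outcome set $\{X,\mathcal{F}\}$. Then for any state $\rho\in\mathfrak{S}(\mathcal{H})$ with finite entropy $$ER(\rho,\mathfrak{M})=I(\rho,\Pi_{\mathfrak{M}}),$$ where $ER(\rho,\mathfrak{M})=H(\rho)-\int_XH(\rho_x)\mu_\rho(dx)$ is the entropy reduction and $I(\rho,\Pi_{\mathfrak{M}})$ is the quantum mutual information at $\rho$ of the quantum-classical channel $\Pi_{\mathfrak{M}}$ mapping an a priori state to the density of its posteriori measure.
   Context: All Hilbert spaces are separable. $\mathfrak{B}(\mathcal{H})$, $\mathfrak{T}(\mathcal{H})$, $\mathfrak{T}_+(\mathcal{H})$, $\mathfrak{S}(\mathcal{H})$ denote bounded operators, trace-class operators, positive trace-class operators, and states (density operators). $H(\rho)=-\mathrm{Tr}\rho\log\rho\in[0,+\infty]$ is the von Neumann entropy. For $A,B\in\mathfrak{T}_+(\mathcal{H})$, $H(A\|B)=\sum_i\langle i|(A\log A-A\log B+B-A)|i\rangle$ with $\{|i\rangle\}$ an orthonormal eigenbasis of $A$, and $H(A\|B)=+\infty$ if $\mathrm{supp}A\not\subseteq\mathrm{supp}B$. An instrument $\mathfrak{M}$ in $\mathcal{H}$ with outcome set a measurable space $\{X,\mathcal{F}\}$ is a $\sigma$-additive map $F\mapsto\mathfrak{M}(F)$ from $\mathcal{F}$ to completely positive trace-non-increasing linear maps $\mathfrak{T}(\mathcal{H})\to\mathfrak{T}(\mathcal{H})$ such that $\mathfrak{M}(X)$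 is trace preserving; $\mathfrak{M}^*(F)$ is the dual map of $\mathfrak{M}(F)$. For an a priori state $\rho$, the posteriori measure is $\mu_\rho(F)=\mathrm{Tr}\,\mathfrak{M}(F)[\rho]$, and a family of posteriori states is a family $\{\rho_x\}_{x\in X}$ of states, defined for $\mu_\rho$-almost all $x$, with $x\mapsto\mathrm{Tr}A\rho_x$ measurable for all $A\in\mathfrak{B}(\mathcal{H})$ and $\int_F\rho_x\,\mu_\rho(dx)=\mathfrak{M}(F)[\rho]$ for all $F\in\mathcal{F}$ (it exists by a theorem of Ozawa). Every instrument can be written as $\mathfrak{M}^*(F)[A]=V^*(A\otimes P(F))V$, $A\in\mathfrak{B}(\mathcal{H})$, with an isometry $V:\mathcal{H}\to\mathcal{H}\otimes\mathcal{H}_0$ and a spectral (projection-valued) measure $P$ on $\{X,\mathcal{F}\}$ in a Hilbert space $\mathcal{H}_0$. $\mathfrak{M}$ is efficient if it has such a representation with $P$ of multiplicity one, i.e. $P$ is unitarily equivalent to multiplication by indicator functions $\chi_F$ in $L_2(X,\mathcal{F},\nu)$ for some positive $\sigma$-finite measure $\nu$. Let $\mu_0$ be a positive complete ($\sigma$-finite) measure on $\{X,\mathcal{F}\}$ such that $\mu_\rho\ll\mu_0$ for all $\rho\in\mathfrak{S}(\mathcal{H})$. The channel $\Pi_{\mathfrak{M}}:\mathfrak{T}(\mathcal{H})\to L_1(X,\mathcal{F},\mu_0)$ is the preadjoint of $\Pi^*_{\mathfrak{M}}:L_\infty(X,\mathcal{F},\mu_0)\to\mathfrak{B}(\mathcal{H})$,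 $\mathrm{Tr}\,\rho\,\Pi^*_{\mathfrak{M}}(f)=\int_Xf(x)\,\mathrm{Tr}\,\mathfrak{M}(dx)[\rho]$. Its quantum mutual information at $\rho$ is $$I(\rho,\Pi_{\mathfrak{M}})=H\big(\Pi_{\mathfrak{M}}\otimes\mathrm{Id}_{\mathcal{K}}(\hat\rho)\,\|\,\Pi_{\mathfrak{M}}(\rho)\otimes\varrho\big),$$ where $\mathcal{K}\cong\mathcal{H}$, $\hat\rho$ is a purification of $\rho$ in $\mathcal{H}\otimes\mathcal{K}$, $\varrho=\mathrm{Tr}_{\mathcal{H}}\hat\rho$, and $H(\cdot\|\cdot)$ is the relative entropy of normal states on $L_\infty(X,\mathcal{F},\mu_0)\otimes\mathfrak{B}(\mathcal{K})$, viewed as elements of $L_1(X,\mathcal{F},\mu_0,\mathfrak{T}(\mathcal{K}))$; explicitly $H(\sigma_1\|\sigma_2)=\int_XH(\sigma_1(x)\|\sigma_2(x))\,\mu_0(dx)$. Here $\Pi_{\mathfrak{M}}\otimes\mathrm{Id}_{\mathcal{K}}(\hat\rho)$ is the class of functions $\sigma$ with $\int_F\sigma(x)\mu_0(dx)=\mathrm{Tr}_{\mathcal{H}}(\mathfrak{M}(F)\otimes\mathrm{Id}_{\mathcal{K}})[\hat\rho]$ for all $F\in\mathcal{F}$. *)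

theory Defs
  imports "HOL-Analysis.Analysis"
begin

text \<open>
  Separable complex Hilbert spaces. The topology, norm and completeness are those of the underlying
  real Hilbert space, whose inner product is the real part of the complex one.
  Following the convention in physics, \<open>cinner\<close> is conjugate-linear in its first argument.
\<close>

class separable_chilbert = real_inner + polish_space +
  fixes scaleC :: "complex \<Rightarrow> 'a \<Rightarrow> 'a"  (infixr \<open>*\<^sub>C\<close> 75)
    and cinner :: "'a \<Rightarrow> 'a \<Rightarrow> complex"
  assumes scaleC_add_right: "c *\<^sub>C (x + y) = c *\<^sub>C x + c *\<^sub>C y"
    and scaleC_add_left: "(c + d) *\<^sub>C x = c *\<^sub>C x + d *\<^sub>C x"
    and scaleC_scaleC: "c *\<^sub>C (d *\<^sub>C x) = (c * d) *\<^sub>C x"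
    and scaleC_of_real: "complex_of_real r *\<^sub>C x = r *\<^sub>R x"
    and cinner_commute: "cinner x y = cnj (cinner y x)"
    and cinner_add_right: "cinner x (y + z) = cinner x y + cinner x z"
    and cinner_scaleC_right: "cinner x (c *\<^sub>C y) = c * cinner x y"
    and Re_cinner: "Re (cinner x y) = inner x y"

definition is_onb :: "'a::separable_chilbert set \<Rightarrow> bool" where
  "is_onb B \<longleftrightarrow>
     (\<forall>e\<in>B. \<forall>f\<in>B. cinner e f = (if e = f then 1 else 0)) \<and>
     (\<forall>x. (\<forall>e\<in>B. cinner e x = 0) \<longrightarrow> x = 0)"


section \<open>Bounded operators\<close>

text \<open>
  The library's type of bounded real-linear maps is used as ambient type; bounded operators in the
  sense of complex Hilbert spaces are its complex-linear elements.
\<close>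

definition clinear_op :: "('a::separable_chilbert \<Rightarrow>\<^sub>L 'b::separable_chilbert) \<Rightarrow> bool" where
  "clinear_op A \<longleftrightarrow> (\<forall>c x. blinfun_apply A (c *\<^sub>C x) = c *\<^sub>C blinfun_apply A x)"

definition op_scaleC ::
    "complex \<Rightarrow> ('a::separable_chilbert \<Rightarrow>\<^sub>L 'b::separable_chilbert) \<Rightarrow> ('a \<Rightarrow>\<^sub>L 'b)" where
  "op_scaleC c A = Blinfun (\<lambda>x. c *\<^sub>C blinfun_apply A x)"

definition adj :: "('a::separable_chilbert \<Rightarrow>\<^sub>L 'b::separable_chilbert) \<Rightarrow> ('b \<Rightarrow>\<^sub>L 'a)" where
  "adj A = (THE B. \<forall>x y. cinner (blinfun_apply A x) y = cinner x (blinfun_apply B y))"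

definition ketbra :: "'a::separable_chilbert \<Rightarrow> 'b::separable_chilbert \<Rightarrow> ('b \<Rightarrow>\<^sub>L 'a)" where
  "ketbra u v = Blinfun (\<lambda>x. cinner v x *\<^sub>C u)"

definition isometry_op :: "('a::separable_chilbert \<Rightarrow>\<^sub>L 'b::separable_chilbert) \<Rightarrow> bool" where
  "isometry_op V \<longleftrightarrow> clinear_op V \<and> (\<forall>x. norm (blinfun_apply V x) = norm x)"

definition unitary_op :: "('a::separable_chilbert \<Rightarrow>\<^sub>L 'b::separable_chilbert) \<Rightarrow> bool" where
  "unitary_op U \<longleftrightarrow> isometry_op U \<and> surj (blinfun_apply U)"

definition projection_op :: "('a::separable_chilbert \<Rightarrow>\<^sub>L 'a) \<Rightarrow> bool" where
  "projection_op P \<longleftrightarrow> clinear_op P \<and> P o\<^sub>L P = P \<and>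
     (\<forall>x y. cinner (blinfun_apply P x) y = cinner x (blinfun_apply P y))"

definition positive_op :: "('a::separable_chilbert \<Rightarrow>\<^sub>L 'a) \<Rightarrow> bool" where
  "positive_op A \<longleftrightarrow> clinear_op A \<and> (\<forall>x. cinner x (blinfun_apply A x) \<in> \<real>\<^sub>\<ge>\<^sub>0)"


section \<open>Trace-class operators and states\<close>

text \<open>
  The trace norm as the supremum of $\sum_i |\langle e_i, A f_i\rangle|$ over pairs of finite
  orthonormal systems (it equals $\mathrm{Tr}|A|$, and is infinite iff $A$ is not trace class).
\<close>

definition orthonormal_upto :: "nat \<Rightarrow> (nat \<Rightarrow> 'a::separable_chilbert) \<Rightarrow> bool" where
  "orthonormal_upto n e \<longleftrightarrow> (\<forall>i<n. \<forall>j<n. cinner (e i) (e j) = (if i = j then 1 else 0))"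

definition trace_norm :: "('a::separable_chilbert \<Rightarrow>\<^sub>L 'a) \<Rightarrow> ennreal" where
  "trace_norm A =
     (SUP (n, e, f) \<in> {(n, e, f). orthonormal_upto n e \<and> orthonormal_upto n f}.
        \<Sum>i<n. ennreal (cmod (cinner (e i) (blinfun_apply A (f i)))))"

definition trace_class :: "('a::separable_chilbert \<Rightarrow>\<^sub>L 'a) \<Rightarrow> bool" where
  "trace_class A \<longleftrightarrow> clinear_op A \<and> trace_norm A < \<infinity>"

text \<open>For trace-class operators the value does not depend on the orthonormal basis.\<close>

definition trace :: "('a::separable_chilbert \<Rightarrow>\<^sub>L 'a) \<Rightarrow> complex" where
  "trace A = (\<Sum>\<^sub>\<infinity>e\<in>(SOME B. is_onb B). cinner e (blinfun_apply A e))"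

definition is_state :: "('a::separable_chilbert \<Rightarrow>\<^sub>L 'a) \<Rightarrow> bool" where
  "is_state \<rho> \<longleftrightarrow> positive_op \<rho> \<and> trace_class \<rho> \<and> trace \<rho> = 1"


section \<open>Entropy and relative entropy\<close>

text \<open>
  An orthonormal eigenbasis; it exists for positive trace-class operators, and the quantities
  defined through it below do not depend on its choice.
\<close>

definition eigenbasis :: "('a::separable_chilbert \<Rightarrow>\<^sub>L 'a) \<Rightarrow> 'a set" where
  "eigenbasis A = (SOME B. is_onb B \<and> (\<forall>e\<in>B. \<exists>c. blinfun_apply A e = c *\<^sub>C e))"

definition expval :: "('a::separable_chilbert \<Rightarrow>\<^sub>L 'a) \<Rightarrow> 'a \<Rightarrow> real" where
  "expval A x = Re (cinner x (blinfun_apply A x))"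

text \<open>On an eigenvector \<open>e\<close> of unit norm, \<open>expval \<rho> e\<close> is the eigenvalue; \<open>ln 0 = 0\<close>.\<close>

definition entropy :: "('a::separable_chilbert \<Rightarrow>\<^sub>L 'a) \<Rightarrow> ennreal" where
  "entropy \<rho> = (\<integral>\<^sup>+ e. ennreal (- (expval \<rho> e * ln (expval \<rho> e))) \<partial>count_space (eigenbasis \<rho>))"

definition supp :: "('a::separable_chilbert \<Rightarrow>\<^sub>L 'a) \<Rightarrow> 'a set" where
  "supp A = {x. \<forall>y. blinfun_apply A y = 0 \<longrightarrow> cinner y x = 0}"

text \<open>
  The quadratic form $\langle x|\log B|x\rangle = \sum_j \ln b_j\,|\langle j|x\rangle|^2$, the sum
  ranging over the eigenvectors of \<open>B\<close> with eigenvalue $b_j > 0$. The eigenvalues are bounded above,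
  so the first sum is finite and the value lies in $[-\infty,\infty)$.
\<close>

definition log_form :: "('a::separable_chilbert \<Rightarrow>\<^sub>L 'a) \<Rightarrow> 'a \<Rightarrow> ereal" where
  "log_form B x =
     enn2ereal (\<integral>\<^sup>+ j. ennreal (ln (expval B j) * (cmod (cinner j x))\<^sup>2)
        \<partial>count_space {j \<in> eigenbasis B. 0 < expval B j})
   - enn2ereal (\<integral>\<^sup>+ j. ennreal (- ln (expval B j) * (cmod (cinner j x))\<^sup>2)
        \<partial>count_space {j \<in> eigenbasis B. 0 < expval B j})"

text \<open>
  $\langle i|A\log B|i\rangle = a_i\langle i|\log B|i\rangle$ for an eigenvector \<open>i\<close> of \<open>A\<close> with
  eigenvalue $a_i$, where $0\cdot(-\infty) = 0$. All terms of the sum are nonnegative, so that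
  \<open>e2ennreal\<close> does not truncate.
\<close>

definition rel_entropy ::
    "('a::separable_chilbert \<Rightarrow>\<^sub>L 'a) \<Rightarrow> ('a \<Rightarrow>\<^sub>L 'a) \<Rightarrow> ennreal" where
  "rel_entropy A B =
     (if supp A \<subseteq> supp B
      then \<integral>\<^sup>+ i. e2ennreal (ereal (expval A i * ln (expval A i)) - ereal (expval A i) * log_form B i
                      + ereal (expval B i) - ereal (expval A i)) \<partial>count_space (eigenbasis A)
      else \<infinity>)"


section \<open>Tensor products\<close>

text \<open>
  The Hilbert space tensor product is determined up to a unique unitary by the following property
  of the map sending \<open>a\<close>, \<open>b\<close> to \<open>a \<otimes> b\<close>. The real span of the product vectors is already their
  complex span.
\<close>

definition hilbert_tensor ::
    "('a::separable_chilbert \<Rightarrow> 'b::separable_chilbert \<Rightarrow> 'c::separable_chilbert) \<Rightarrow> bool" where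
  "hilbert_tensor t \<longleftrightarrow>
     (\<forall>a a' b. t (a + a') b = t a b + t a' b) \<and>
     (\<forall>a b b'. t a (b + b') = t a b + t a b') \<and>
     (\<forall>c a b. t (c *\<^sub>C a) b = c *\<^sub>C t a b) \<and>
     (\<forall>c a b. t a (c *\<^sub>C b) = c *\<^sub>C t a b) \<and>
     (\<forall>a b a' b'. cinner (t a b) (t a' b') = cinner a a' * cinner b b') \<and>
     closure (span {t a b | a b. True}) = UNIV"

definition op_tensor ::
    "('a::separable_chilbert \<Rightarrow> 'b::separable_chilbert \<Rightarrow> 'c::separable_chilbert) \<Rightarrow>
     ('a \<Rightarrow>\<^sub>L 'a) \<Rightarrow> ('b \<Rightarrow>\<^sub>L 'b) \<Rightarrow> ('c \<Rightarrow>\<^sub>L 'c)" where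
  "op_tensor t A B =
     (THE C. clinear_op C \<and>
        (\<forall>a b. blinfun_apply C (t a b) = t (blinfun_apply A a) (blinfun_apply B b)))"

text \<open>
  The block $\langle k|W|l\rangle$ of an operator \<open>W\<close> on the tensor product, an operator on the first
  factor: $\langle h, \langle k|W|l\rangle h'\rangle = \langle h\otimes k, W(h'\otimes l)\rangle$;
  and likewise for the second factor.
\<close>

definition block1 ::
    "('a::separable_chilbert \<Rightarrow> 'b::separable_chilbert \<Rightarrow> 'c::separable_chilbert) \<Rightarrow>
     'b \<Rightarrow> 'b \<Rightarrow> ('c \<Rightarrow>\<^sub>L 'c) \<Rightarrow> ('a \<Rightarrow>\<^sub>L 'a)" where
  "block1 t k l W = adj (Blinfun (\<lambda>h. t h k)) o\<^sub>L W o\<^sub>L Blinfun (\<lambda>h. t h l)"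

definition block2 ::
    "('a::separable_chilbert \<Rightarrow> 'b::separable_chilbert \<Rightarrow> 'c::separable_chilbert) \<Rightarrow>
     'a \<Rightarrow> 'a \<Rightarrow> ('c \<Rightarrow>\<^sub>L 'c) \<Rightarrow> ('b \<Rightarrow>\<^sub>L 'b)" where
  "block2 t g h W = adj (Blinfun (\<lambda>k. t g k)) o\<^sub>L W o\<^sub>L Blinfun (\<lambda>k. t h k)"

text \<open>\<open>ptrace_snd\<close> traces out the second factor, \<open>ptrace_fst\<close> the first.\<close>

definition ptrace_snd ::
    "('a::separable_chilbert \<Rightarrow> 'b::separable_chilbert \<Rightarrow> 'c::separable_chilbert) \<Rightarrow>
     ('c \<Rightarrow>\<^sub>L 'c) \<Rightarrow> ('a \<Rightarrow>\<^sub>L 'a)" where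
  "ptrace_snd t W = (\<Sum>\<^sub>\<infinity>k\<in>(SOME B. is_onb B). block1 t k k W)"

definition ptrace_fst ::
    "('a::separable_chilbert \<Rightarrow> 'b::separable_chilbert \<Rightarrow> 'c::separable_chilbert) \<Rightarrow>
     ('c \<Rightarrow>\<^sub>L 'c) \<Rightarrow> ('b \<Rightarrow>\<^sub>L 'b)" where
  "ptrace_fst t W = (\<Sum>\<^sub>\<infinity>h\<in>(SOME B. is_onb B). block2 t h h W)"

text \<open>
  $(\Phi\otimes\mathrm{Id})[W]$: the map \<open>\<Phi>\<close> is applied to every block of \<open>W\<close>. On products this gives
  $(\Phi\otimes\mathrm{Id})[A\otimes B] = \Phi[A]\otimes B$, since $\langle k|A\otimes B|l\rangle =
  \langle k,Bl\rangle A$.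
\<close>

definition map_tensor_id ::
    "('a::separable_chilbert \<Rightarrow> 'b::separable_chilbert \<Rightarrow> 'c::separable_chilbert) \<Rightarrow>
     (('a \<Rightarrow>\<^sub>L 'a) \<Rightarrow> ('a \<Rightarrow>\<^sub>L 'a)) \<Rightarrow> ('c \<Rightarrow>\<^sub>L 'c) \<Rightarrow> ('c \<Rightarrow>\<^sub>L 'c)" where
  "map_tensor_id t \<Phi> W =
     (THE S. trace_class S \<and> (\<forall>k l. block1 t k l S = \<Phi> (block1 t k l W)))"

definition purification ::
    "('a::separable_chilbert \<Rightarrow> 'b::separable_chilbert \<Rightarrow> 'c::separable_chilbert) \<Rightarrow>
     ('a \<Rightarrow>\<^sub>L 'a) \<Rightarrow> ('c \<Rightarrow>\<^sub>L 'c) \<Rightarrow> bool" where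
  "purification t \<rho> \<omega> \<longleftrightarrow> (\<exists>\<psi>. norm \<psi> = 1 \<and> \<omega> = ketbra \<psi> \<psi> \<and> ptrace_snd t \<omega> = \<rho>)"


section \<open>Instruments\<close>

text \<open>
  Maps on trace-class operators are functions on all of the ambient operator type; only their values
  on trace-class operators matter.
\<close>

definition positive_block :: "nat \<Rightarrow> (nat \<Rightarrow> nat \<Rightarrow> ('a::separable_chilbert \<Rightarrow>\<^sub>L 'a)) \<Rightarrow> bool" where
  "positive_block n T \<longleftrightarrow>
     (\<forall>x. (\<Sum>i<n. \<Sum>j<n. cinner (x i) (blinfun_apply (T i j) (x j))) \<in> \<real>\<^sub>\<ge>\<^sub>0)"

definition completely_positive ::
    "(('a::separable_chilbert \<Rightarrow>\<^sub>L 'a) \<Rightarrow> ('a \<Rightarrow>\<^sub>L 'a)) \<Rightarrow> bool" where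
  "completely_positive \<Phi> \<longleftrightarrow>
     (\<forall>n T. (\<forall>i<n. \<forall>j<n. trace_class (T i j)) \<longrightarrow> positive_block n T \<longrightarrow>
        positive_block n (\<lambda>i j. \<Phi> (T i j)))"

definition operation :: "(('a::separable_chilbert \<Rightarrow>\<^sub>L 'a) \<Rightarrow> ('a \<Rightarrow>\<^sub>L 'a)) \<Rightarrow> bool" where
  "operation \<Phi> \<longleftrightarrow>
     (\<forall>T. trace_class T \<longrightarrow> trace_class (\<Phi> T)) \<and>
     (\<forall>S T. trace_class S \<longrightarrow> trace_class T \<longrightarrow> \<Phi> (S + T) = \<Phi> S + \<Phi> T) \<and>
     (\<forall>c T. trace_class T \<longrightarrow> \<Phi> (op_scaleC c T) = op_scaleC c (\<Phi> T)) \<and>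
     completely_positive \<Phi> \<and>
     (\<forall>T. trace_class T \<longrightarrow> positive_op T \<longrightarrow> Re (trace (\<Phi> T)) \<le> Re (trace T))"

text \<open>The measure argument \<open>X\<close> only serves as the measurable space of outcomes.\<close>

definition instrument ::
    "'x measure \<Rightarrow> ('x set \<Rightarrow> ('a::separable_chilbert \<Rightarrow>\<^sub>L 'a) \<Rightarrow> ('a \<Rightarrow>\<^sub>L 'a)) \<Rightarrow> bool" where
  "instrument X \<MM> \<longleftrightarrow>
     (\<forall>F\<in>sets X. operation (\<MM> F)) \<and>
     (\<forall>F T. range F \<subseteq> sets X \<longrightarrow> disjoint_family F \<longrightarrow> trace_class T \<longrightarrow>
        (\<lambda>n. trace_norm (\<MM> (\<Union>i. F i) T - (\<Sum>i<n. \<MM> (F i) T))) \<longlonglongrightarrow> 0) \<and>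
     (\<forall>T. trace_class T \<longrightarrow> trace (\<MM> (space X) T) = trace T)"

definition dual_map ::
    "(('a::separable_chilbert \<Rightarrow>\<^sub>L 'a) \<Rightarrow> ('a \<Rightarrow>\<^sub>L 'a)) \<Rightarrow> (('a \<Rightarrow>\<^sub>L 'a) \<Rightarrow> ('a \<Rightarrow>\<^sub>L 'a)) \<Rightarrow> bool" where
  "dual_map \<Phi> \<Psi> \<longleftrightarrow>
     (\<forall>A. clinear_op A \<longrightarrow> clinear_op (\<Psi> A) \<and>
        (\<forall>T. trace_class T \<longrightarrow> trace (A o\<^sub>L \<Phi> T) = trace (\<Psi> A o\<^sub>L T)))"

definition spectral_measure ::
    "'x measure \<Rightarrow> ('x set \<Rightarrow> ('a::separable_chilbert \<Rightarrow>\<^sub>L 'a)) \<Rightarrow> bool" where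
  "spectral_measure X P \<longleftrightarrow>
     (\<forall>F\<in>sets X. projection_op (P F)) \<and>
     P (space X) = id_blinfun \<and>
     (\<forall>F y. range F \<subseteq> sets X \<longrightarrow> disjoint_family F \<longrightarrow>
        (\<lambda>i. blinfun_apply (P (F i)) y) sums blinfun_apply (P (\<Union>i. F i)) y)"

definition square_integrable :: "'x measure \<Rightarrow> ('x \<Rightarrow> complex) \<Rightarrow> bool" where
  "square_integrable \<nu> f \<longleftrightarrow> f \<in> borel_measurable \<nu> \<and> integrable \<nu> (\<lambda>x. (cmod (f x))\<^sup>2)"

text \<open>
  A unitary from $L_2(\nu)$ onto a Hilbert space, as a map on representatives; the isometry
  condition makes it constant on almost-everywhere classes.
\<close>

definition L2_unitary :: "'x measure \<Rightarrow> (('x \<Rightarrow> complex) \<Rightarrow> 'a::separable_chilbert) \<Rightarrow> bool" where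
  "L2_unitary \<nu> U \<longleftrightarrow>
     (\<forall>f g. square_integrable \<nu> f \<longrightarrow> square_integrable \<nu> g \<longrightarrow>
        U (\<lambda>x. f x + g x) = U f + U g) \<and>
     (\<forall>c f. square_integrable \<nu> f \<longrightarrow> U (\<lambda>x. c * f x) = c *\<^sub>C U f) \<and>
     (\<forall>f. square_integrable \<nu> f \<longrightarrow> (norm (U f))\<^sup>2 = (\<integral>x. (cmod (f x))\<^sup>2 \<partial>\<nu>)) \<and>
     (\<forall>y. \<exists>f. square_integrable \<nu> f \<and> U f = y)"

definition multiplicity_one ::
    "'x measure \<Rightarrow> ('x set \<Rightarrow> ('a::separable_chilbert \<Rightarrow>\<^sub>L 'a)) \<Rightarrow> bool" where
  "multiplicity_one X P \<longleftrightarrow>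
     (\<exists>\<nu> U. sets \<nu> = sets X \<and> sigma_finite_measure \<nu> \<and> L2_unitary \<nu> U \<and>
        (\<forall>F\<in>sets X. \<forall>f. square_integrable \<nu> f \<longrightarrow>
           blinfun_apply (P F) (U f) = U (\<lambda>x. indicator F x * f x)))"

text \<open>
  The second factor of the tensor product \<open>t\<close> is the auxiliary space of the representation, so that
  the hypothesis \<open>efficient t X \<MM>\<close> with a free type for it ranges over all auxiliary spaces.
\<close>

definition efficient ::
    "('a::separable_chilbert \<Rightarrow> 'b::separable_chilbert \<Rightarrow> 'c::separable_chilbert) \<Rightarrow> 'x measure \<Rightarrow>
     ('x set \<Rightarrow> ('a \<Rightarrow>\<^sub>L 'a) \<Rightarrow> ('a \<Rightarrow>\<^sub>L 'a)) \<Rightarrow> bool" where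
  "efficient t X \<MM> \<longleftrightarrow>
     (\<exists>V P. isometry_op V \<and> spectral_measure X P \<and> multiplicity_one X P \<and>
        (\<forall>F\<in>sets X. dual_map (\<MM> F) (\<lambda>A. adj V o\<^sub>L op_tensor t A (P F) o\<^sub>L V)))"

definition posteriori_measure ::
    "'x measure \<Rightarrow> ('x set \<Rightarrow> ('a::separable_chilbert \<Rightarrow>\<^sub>L 'a) \<Rightarrow> ('a \<Rightarrow>\<^sub>L 'a)) \<Rightarrow> ('a \<Rightarrow>\<^sub>L 'a) \<Rightarrow>
     'x measure" where
  "posteriori_measure X \<MM> \<rho> =
     measure_of (space X) (sets X) (\<lambda>F. ennreal (Re (trace (\<MM> F \<rho>))))"

text \<open>
  The integral of a family of trace-class operators is taken weakly, against all bounded operators;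
  by separability of the trace class this is the Bochner integral.
\<close>

definition posteriori_states ::
    "'x measure \<Rightarrow> ('x set \<Rightarrow> ('a::separable_chilbert \<Rightarrow>\<^sub>L 'a) \<Rightarrow> ('a \<Rightarrow>\<^sub>L 'a)) \<Rightarrow> ('a \<Rightarrow>\<^sub>L 'a) \<Rightarrow>
     ('x \<Rightarrow> ('a \<Rightarrow>\<^sub>L 'a)) \<Rightarrow> bool" where
  "posteriori_states X \<MM> \<rho> r \<longleftrightarrow>
     (AE x in posteriori_measure X \<MM> \<rho>. is_state (r x)) \<and>
     (\<forall>A. clinear_op A \<longrightarrow> (\<lambda>x. trace (A o\<^sub>L r x)) \<in> borel_measurable X) \<and>
     (\<forall>A. clinear_op A \<longrightarrow> (\<forall>F\<in>sets X.
        (LINT x:F|posteriori_measure X \<MM> \<rho>. trace (A o\<^sub>L r x)) = trace (A o\<^sub>L \<MM> F \<rho>)))"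

definition entropy_reduction ::
    "'x measure \<Rightarrow> ('x set \<Rightarrow> ('a::separable_chilbert \<Rightarrow>\<^sub>L 'a) \<Rightarrow> ('a \<Rightarrow>\<^sub>L 'a)) \<Rightarrow> ('a \<Rightarrow>\<^sub>L 'a) \<Rightarrow>
     ('x \<Rightarrow> ('a \<Rightarrow>\<^sub>L 'a)) \<Rightarrow> ereal" where
  "entropy_reduction X \<MM> \<rho> r =
     enn2ereal (entropy \<rho>) - enn2ereal (\<integral>\<^sup>+ x. entropy (r x) \<partial>posteriori_measure X \<MM> \<rho>)"


section \<open>The quantum-classical channel and its mutual information\<close>

text \<open>Elements of $L_1(\mu_0,\mathfrak{T})$ with prescribed integrals over all measurable sets.\<close>

definition op_density ::
    "'x measure \<Rightarrow> ('x set \<Rightarrow> ('a::separable_chilbert \<Rightarrow>\<^sub>L 'a)) \<Rightarrow> ('x \<Rightarrow> ('a \<Rightarrow>\<^sub>L 'a)) \<Rightarrow> bool" where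
  "op_density \<mu>0 m \<sigma> \<longleftrightarrow>
     (\<forall>x\<in>space \<mu>0. trace_class (\<sigma> x)) \<and>
     (\<forall>A. clinear_op A \<longrightarrow> (\<lambda>x. trace (A o\<^sub>L \<sigma> x)) \<in> borel_measurable \<mu>0) \<and>
     (\<integral>\<^sup>+ x. trace_norm (\<sigma> x) \<partial>\<mu>0) < \<infinity> \<and>
     (\<forall>A. clinear_op A \<longrightarrow> (\<forall>F\<in>sets \<mu>0.
        (LINT x:F|\<mu>0. trace (A o\<^sub>L \<sigma> x)) = trace (A o\<^sub>L m F)))"

text \<open>
  Like \<open>RN_deriv\<close>, the next two definitions select representatives of almost-everywhere classes.
  On states, the channel yields the density of the posteriori measure.
\<close>

definition qc_channel ::
    "'x measure \<Rightarrow> 'x measure \<Rightarrow> ('x set \<Rightarrow> ('a::separable_chilbert \<Rightarrow>\<^sub>L 'a) \<Rightarrow> ('a \<Rightarrow>\<^sub>L 'a)) \<Rightarrow>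
     ('a \<Rightarrow>\<^sub>L 'a) \<Rightarrow> 'x \<Rightarrow> real" where
  "qc_channel \<mu>0 X \<MM> \<rho> x = enn2real (RN_deriv \<mu>0 (posteriori_measure X \<MM> \<rho>) x)"

definition qc_channel_tensor_id ::
    "('a::separable_chilbert \<Rightarrow> 'b::separable_chilbert \<Rightarrow> 'c::separable_chilbert) \<Rightarrow> 'x measure \<Rightarrow>
     ('x set \<Rightarrow> ('a \<Rightarrow>\<^sub>L 'a) \<Rightarrow> ('a \<Rightarrow>\<^sub>L 'a)) \<Rightarrow> ('c \<Rightarrow>\<^sub>L 'c) \<Rightarrow> 'x \<Rightarrow> ('b \<Rightarrow>\<^sub>L 'b)" where
  "qc_channel_tensor_id t \<mu>0 \<MM> \<omega> =
     (SOME \<sigma>. op_density \<mu>0 (\<lambda>F. ptrace_fst t (map_tensor_id t (\<MM> F) \<omega>)) \<sigma>)"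

definition qc_rel_entropy ::
    "'x measure \<Rightarrow> ('x \<Rightarrow> ('a::separable_chilbert \<Rightarrow>\<^sub>L 'a)) \<Rightarrow> ('x \<Rightarrow> ('a \<Rightarrow>\<^sub>L 'a)) \<Rightarrow> ennreal" where
  "qc_rel_entropy \<mu>0 \<sigma>1 \<sigma>2 = (\<integral>\<^sup>+ x. rel_entropy (\<sigma>1 x) (\<sigma>2 x) \<partial>\<mu>0)"

text \<open>The mutual information at \<open>\<rho>\<close>, computed from a purification \<open>\<omega>\<close> of \<open>\<rho>\<close>.\<close>

definition mutual_information ::
    "('a::separable_chilbert \<Rightarrow> 'b::separable_chilbert \<Rightarrow> 'c::separable_chilbert) \<Rightarrow> 'x measure \<Rightarrow>
     'x measure \<Rightarrow> ('x set \<Rightarrow> ('a \<Rightarrow>\<^sub>L 'a) \<Rightarrow> ('a \<Rightarrow>\<^sub>L 'a)) \<Rightarrow> ('a \<Rightarrow>\<^sub>L 'a) \<Rightarrow> ('c \<Rightarrow>\<^sub>L 'c) \<Rightarrow> ennreal" where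
  "mutual_information t \<mu>0 X \<MM> \<rho> \<omega> =
     qc_rel_entropy \<mu>0 (qc_channel_tensor_id t \<mu>0 \<MM> \<omega>)
       (\<lambda>x. qc_channel \<mu>0 X \<MM> \<rho> x *\<^sub>R ptrace_fst t \<omega>)"

end

theory Submission
  imports Defs
begin

text \<open>
  Let \<open>\<psi>\<close> be the purifying vector. Since the spectral measure has multiplicity one, the dilation
  of the instrument acts on \<open>L\<^sub>2(\<nu>)\<close> with values in the Hilbert space of the system, and applied to
  \<open>\<psi>\<close> it yields for almost every outcome \<open>x\<close> a vector in the tensor product. Its normalization \<open>\<xi> x\<close> has
  the posteriori state as the reduced state of the system, and the density of \<open>\<Pi> \<otimes> Id\<close> at the
  purification is \<open>p(x)\<close> times the reduced state \<open>s(x)\<close> of the reference, where \<open>p\<close> is the density of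
  the posteriori measure. The two reduced states of a pure state have the same nonzero spectrum, so
  \<open>H(\<rho>\<^sub>x) = H(s(x))\<close>. Pointwise, \<open>H(p s \<parallel> p R) + p H(s) = - p Tr s log R\<close> for the reduced state
  \<open>R\<close> of the purification. As \<open>R\<close> is the mean of the states \<open>s(x)\<close>, the right-hand side integrates
  to \<open>H(R) = H(\<rho>)\<close>, which is finite and may be subtracted from.
\<close>

text \<open>Efficiency speaks of the dual maps only, so \<open>\<MM> F T\<close> is accessible
  through its matrix elements, written as traces of T against operators compressed by the isometry.
  An \<open>L\<^sub>2\<close> representative is chosen separately for each vector and depends
  linearly on that vector only up to null sets. Hence the vector at an outcome is assembled from
  countably many coordinates, and identities are carried from a basis to all vectors after
  integration, where linearity is available again. Further obstacles are choices without regularity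
  and infinite values. Eigenbases of x-dependent states need not vary measurably; posteriori states
  and operator densities are arbitrary representatives; the relative entropy, the entropy and the
  cross term may each be infinite at single outcomes. Therefore measurability of the entropy is
  obtained from a formula in a fixed basis, representatives are compared through countably many
  matrix elements, and the pointwise identity is proved additively in
  \<open>[0,\<infinity>]\<close>.\<close>

instance separable_chilbert \<subseteq> banach ..

section \<open>Separable Hilbert spaces\<close>

lemma cinner_add_left: "cinner (x + y) z = cinner x z + cinner (y::'a::separable_chilbert) z"
  by (metis cinner_add_right cinner_commute complex_cnj_add)

lemma cinner_scaleC_left: "cinner (c *\<^sub>C x) (y::'a::separable_chilbert) = cnj c * cinner x y"
  by (metis cinner_commute cinner_scaleC_right complex_cnj_mult)

lemma cinner_scaleR_right: "cinner x (r *\<^sub>R (y::'a::separable_chilbert)) = r *\<^sub>R cinner x y"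
  by (metis cinner_scaleC_right scaleC_of_real scaleR_conv_of_real)

lemma cinner_scaleR_left: "cinner (r *\<^sub>R x) (y::'a::separable_chilbert) = r *\<^sub>R cinner x y"
  by (metis cinner_scaleC_left scaleC_of_real scaleR_conv_of_real complex_cnj_complex_of_real)

lemma cinner_self: "cinner x (x::'a::separable_chilbert) = of_real ((norm x)\<^sup>2)"
proof (rule complex_eqI)
  show "Re (cinner x x) = Re (of_real ((norm x)\<^sup>2))"
    by (simp add: Re_cinner power2_norm_eq_inner)
  have "Im (cinner x x) = - Im (cinner x x)"
    by (metis cinner_commute cnj.simps(2))
  then show "Im (cinner x x) = Im (of_real ((norm x)\<^sup>2))" by simp
qed

lemma norm_scaleC: "norm (c *\<^sub>C (x::'a::separable_chilbert)) = cmod c * norm x"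
proof -
  have "cinner (c *\<^sub>C x) (c *\<^sub>C x) = (c * cnj c) * cinner x x"
    by (simp add: cinner_scaleC_left cinner_scaleC_right)
  then have "complex_of_real ((norm (c *\<^sub>C x))\<^sup>2) = of_real ((cmod c * norm x)\<^sup>2)"
    by (simp only: cinner_self complex_norm_square[symmetric] of_real_mult[symmetric] power_mult_distrib)
  then have "(norm (c *\<^sub>C x))\<^sup>2 = (cmod c * norm x)\<^sup>2"
    using of_real_eq_iff by blast
  then show ?thesis by (simp add: power2_eq_iff_nonneg)
qed

lemma cmod_cinner_le: "cmod (cinner x y) \<le> norm x * norm (y::'a::separable_chilbert)"
proof (cases "cinner x y = 0")
  case False
  let ?c = "cinner x y"
  have "(cmod ?c)\<^sup>2 = Re (cinner x (cnj ?c *\<^sub>C y))"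
    by (metis cinner_scaleC_right complex_norm_square mult.commute Re_complex_of_real)
  also have "\<dots> \<le> norm x * norm (cnj ?c *\<^sub>C y)"
    by (simp add: Re_cinner norm_cauchy_schwarz)
  also have "\<dots> = cmod ?c * (norm x * norm y)" by (simp add: norm_scaleC)
  finally show ?thesis using False by (simp add: power2_eq_square)
qed simp

lemma bounded_bilinear_cinner:
  "bounded_bilinear (cinner :: 'a::separable_chilbert \<Rightarrow> 'a \<Rightarrow> complex)"
  by (rule bounded_bilinear.intro)
     (auto simp: cinner_add_left cinner_add_right cinner_scaleR_left cinner_scaleR_right
        intro!: exI[of _ 1] cmod_cinner_le)

lemma bounded_bilinear_scaleC:
  "bounded_bilinear (scaleC :: complex \<Rightarrow> 'a::separable_chilbert \<Rightarrow> 'a)"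
proof (rule bounded_bilinear.intro)
  show "(r *\<^sub>R a) *\<^sub>C b = r *\<^sub>R (a *\<^sub>C b)" for r a and b :: 'a
    by (metis scaleC_of_real scaleC_scaleC scaleR_conv_of_real)
  show "a *\<^sub>C (r *\<^sub>R b) = r *\<^sub>R (a *\<^sub>C b)" for r a and b :: 'a
    by (metis scaleC_of_real scaleC_scaleC mult.commute)
qed (auto simp: scaleC_add_left scaleC_add_right norm_scaleC intro!: exI[of _ 1])

interpretation cinner: bounded_bilinear "cinner :: 'a::separable_chilbert \<Rightarrow> 'a \<Rightarrow> complex"
  by (rule bounded_bilinear_cinner)
interpretation scaleC: bounded_bilinear "scaleC :: complex \<Rightarrow> 'a::separable_chilbert \<Rightarrow> 'a"
  by (rule bounded_bilinear_scaleC)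

declare cinner.zero_left [simp] cinner.zero_right [simp] scaleC.zero_left [simp] scaleC.zero_right [simp]

lemma scaleC_one [simp]: "1 *\<^sub>C x = (x::'a::separable_chilbert)"
  using scaleC_of_real[of 1 x] by simp

lemma cinner_eqI:
  assumes "\<And>z. cinner z x = cinner z y"
  shows "x = (y::'a::separable_chilbert)"
proof -
  have "cinner (x - y) (x - y) = 0" by (simp add: cinner.diff_right assms)
  then show ?thesis by (simp add: cinner_self)
qed

lemma cinner_zero_iff: "cinner x y = 0 \<longleftrightarrow> cinner y (x::'a::separable_chilbert) = 0"
  by (metis cinner_commute complex_cnj_zero_iff)

lemma cmod_cinner_commute: "cmod (cinner x y) = cmod (cinner y (x::'a::separable_chilbert))"
  by (metis cinner_commute complex_mod_cnj)

lemma cinner_mult_swap: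
  "cinner x y * cinner y x = of_real ((cmod (cinner y (x::'a::separable_chilbert)))\<^sup>2)"
  by (metis cinner_commute complex_norm_square mult.commute of_real_power)


subsection \<open>Orthonormal sets\<close>

definition orthonormal :: "'a::separable_chilbert set \<Rightarrow> bool" where
  "orthonormal B \<longleftrightarrow> (\<forall>e\<in>B. \<forall>f\<in>B. cinner e f = (if e = f then 1 else 0))"

lemma is_onb_orthonormal: "is_onb B \<Longrightarrow> orthonormal B"
  by (simp add: is_onb_def orthonormal_def)

lemma orthonormal_cinner:
  "orthonormal B \<Longrightarrow> e \<in> B \<Longrightarrow> f \<in> B \<Longrightarrow> cinner e f = (if e = f then 1 else 0)"
  unfolding orthonormal_def by blast

lemma orthonormal_norm: "orthonormal B \<Longrightarrow> e \<in> B \<Longrightarrow> norm e = 1"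
proof -
  assume "orthonormal B" "e \<in> B"
  then have "complex_of_real ((norm e)\<^sup>2) = of_real 1"
    unfolding cinner_self[symmetric] by (simp add: orthonormal_def)
  then have "(norm e)\<^sup>2 = 1" using of_real_eq_iff by blast
  then show ?thesis by (simp add: power2_eq_1_iff)
     (metis norm_ge_zero neg_0_le_iff_le not_one_le_zero)
qed

lemma cinner_sum_orthonormal:
  assumes "orthonormal B" "finite J" "J \<subseteq> B" "e \<in> B"
  shows "cinner e (\<Sum>f\<in>J. c f *\<^sub>C f) = (if e \<in> J then c e else 0)"
proof -
  have "cinner e (\<Sum>f\<in>J. c f *\<^sub>C f) = (\<Sum>f\<in>J. if e = f then c f else 0)"
    unfolding cinner.sum_right
    by (rule sum.cong) (use assms in \<open>auto simp: cinner_scaleC_right orthonormal_cinner[OF assms(1)] subset_iff\<close>)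
  then show ?thesis using assms(2) by simp
qed

lemma norm_sum_orthonormal:
  assumes "orthonormal B" "finite J" "J \<subseteq> B"
  shows "(norm (\<Sum>e\<in>J. c e *\<^sub>C e))\<^sup>2 = (\<Sum>e\<in>J. (cmod (c e))\<^sup>2)"
proof -
  let ?s = "\<Sum>e\<in>J. c e *\<^sub>C e"
  have "complex_of_real ((norm ?s)\<^sup>2) = (\<Sum>e\<in>J. cinner (c e *\<^sub>C e) ?s)"
    by (simp only: cinner_self[symmetric] cinner.sum_left)
  also have "\<dots> = (\<Sum>e\<in>J. of_real ((cmod (c e))\<^sup>2))"
    using assms by (intro sum.cong refl)
      (auto simp: cinner_scaleC_left cinner_sum_orthonormal[OF assms] complex_norm_square mult.commute simp del: of_real_power)
  also have "\<dots> = of_real (\<Sum>e\<in>J. (cmod (c e))\<^sup>2)" by simp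
  finally show ?thesis using of_real_eq_iff by blast
qed

lemma bessel_finite:
  assumes "orthonormal B" "finite J" "J \<subseteq> B"
  shows "(\<Sum>e\<in>J. (cmod (cinner e x))\<^sup>2) \<le> (norm x)\<^sup>2"
proof -
  let ?s = "\<Sum>e\<in>J. cinner e x *\<^sub>C e"
  let ?N = "\<Sum>e\<in>J. (cmod (cinner e x))\<^sup>2"
  have "cinner ?s x = (\<Sum>e\<in>J. of_real ((cmod (cinner e x))\<^sup>2))"
    unfolding cinner.sum_left
    by (intro sum.cong refl) (simp add: cinner_scaleC_left complex_norm_square mult.commute del: of_real_power)
  then have c: "cinner ?s x = of_real ?N" by simp
  have "?N = inner ?s x" by (metis Re_cinner Re_complex_of_real c)
  also have "\<dots> \<le> norm ?s * norm x" by (rule norm_cauchy_schwarz)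
  finally have "?N \<le> norm ?s * norm x" .
  moreover have "(norm ?s)\<^sup>2 = ?N" by (rule norm_sum_orthonormal[OF assms])
  ultimately have "norm ?s * norm ?s \<le> norm ?s * norm x"
    by (simp only: power2_eq_square)
  then have "norm ?s \<le> norm x"
    by (cases "norm ?s = 0") (auto simp: mult_le_cancel_left)
  then have "(norm ?s)\<^sup>2 \<le> (norm x)\<^sup>2" by (simp add: power_mono)
  then show ?thesis using \<open>(norm ?s)\<^sup>2 = ?N\<close> by linarith
qed

text \<open>Distinct members lie at distance sqrt 2, so the balls of radius 1/2 around them are
  disjoint open sets, of which a separable space has only countably many.\<close>

lemma orthonormal_countable:
  fixes B :: "'a::separable_chilbert set"
  assumes B: "orthonormal B"
  shows "countable B"
proof -
  have d: "2 \<le> (dist e f)\<^sup>2" if "e \<in> B" "f \<in> B" "e \<noteq> f" for e f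
  proof -
    have "inner e f = 0"
      using orthonormal_cinner[OF B that(1,2)] that(3) by (metis Re_cinner zero_complex.sel(1))
    then have "(dist e f)\<^sup>2 = (norm e)\<^sup>2 + (norm f)\<^sup>2"
      by (simp add: dist_norm power2_norm_eq_inner inner_diff inner_commute)
    then show ?thesis using orthonormal_norm[OF B] that by simp
  qed
  have pw: "ball e (1/2) \<inter> ball f (1/2) = {}" if "e \<in> B" "f \<in> B" "e \<noteq> f" for e f
  proof (rule ccontr)
    assume "\<not> ?thesis"
    then obtain z where "dist e z < 1/2" "dist f z < 1/2" by auto
    then have "dist e f < 1" by (metis dist_triangle_half_l dist_commute)
    then have "(dist e f)\<^sup>2 < 1\<^sup>2" by (intro power_strict_mono) auto
    then show False using d[OF that] by simp
  qed
  have "countable ((\<lambda>e. ball e (1/2)) ` B)"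
    by (rule countable_disjoint_open_subsets)
       (auto simp: pairwise_def disjnt_def dest: pw)
  moreover have "inj_on (\<lambda>e. ball e (1/2)) B"
  proof (rule inj_onI, rule ccontr)
    fix e f assume "e \<in> B" "f \<in> B" "ball e (1/2) = ball f (1/2)" "e \<noteq> f"
    with pw[of e f] have "ball e (1/2) = {}" by auto
    then show False by simp
  qed
  ultimately show ?thesis by (rule countable_image_inj_on)
qed

text \<open>Zorn's lemma. Maximality is tested on the unit vectors of Q: with Q the whole space it
  yields bases extending a given system, with Q the set of eigenvectors of an operator it drives the
  spectral theorem.\<close>

lemma maximal_orthonormal:
  assumes "orthonormal A" "A \<subseteq> Q"
  obtains B where "A \<subseteq> B" "orthonormal B" "B \<subseteq> Q"
    "\<And>x. x \<in> Q \<Longrightarrow> norm x = 1 \<Longrightarrow> \<exists>e\<in>B. cinner e x \<noteq> 0"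
proof -
  let ?A = "{B. A \<subseteq> B \<and> orthonormal B \<and> B \<subseteq> Q}"
  have "\<exists>M\<in>?A. \<forall>X\<in>?A. M \<subseteq> X \<longrightarrow> X = M"
  proof (rule subset_Zorn_nonempty)
    show "?A \<noteq> {}" using assms by blast
    fix C assume C: "C \<noteq> {}" "subset.chain ?A C"
    have "orthonormal (\<Union>C)"
      unfolding orthonormal_def
    proof (intro ballI)
      fix e f assume "e \<in> \<Union>C" "f \<in> \<Union>C"
      then obtain X Y where XY: "X \<in> C" "Y \<in> C" "e \<in> X" "f \<in> Y" by blast
      then have "X \<subseteq> Y \<or> Y \<subseteq> X" using C unfolding subset.chain_def by blast
      then obtain Z where "Z \<in> C" "e \<in> Z" "f \<in> Z" using XY by blast
      moreover have "orthonormal Z" using \<open>Z \<in> C\<close> C unfolding subset.chain_def by blast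
      ultimately show "cinner e f = (if e = f then 1 else 0)" by (simp add: orthonormal_def)
    qed
    moreover have "A \<subseteq> \<Union>C" "\<Union>C \<subseteq> Q" using C unfolding subset.chain_def by blast+
    ultimately show "\<Union>C \<in> ?A" by blast
  qed
  then obtain B where "B \<in> ?A" and mx0: "\<forall>X\<in>?A. B \<subseteq> X \<longrightarrow> X = B" by (elim bexE)
  then have B: "A \<subseteq> B" "orthonormal B" "B \<subseteq> Q" by simp_all
  have mx: "X = B" if "A \<subseteq> X" "orthonormal X" "X \<subseteq> Q" "B \<subseteq> X" for X
    using mx0 that by simp
  have "\<exists>e\<in>B. cinner e x \<noteq> 0" if x: "x \<in> Q" "norm x = 1" for x
  proof (rule ccontr)
    assume n: "\<not> ?thesis"
    then have o: "\<And>e. e \<in> B \<Longrightarrow> cinner e x = 0 \<and> cinner x e = 0"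
      using cinner_zero_iff by blast
    have xx: "cinner x x = 1" using x by (simp add: cinner_self)
    have "orthonormal (insert x B)"
      unfolding orthonormal_def
    proof (intro ballI)
      fix e f assume "e \<in> insert x B" "f \<in> insert x B"
      moreover have "x \<notin> B" using o[of x] xx by auto
      ultimately show "cinner e f = (if e = f then 1 else 0)"
        using o[of e] o[of f] xx orthonormal_cinner[OF B(2), of e f] by (cases "e = x"; cases "f = x") auto
    qed
    then have "insert x B = B" by (intro mx) (use B(1,3) x(1) in auto)
    then have "x \<in> B" by blast
    then show False using o[of x] xx by simp
  qed
  then show ?thesis using that B by blast
qed

lemma orthonormal_extend:
  assumes "orthonormal A"
  obtains B where "A \<subseteq> B" "is_onb B"
proof -
  obtain B where B: "A \<subseteq> B" "orthonormal B"
    and mx: "\<And>x. norm x = 1 \<Longrightarrow> \<exists>e\<in>B. cinner e x \<noteq> 0"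
    using maximal_orthonormal[OF assms, of UNIV] by auto
  have "x = 0" if "\<forall>e\<in>B. cinner e x = 0" for x
  proof (rule ccontr)
    assume "x \<noteq> 0"
    then have "norm ((1 / norm x) *\<^sub>R x) = 1" by simp
    with mx obtain e where "e \<in> B" "cinner e ((1 / norm x) *\<^sub>R x) \<noteq> 0" by blast
    then show False using that by (simp add: cinner_scaleR_right)
  qed
  then have "is_onb B" using B(2) unfolding is_onb_def orthonormal_def by blast
  then show ?thesis using that B(1) by blast
qed

lemma is_onb_some: "is_onb (SOME B. is_onb (B :: 'a::separable_chilbert set))"
proof (rule someI_ex)
  show "\<exists>B. is_onb (B :: 'a set)"
    using orthonormal_extend[of "{}"] by (auto simp: orthonormal_def)
qed


subsection \<open>Expansions\<close>

text \<open>Unconditional sums serve for vectors and complex numbers; integrals over the counting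
  measure serve for nonnegative terms, where infinite values are allowed and countable sums and
  integrals can be exchanged. This is the passage from the former to the latter.\<close>

lemma has_sum_imp_nn_integral:
  fixes f :: "'a \<Rightarrow> real"
  assumes "(f has_sum s) A" "\<And>x. x \<in> A \<Longrightarrow> 0 \<le> f x"
  shows "(\<integral>\<^sup>+ x. ennreal (f x) \<partial>count_space A) = ennreal s"
proof -
  have "f summable_on A" using assms(1) has_sum_imp_summable by blast
  then have "Infinite_Set_Sum.abs_summable_on f A"
    using summable_on_iff_abs_summable_on_real abs_summable_equivalent by blast
  then show ?thesis
    using nn_integral_conv_infsetsum[of f A] infsetsum_infsum[of f A] assms infsumI by metis
qed

lemma nn_integral_imp_summable:
  fixes f :: "'a \<Rightarrow> real"
  assumes "(\<integral>\<^sup>+ x. ennreal (f x) \<partial>count_space A) < \<infinity>" "\<And>x. x \<in> A \<Longrightarrow> 0 \<le> f x"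
  shows "f summable_on A"
proof -
  have "integrable (count_space A) f"
    using assms by (intro integrableI_nonneg) (auto simp: AE_count_space)
  then show ?thesis
    using summable_on_iff_abs_summable_on_real abs_summable_equivalent
    unfolding Infinite_Set_Sum.abs_summable_on_def by blast
qed

text \<open>The partial sums form a Cauchy filter: beyond a suitable finite set J, the squared norm
  of a difference of partial sums is a piece of the tail of the scalar series.\<close>

lemma orthonormal_summable:
  assumes B: "orthonormal B" and c: "(\<lambda>e. (cmod (c e))\<^sup>2) summable_on B"
  shows "(\<lambda>e. c e *\<^sub>C e) summable_on B"
proof -
  let ?f = "\<lambda>e. c e *\<^sub>C e" and ?g = "\<lambda>e. (cmod (c e))\<^sup>2"
  have "\<exists>P. eventually P (finite_subsets_at_top B) \<and>
              (\<forall>F F'. P F \<and> P F' \<longrightarrow> dist (sum ?f F) (sum ?f F') < \<epsilon>)" if "\<epsilon> > 0" for \<epsilon>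
  proof -
    from that have "(\<epsilon>/2)\<^sup>2 > 0" by simp
    \<comment> \<open>The approximation bound is weak; the additional factor 1/2 makes the estimate
      \<open>near\<close> strict.\<close>
    then obtain J where J: "finite J" "J \<subseteq> B" "dist (sum ?g J) (infsum ?g B) \<le> (\<epsilon>/2)\<^sup>2 / 2"
      using infsum_finite_approximation[OF c, of "(\<epsilon>/2)\<^sup>2 / 2"] by auto
    define P where "P F \<longleftrightarrow> finite F \<and> J \<subseteq> F \<and> F \<subseteq> B" for F
    have near: "dist (sum ?f F) (sum ?f J) < \<epsilon> / 2" if "P F" for F
    proof -
      have F: "finite F" "J \<subseteq> F" "F \<subseteq> B" using that by (auto simp: P_def)
      have "(dist (sum ?f F) (sum ?f J))\<^sup>2 = (norm (sum ?f (F - J)))\<^sup>2"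
        using F by (simp add: dist_norm sum_diff)
      also have "\<dots> = sum ?g (F - J)"
        using F by (intro norm_sum_orthonormal[OF B]) auto
      also have "\<dots> = sum ?g F - sum ?g J" using F by (simp add: sum_diff)
      also have "\<dots> \<le> infsum ?g B - sum ?g J"
        using finite_sum_le_infsum[OF c, of F] F by auto
      also have "\<dots> \<le> (\<epsilon>/2)\<^sup>2 / 2" using J(3) unfolding dist_real_def by linarith
      also have "\<dots> < (\<epsilon>/2)\<^sup>2" using \<open>(\<epsilon>/2)\<^sup>2 > 0\<close> by linarith
      finally show ?thesis using \<open>\<epsilon> > 0\<close> by (meson half_gt_zero less_imp_le power_less_imp_less_base)
    qed
    have "eventually P (finite_subsets_at_top B)"
      unfolding eventually_finite_subsets_at_top P_def using J by blast
    moreover have "dist (sum ?f F) (sum ?f F') < \<epsilon>" if "P F" "P F'" for F F'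
      by (rule dist_triangle_half_l[OF near[OF that(1)] near[OF that(2)]])
    ultimately show ?thesis by blast
  qed
  then have "cauchy_filter (filtermap (sum ?f) (finite_subsets_at_top B))"
    by (simp add: cauchy_filter_metric_filtermap)
  moreover have "complete (UNIV::'a set)"
    by (meson Cauchy_convergent UNIV_I complete_def convergent_def)
  ultimately obtain L where "(sum ?f \<longlongrightarrow> L) (finite_subsets_at_top B)"
    using complete_uniform[where S=UNIV] by (force simp add: filterlim_def)
  then show ?thesis using summable_on_def has_sum_def by blast
qed

lemma cinner_infsum_orthonormal:
  assumes B: "orthonormal B" and c: "(\<lambda>e. (cmod (c e))\<^sup>2) summable_on B" and e: "e \<in> B"
  shows "cinner e (\<Sum>\<^sub>\<infinity>f\<in>B. c f *\<^sub>C f) = c e"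
proof -
  have "((\<lambda>f. cinner e (c f *\<^sub>C f)) has_sum cinner e (\<Sum>\<^sub>\<infinity>f\<in>B. c f *\<^sub>C f)) B"
    by (intro has_sum_bounded_linear[OF cinner.bounded_linear_right] has_sum_infsum
        orthonormal_summable assms)
  moreover have "((\<lambda>f. cinner e (c f *\<^sub>C f)) has_sum c e) B"
  proof (rule has_sum_finite_neutralI[where B = "{e}"])
    show "c e = (\<Sum>f\<in>{e}. cinner e (c f *\<^sub>C f))"
      using e B by (simp add: cinner_scaleC_right orthonormal_cinner)
  qed (use e B in \<open>auto simp: cinner_scaleC_right orthonormal_cinner\<close>)
  ultimately show ?thesis by (rule has_sum_unique)
qed

lemma bessel_summable:
  assumes "orthonormal B"
  shows "(\<lambda>e. (cmod (cinner e x))\<^sup>2) summable_on B"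
  by (rule nonneg_bdd_above_summable_on)
     (auto intro!: bdd_aboveI2[where M = "(norm x)\<^sup>2"] bessel_finite[OF assms])

lemma riesz_fischer:
  assumes "orthonormal B" "(\<integral>\<^sup>+ e. ennreal ((cmod (c e))\<^sup>2) \<partial>count_space B) < \<infinity>"
  shows "\<exists>z. \<forall>e\<in>B. cinner e z = c e"
  using cinner_infsum_orthonormal[OF assms(1), of c] nn_integral_imp_summable[OF assms(2)] by auto

lemma onb_expand:
  assumes "is_onb B"
  shows "((\<lambda>e. cinner e x *\<^sub>C e) has_sum x) B"
proof -
  have B: "orthonormal B" using assms by (rule is_onb_orthonormal)
  let ?y = "\<Sum>\<^sub>\<infinity>e\<in>B. cinner e x *\<^sub>C e"
  have "\<forall>e\<in>B. cinner e (x - ?y) = 0"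
    by (simp add: cinner.diff_right cinner_infsum_orthonormal[OF B bessel_summable[OF B]])
  then have "x - ?y = 0" using assms unfolding is_onb_def by blast
  then show ?thesis
    using has_sum_infsum[OF orthonormal_summable[OF B bessel_summable[OF B, of x]]] by simp
qed

lemma onb_eqI:
  assumes "is_onb B" "\<And>e. e \<in> B \<Longrightarrow> cinner e x = cinner e y"
  shows "x = y"
proof -
  have "\<forall>e\<in>B. cinner e (x - y) = 0" using assms(2) by (simp add: cinner.diff_right)
  then show ?thesis using assms(1) unfolding is_onb_def by auto
qed

lemma parseval:
  assumes "is_onb B"
  shows "((\<lambda>e. cinner x e * cinner e y) has_sum cinner x y) B"
  using has_sum_bounded_linear[OF cinner.bounded_linear_right onb_expand[OF assms, of y], of x]
  by (simp add: cinner_scaleC_right mult.commute)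

lemma parseval_norm:
  assumes "is_onb B"
  shows "((\<lambda>e. (cmod (cinner e x))\<^sup>2) has_sum (norm x)\<^sup>2) B"
  using has_sum_Re[OF parseval[OF assms, of x x]]
  by (simp add: cinner_mult_swap cinner_self del: of_real_power)

lemma parseval_nn:
  assumes "is_onb B"
  shows "(\<integral>\<^sup>+ e. ennreal ((cmod (cinner e x))\<^sup>2) \<partial>count_space B) = ennreal ((norm x)\<^sup>2)"
  by (rule has_sum_imp_nn_integral[OF parseval_norm[OF assms]]) simp

lemma nn_integral_count_space_subset_mono:
  assumes "A \<subseteq> B"
  shows "(\<integral>\<^sup>+ x. f x \<partial>count_space A) \<le> (\<integral>\<^sup>+ x. f x \<partial>count_space B)"
proof -
  have "(\<integral>\<^sup>+ x. f x * indicator A x \<partial>count_space UNIV) \<le> (\<integral>\<^sup>+ x. f x * indicator B x \<partial>count_space UNIV)"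
    using assms by (intro nn_integral_mono) (auto simp: indicator_def)
  then show ?thesis
    using nn_integral_restrict_space[of A "count_space UNIV" f] nn_integral_restrict_space[of B "count_space UNIV" f]
    by (simp add: restrict_count_space)
qed

lemma clinear_ext_onb:
  fixes f :: "'a::separable_chilbert \<Rightarrow> 'b::separable_chilbert"
  assumes "is_onb B" "bounded_linear f" "bounded_linear g"
    and "\<And>c x. f (c *\<^sub>C x) = c *\<^sub>C f x" "\<And>c x. g (c *\<^sub>C x) = c *\<^sub>C g x"
    and "\<And>e. e \<in> B \<Longrightarrow> f e = g e"
  shows "f x = g x"
proof -
  have "((\<lambda>e. cinner e x *\<^sub>C f e) has_sum f x) B" "((\<lambda>e. cinner e x *\<^sub>C g e) has_sum g x) B"
    using has_sum_bounded_linear[OF assms(2) onb_expand[OF assms(1), of x]]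
      has_sum_bounded_linear[OF assms(3) onb_expand[OF assms(1), of x]] assms(4,5) by auto
  moreover have "((\<lambda>e. cinner e x *\<^sub>C f e) has_sum g x) B \<longleftrightarrow> ((\<lambda>e. cinner e x *\<^sub>C g e) has_sum g x) B"
    by (rule has_sum_cong) (simp add: assms(6))
  ultimately show ?thesis using has_sum_unique by metis
qed

section \<open>Operators\<close>

lemma clinear_opD: "clinear_op A \<Longrightarrow> A (c *\<^sub>C x) = c *\<^sub>C A x"
  by (simp add: clinear_op_def)

text \<open>The candidate has the coordinates \<open>cnj (f e)\<close>. On a finite section s of its
  expansion f takes the value \<open>(norm s)\<^sup>2\<close>, so boundedness of f bounds the norm
  of s by K, and the coordinates are square summable.\<close>

lemma riesz_representation:
  fixes f :: "'a::separable_chilbert \<Rightarrow> complex"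
  assumes f: "bounded_linear f" and fC: "\<And>c x. f (c *\<^sub>C x) = c * f x"
  shows "\<exists>z. \<forall>x. f x = cinner z x"
proof -
  obtain B :: "'a set" where B: "is_onb B" using is_onb_some by blast
  have o: "orthonormal B" using B by (rule is_onb_orthonormal)
  obtain K where K: "\<And>x. cmod (f x) \<le> norm x * K" "0 < K"
    using bounded_linear.pos_bounded[OF f] by blast
  have "(\<lambda>e. (cmod (cnj (f e)))\<^sup>2) summable_on B"
  proof (rule nonneg_bdd_above_summable_on, simp, rule bdd_aboveI2[where M = "K\<^sup>2"])
    fix J assume "J \<in> {F. F \<subseteq> B \<and> finite F}"
    then have J: "finite J" "J \<subseteq> B" by auto
    let ?s = "\<Sum>e\<in>J. cnj (f e) *\<^sub>C e" and ?N = "\<Sum>e\<in>J. (cmod (cnj (f e)))\<^sup>2"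
    have "f ?s = (\<Sum>e\<in>J. of_real ((cmod (cnj (f e)))\<^sup>2))"
      unfolding linear_sum[OF bounded_linear.linear[OF f]]
      by (intro sum.cong refl) (simp add: fC complex_norm_square mult.commute del: of_real_power)
    then have fs: "f ?s = of_real ?N" by simp
    have n: "(norm ?s)\<^sup>2 = ?N" by (rule norm_sum_orthonormal[OF o J])
    have "cmod (f ?s) = ?N" unfolding fs norm_of_real by (simp add: sum_nonneg)
    then have "?N \<le> norm ?s * K" using K(1)[of ?s] by simp
    then have "norm ?s * norm ?s \<le> norm ?s * K" using n by (simp only: power2_eq_square)
    then have "norm ?s \<le> K" using K(2) by (cases "norm ?s = 0") (auto simp: mult_le_cancel_left)
    then have "(norm ?s)\<^sup>2 \<le> K\<^sup>2" by (simp add: power_mono)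
    then show "?N \<le> K\<^sup>2" using n by linarith
  qed
  note summ = this
  define z where "z = (\<Sum>\<^sub>\<infinity>e\<in>B. cnj (f e) *\<^sub>C e)"
  have z: "\<And>e. e \<in> B \<Longrightarrow> cinner e z = cnj (f e)"
    unfolding z_def by (rule cinner_infsum_orthonormal[OF o summ])
  have "f x = cinner z x" for x
  proof -
    have "((\<lambda>e. cinner e x * f e) has_sum f x) B"
      using has_sum_bounded_linear[OF f onb_expand[OF B, of x]] by (simp add: fC)
    moreover have "((\<lambda>e. cinner z e * cinner e x) has_sum cinner z x) B"
      by (rule parseval[OF B])
    moreover have "cinner z e * cinner e x = cinner e x * f e" if "e \<in> B" for e
      using z[OF that] cinner_commute[of z e] by simp
    ultimately show ?thesis using has_sum_unique has_sum_cong by (metis (no_types, lifting))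
  qed
  then show ?thesis by blast
qed

text \<open>Riesz representation gives the value of the adjoint at each y separately; linearity
  follows because a vector is determined by its inner products, and the norm bound comes from
  testing at \<open>x = g y\<close>.\<close>

lemma adj_ex:
  fixes A :: "'a::separable_chilbert \<Rightarrow>\<^sub>L 'b::separable_chilbert"
  assumes A: "clinear_op A"
  shows "\<exists>B. clinear_op B \<and> (\<forall>x y. cinner (A x) y = cinner x (B y))"
proof -
  have "\<exists>z. \<forall>x. cinner y (A x) = cinner z x" for y
    by (rule riesz_representation)
      (auto simp: clinear_opD[OF A] cinner_scaleC_right
        intro!: bounded_linear_compose[OF cinner.bounded_linear_right] blinfun.bounded_linear_right)
  then obtain g where "\<And>y x. cinner y (A x) = cinner (g y) x" by metis
  then have g: "\<And>y x. cinner (A x) y = cinner x (g y)"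
    by (metis cinner_commute)
  have gC: "g (c *\<^sub>C y) = c *\<^sub>C g y" for c y
    by (rule cinner_eqI) (simp add: g[symmetric] cinner_scaleC_right)
  have bl: "bounded_linear g"
  proof (rule bounded_linear_intro[where K = "norm A"])
    show "g (x + y) = g x + g y" for x y
      by (rule cinner_eqI) (simp add: g[symmetric] cinner_add_right)
    show "g (r *\<^sub>R x) = r *\<^sub>R g x" for r x
      by (rule cinner_eqI) (simp add: g[symmetric] cinner_scaleR_right)
    show "norm (g y) \<le> norm y * norm A" for y
    proof -
      have "(norm (g y))\<^sup>2 = cmod (cinner (g y) (g y))"
        unfolding cinner_self norm_of_real by simp
      also have "\<dots> = cmod (cinner (A (g y)) y)" by (simp add: g)
      also have "\<dots> \<le> norm (A (g y)) * norm y" by (rule cmod_cinner_le)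
      also have "\<dots> \<le> (norm A * norm (g y)) * norm y"
        by (intro mult_right_mono norm_blinfun) simp
      finally have "norm (g y) * norm (g y) \<le> norm (g y) * (norm y * norm A)"
        by (simp add: power2_eq_square mult_ac)
      then show ?thesis by (cases "norm (g y) = 0") (auto simp: mult_le_cancel_left)
    qed
  qed
  show ?thesis
    by (rule exI[of _ "Blinfun g"])
      (simp add: bounded_linear_Blinfun_apply[OF bl] clinear_op_def gC g)
qed

lemma adj_props:
  assumes "clinear_op A"
  shows "clinear_op (adj A) \<and> (\<forall>x y. cinner (A x) y = cinner x (blinfun_apply (adj A) y))"
proof -
  obtain B where B: "clinear_op B" "\<forall>x y. cinner (A x) y = cinner x (B y)"
    using adj_ex[OF assms] by blast
  have "adj A = B"
    unfolding adj_def
  proof (rule the_equality)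
    fix C assume "\<forall>x y. cinner (blinfun_apply A x) y = cinner x (blinfun_apply C y)"
    then show "C = B" using B(2) by (intro blinfun_eqI cinner_eqI) metis
  qed (rule B(2))
  then show ?thesis using B by blast
qed

lemma clinear_op_adj: "clinear_op A \<Longrightarrow> clinear_op (adj A)"
  using adj_props by blast

lemma cinner_adj_right: "clinear_op A \<Longrightarrow> cinner x (blinfun_apply (adj A) y) = cinner (A x) y"
  using adj_props by metis

lemma cinner_adj_left: "clinear_op A \<Longrightarrow> cinner (blinfun_apply (adj A) x) y = cinner x (A y)"
  using cinner_adj_right[of A y x] cinner_commute by metis

lemma blinfun_apply_ketbra: "blinfun_apply (ketbra u v) x = cinner v x *\<^sub>C u"
  unfolding ketbra_def
  by (subst bounded_linear_Blinfun_apply)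
    (auto intro!: bounded_linear_compose[OF scaleC.bounded_linear_left] cinner.bounded_linear_right)

lemma clinear_op_ketbra: "clinear_op (ketbra u v)"
  by (simp add: clinear_op_def blinfun_apply_ketbra cinner_scaleC_right scaleC_scaleC)

lemma clinear_op_id: "clinear_op id_blinfun"
  by (simp add: clinear_op_def)

lemma clinear_op_compose: "clinear_op A \<Longrightarrow> clinear_op B \<Longrightarrow> clinear_op (A o\<^sub>L B)"
  by (simp add: clinear_op_def)

lemma scaleR_scaleC: "r *\<^sub>R x = complex_of_real r *\<^sub>C (x::'a::separable_chilbert)"
  by (simp add: scaleC_of_real)

lemma clinear_op_eqI:
  fixes S T :: "'a::separable_chilbert \<Rightarrow>\<^sub>L 'b::separable_chilbert"
  assumes "is_onb B" "is_onb C" "clinear_op S" "clinear_op T"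
    and "\<And>b c. b \<in> B \<Longrightarrow> c \<in> C \<Longrightarrow> cinner c (S b) = cinner c (T b)"
  shows "S = T"
proof (rule blinfun_eqI)
  fix x
  have "S b = T b" if "b \<in> B" for b
    by (rule onb_eqI[OF assms(2)]) (rule assms(5)[OF that])
  note * = this
  show "S x = T x"
    by (rule clinear_ext_onb[OF assms(1) blinfun.bounded_linear_right blinfun.bounded_linear_right])
      (simp_all add: clinear_opD[OF assms(3)] clinear_opD[OF assms(4)] *)
qed


subsection \<open>Trace-class operators\<close>

lemma sum_le_trace_norm:
  assumes "orthonormal_upto n e" "orthonormal_upto n f"
  shows "(\<Sum>i<n. ennreal (cmod (cinner (e i) (blinfun_apply A (f i))))) \<le> trace_norm A"
  unfolding trace_norm_def
  by (rule SUP_upper2[of "(n, e, f)"]) (use assms in auto)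

lemma trace_norm_leI:
  assumes "\<And>n e f. orthonormal_upto n e \<Longrightarrow> orthonormal_upto n f \<Longrightarrow>
      (\<Sum>i<n. ennreal (cmod (cinner (e i) (blinfun_apply A (f i))))) \<le> C"
  shows "trace_norm A \<le> C"
  unfolding trace_norm_def by (rule SUP_least) (use assms in auto)

lemma cmod_cinner_le_trace_norm:
  assumes "norm u = 1" "norm v = 1"
  shows "ennreal (cmod (cinner u (blinfun_apply A v))) \<le> trace_norm A"
  using sum_le_trace_norm[of 1 "\<lambda>_. u" "\<lambda>_. v" A] assms
  by (simp add: orthonormal_upto_def cinner_self)

lemma orthonormal_upto_image:
  assumes "orthonormal_upto n e"
  shows "orthonormal (e ` {..<n})" "inj_on e {..<n}"
proof -
  show inj: "inj_on e {..<n}"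
    using assms unfolding orthonormal_upto_def inj_on_def
    by (metis lessThan_iff zero_neq_one)
  show "orthonormal (e ` {..<n})"
    using assms inj unfolding orthonormal_upto_def orthonormal_def inj_on_def by auto
qed

lemma bessel_upto:
  assumes "orthonormal_upto n e"
  shows "(\<Sum>i<n. (cmod (cinner (e i) x))\<^sup>2) \<le> (norm x)\<^sup>2"
  using bessel_finite[OF orthonormal_upto_image(1)[OF assms] _ order_refl, of x]
  by (simp add: sum.reindex[OF orthonormal_upto_image(2)[OF assms]])

lemma mult_le_half_squares: "a * b \<le> (a\<^sup>2 + (b::real)\<^sup>2) / 2"
  using sum_squares_bound[of a b] by (simp add: mult.assoc)

text \<open>Each product is estimated by half the sum of squares, and Bessel's inequality is applied
  to both orthonormal systems. The arithmetic mean instead of the product of the norms suffices for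
  finiteness.\<close>

lemma trace_norm_ketbra:
  fixes u v :: "'a::separable_chilbert"
  shows "trace_norm (ketbra u v) \<le> ennreal (((norm u)\<^sup>2 + (norm v)\<^sup>2) / 2)"
proof (rule trace_norm_leI)
  fix n and e f :: "nat \<Rightarrow> 'a" assume e: "orthonormal_upto n e" and f: "orthonormal_upto n f"
  have "(\<Sum>i<n. cmod (cinner (e i) (blinfun_apply (ketbra u v) (f i))))
      = (\<Sum>i<n. cmod (cinner (e i) u) * cmod (cinner (f i) v))"
    by (intro sum.cong refl)
      (simp add: blinfun_apply_ketbra cinner_scaleC_right norm_mult cmod_cinner_commute)
  also have "\<dots> \<le> (\<Sum>i<n. ((cmod (cinner (e i) u))\<^sup>2 + (cmod (cinner (f i) v))\<^sup>2) / 2)"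
    by (intro sum_mono mult_le_half_squares)
  also have "\<dots> \<le> ((norm u)\<^sup>2 + (norm v)\<^sup>2) / 2"
    using bessel_upto[OF e, of u] bessel_upto[OF f, of v]
    by (simp add: sum.distrib sum_divide_distrib[symmetric])
  finally show "(\<Sum>i<n. ennreal (cmod (cinner (e i) (blinfun_apply (ketbra u v) (f i)))))
     \<le> ennreal (((norm u)\<^sup>2 + (norm v)\<^sup>2) / 2)"
    by (simp add: sum_ennreal ennreal_leI)
qed

lemma trace_class_ketbra: "trace_class (ketbra u v)"
  unfolding trace_class_def infinity_ennreal_def
  by (intro conjI clinear_op_ketbra order.strict_trans1[OF trace_norm_ketbra ennreal_less_top])

text \<open>For comparing operator norms with the trace norm, whose definition sees only matrix
  elements between orthonormal systems.\<close>

lemma approx_norm_blinfun: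
  fixes R :: "'a::separable_chilbert \<Rightarrow>\<^sub>L 'b::separable_chilbert"
  assumes "R \<noteq> 0" "\<epsilon> > 0"
  shows "\<exists>u v. norm u = 1 \<and> norm v = 1 \<and> norm R - \<epsilon> \<le> cmod (cinner u (R v))"
proof -
  \<comment> \<open>The maximum with 0 keeps this an admissible norm bound when \<epsilon> exceeds
    the norm of R.\<close>
  let ?b = "max 0 (norm R - \<epsilon>)"
  have "\<not> (\<forall>v. norm (R v) \<le> ?b * norm v)"
  proof
    assume "\<forall>v. norm (R v) \<le> ?b * norm v"
    then have "norm R \<le> ?b" by (intro norm_blinfun_bound) auto
    moreover have "0 < norm R" using assms(1) by simp
    ultimately show False using assms(2) by linarith
  qed
  then obtain v where v: "?b * norm v < norm (R v)" unfolding not_all not_le by (elim exE)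
  have nv: "0 < norm v" using v by (cases "v = 0") auto
  have nR: "0 < norm (R v)"
    by (rule order.strict_trans1[OF _ v]) (intro mult_nonneg_nonneg, auto)
  define u' where "u' = (1 / norm (R v)) *\<^sub>R R v"
  define v' where "v' = (1 / norm v) *\<^sub>R v"
  have "cinner u' (R v') = of_real (norm (R v) / norm v)"
    using nR nv by (simp add: u'_def v'_def blinfun.scaleR_right cinner_scaleR_left cinner_scaleR_right
        cinner_self scaleR_conv_of_real power2_eq_square)
  then have "cmod (cinner u' (R v')) = norm (R v) / norm v"
    by (simp only: norm_of_real) simp
  moreover have "?b \<le> norm (R v) / norm v"
    unfolding pos_le_divide_eq[OF nv] by (rule less_imp_le[OF v])
  ultimately have "norm R - \<epsilon> \<le> cmod (cinner u' (R v'))" by linarith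
  moreover have "norm u' = 1" "norm v' = 1" using nR nv by (auto simp: u'_def v'_def)
  ultimately show ?thesis by blast
qed


section \<open>Tensor products\<close>

context
  fixes t :: "'a::separable_chilbert \<Rightarrow> 'b::separable_chilbert \<Rightarrow> 'c::separable_chilbert"
  assumes t: "hilbert_tensor t"
begin

lemma tensor_cinner: "cinner (t a b) (t a' b') = cinner a a' * cinner b b'"
  using t by (simp add: hilbert_tensor_def)

lemma tensor_add_left: "t (a + a') b = t a b + t a' b"
  and tensor_add_right: "t a (b + b') = t a b + t a b'"
  and tensor_scaleC_left: "t (c *\<^sub>C a) b = c *\<^sub>C t a b"
  and tensor_scaleC_right: "t a (c *\<^sub>C b) = c *\<^sub>C t a b"
  using t by (simp_all add: hilbert_tensor_def)

lemma tensor_flip: "hilbert_tensor (\<lambda>b a. t a b)"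
proof -
  have "{t a b | b a. True} = {t a b | a b. True}" by blast
  then show ?thesis using t by (simp add: hilbert_tensor_def mult.commute)
qed

lemma norm_tensor: "norm (t a b) = norm a * norm b"
proof -
  have "complex_of_real ((norm (t a b))\<^sup>2) = of_real ((norm a * norm b)\<^sup>2)"
    by (simp only: cinner_self[symmetric] tensor_cinner power_mult_distrib of_real_mult)
  then have "(norm (t a b))\<^sup>2 = (norm a * norm b)\<^sup>2" using of_real_eq_iff by blast
  then show ?thesis by (simp add: power2_eq_iff_nonneg)
qed

lemma bounded_linear_tensor_left: "bounded_linear (\<lambda>a. t a b)"
  by (rule bounded_linear_intro[where K = "norm b"])
    (simp_all add: tensor_add_left norm_tensor scaleR_scaleC tensor_scaleC_left)

text \<open>The vectors x with \<open>cinner x z = 0\<close> form a closed real subspace. Containing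
  all product vectors it is the whole space, so z is orthogonal to itself.\<close>

lemma tensor_closed_span:
  assumes "\<And>a b. cinner (t a b) z = 0"
  shows "z = 0"
proof -
  have "closure (span {t a b | a b. True}) \<subseteq> {x. cinner x z = 0}"
  proof (rule closure_minimal)
    show "span {t a b | a b. True} \<subseteq> {x. cinner x z = 0}"
      using assms by (intro span_minimal)
        (auto simp: subspace_def cinner_add_left cinner_scaleR_left)
    show "closed {x. cinner x z = 0}"
      by (intro closed_Collect_eq continuous_on_const
          linear_continuous_on cinner.bounded_linear_left)
  qed
  then have "z \<in> {x. cinner x z = 0}" using t unfolding hilbert_tensor_def by blast
  then show ?thesis by (simp add: cinner_self)
qed

lemma tensor_op_eqI:
  fixes C D :: "'c \<Rightarrow>\<^sub>L 'd::separable_chilbert"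
  assumes "clinear_op C" "clinear_op D"
    and "\<And>a b. C (t a b) = D (t a b)"
  shows "C = D"
proof (intro blinfun_eqI cinner_eqI)
  fix x y
  have "adj C y - adj D y = 0" for y
    by (rule tensor_closed_span) (simp add: cinner.diff_right cinner_adj_right assms)
  then show "cinner y (C x) = cinner y (D x)"
    using cinner_adj_left[OF assms(1)] cinner_adj_left[OF assms(2)] by (metis eq_iff_diff_eq_0)
qed

end

text \<open>Partial inner product, in Dirac notation (I \<otimes> <k|) z: linear in z and
  conjugate-linear in k. Most computations with joint vectors are done through these
  contractions.\<close>

definition contract2 ::
  "('a::separable_chilbert \<Rightarrow> 'b::separable_chilbert \<Rightarrow> 'c::separable_chilbert) \<Rightarrow> 'b \<Rightarrow> 'c \<Rightarrow> 'a" where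
  "contract2 t k z = blinfun_apply (adj (Blinfun (\<lambda>h. t h k))) z"

definition contract1 ::
  "('a::separable_chilbert \<Rightarrow> 'b::separable_chilbert \<Rightarrow> 'c::separable_chilbert) \<Rightarrow> 'a \<Rightarrow> 'c \<Rightarrow> 'b" where
  "contract1 t h z = blinfun_apply (adj (Blinfun (\<lambda>k. t h k))) z"

text \<open>Flipping the tensor factors exchanges the two contractions. Facts are proved for one
  factor and transferred to the other by instantiating them with the flipped map.\<close>

lemma contract2_flip: "contract2 (\<lambda>b a. t a b) = contract1 t"
  and contract1_flip: "contract1 (\<lambda>b a. t a b) = contract2 t"
  by (simp_all add: contract1_def contract2_def fun_eq_iff)

context
  fixes t :: "'a::separable_chilbert \<Rightarrow> 'b::separable_chilbert \<Rightarrow> 'c::separable_chilbert"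
  assumes t: "hilbert_tensor t"
begin

lemma blinfun_tensor_left:
  "blinfun_apply (Blinfun (\<lambda>a. t a b)) a = t a b" "clinear_op (Blinfun (\<lambda>a. t a b))"
  by (simp_all add: clinear_op_def tensor_scaleC_left[OF t]
      bounded_linear_Blinfun_apply[OF bounded_linear_tensor_left[OF t]])

lemma cinner_contract2: "cinner h (contract2 t k z) = cinner (t h k) z"
  unfolding contract2_def
  by (simp add: cinner_adj_right blinfun_tensor_left)

lemma cinner_contract2_left: "cinner (contract2 t k z) h = cinner z (t h k)"
  by (metis cinner_commute cinner_contract2)

lemma bounded_linear_contract2: "bounded_linear (contract2 t k)"
  unfolding contract2_def by (rule blinfun.bounded_linear_right)

lemma contract2_scaleC: "contract2 t k (c *\<^sub>C z) = c *\<^sub>C contract2 t k z"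
  by (rule cinner_eqI) (simp add: cinner_contract2 cinner_scaleC_right)

lemma norm_contract2_le: "norm (contract2 t k z) \<le> norm k * norm z"
proof -
  let ?w = "contract2 t k z"
  have "(norm ?w)\<^sup>2 = cmod (cinner ?w ?w)" unfolding cinner_self norm_of_real by simp
  also have "\<dots> = cmod (cinner (t ?w k) z)" by (simp add: cinner_contract2)
  also have "\<dots> \<le> norm ?w * norm k * norm z"
    using cmod_cinner_le[of "t ?w k" z] by (simp add: norm_tensor[OF t])
  finally have "norm ?w * norm ?w \<le> norm ?w * (norm k * norm z)"
    by (simp add: power2_eq_square mult.assoc)
  then show ?thesis by (cases "norm ?w = 0") (auto simp: mult_le_cancel_left)
qed

lemma contract2_scaleC_left: "contract2 t (c *\<^sub>C k) z = cnj c *\<^sub>C contract2 t k z"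
  by (rule cinner_eqI)
    (simp add: cinner_contract2 cinner_scaleC_right cinner_scaleC_left tensor_scaleC_right[OF t])

lemma blinfun_apply_block1: "blinfun_apply (block1 t k l W) h = contract2 t k (W (t h l))"
  by (simp add: block1_def contract2_def blinfun_tensor_left)

end

context
  fixes t :: "'a::separable_chilbert \<Rightarrow> 'b::separable_chilbert \<Rightarrow> 'c::separable_chilbert"
  assumes t: "hilbert_tensor t"
begin

lemmas cinner_contract1 = cinner_contract2[OF tensor_flip[OF t], unfolded contract2_flip]
lemmas cinner_contract1_left = cinner_contract2_left[OF tensor_flip[OF t], unfolded contract2_flip]
lemmas bounded_linear_contract1 = bounded_linear_contract2[OF tensor_flip[OF t], unfolded contract2_flip]
lemmas contract1_scaleC = contract2_scaleC[OF tensor_flip[OF t], unfolded contract2_flip]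
lemma block2_flip: "block2 t = block1 (\<lambda>b a. t a b)"
  by (simp add: block1_def block2_def fun_eq_iff)

lemma blinfun_apply_block2: "blinfun_apply (block2 t g h W) k = contract1 t g (W (t h k))"
  unfolding block2_flip blinfun_apply_block1[OF tensor_flip[OF t]] contract2_flip ..

lemma clinear_op_block2: "clinear_op W \<Longrightarrow> clinear_op (block2 t g h W)"
  by (simp add: clinear_op_def blinfun_apply_block2 tensor_scaleC_right[OF t] contract1_scaleC)

text \<open>Completeness is the point. If z is orthogonal to every d \<otimes> g, its contractions
  with the g vanish because D is complete; so z is orthogonal to every a \<otimes> g, and the same
  argument in the second factor makes it orthogonal to all product vectors.\<close>

lemma is_onb_tensor:
  assumes D: "is_onb D" and G: "is_onb G"
  shows "is_onb ((\<lambda>(d, g). t d g) ` (D \<times> G))" "inj_on (\<lambda>(d, g). t d g) (D \<times> G)"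
proof -
  note oD = is_onb_orthonormal[OF D] and oG = is_onb_orthonormal[OF G]
  have c: "cinner (t d g) (t d' g') = (if d = d' \<and> g = g' then 1 else 0)"
    if "d \<in> D" "d' \<in> D" "g \<in> G" "g' \<in> G" for d d' g g'
    using that by (simp add: tensor_cinner[OF t] orthonormal_cinner[OF oD] orthonormal_cinner[OF oG])
  show inj: "inj_on (\<lambda>(d, g). t d g) (D \<times> G)"
  proof (rule inj_onI, clarify)
    fix d g d' g' assume a: "d \<in> D" "g \<in> G" "d' \<in> D" "g' \<in> G" "t d g = t d' g'"
    have "cinner (t d g) (t d' g') = 1" using c[of d d g g] a by simp
    then show "d = d' \<and> g = g'" using c[of d d' g g'] a by (simp split: if_splits)
  qed
  have "z = 0" if z: "\<And>d g. d \<in> D \<Longrightarrow> g \<in> G \<Longrightarrow> cinner (t d g) z = 0" for z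
  proof (rule tensor_closed_span[OF t])
    fix a b
    have "contract2 t g z = 0" if "g \<in> G" for g
      by (rule onb_eqI[OF D]) (simp add: cinner_contract2[OF t] z that)
    then have "cinner (t a g) z = 0" if "g \<in> G" for g
      using that cinner_contract2[OF t, of a g z] by simp
    then have "contract1 t a z = 0"
      by (intro onb_eqI[OF G]) (simp add: cinner_contract1)
    then show "cinner (t a b) z = 0" using cinner_contract1[of b a z] by simp
  qed
  note complete = this
  have "t d g = t d' g' \<longleftrightarrow> d = d' \<and> g = g'" if "d \<in> D" "d' \<in> D" "g \<in> G" "g' \<in> G" for d d' g g'
    using inj_onD[OF inj, of "(d, g)" "(d', g')"] that by auto
  then show "is_onb ((\<lambda>(d, g). t d g) ` (D \<times> G))"
    unfolding is_onb_def by (auto simp: c intro!: complete)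
qed

lemma contract1_parseval:
  assumes D: "is_onb D"
  shows "((\<lambda>d. (norm (contract1 t d z))\<^sup>2) has_sum (norm z)\<^sup>2) D"
proof -
  obtain G :: "'b set" where G: "is_onb G" using is_onb_some by blast
  have "((\<lambda>e. (cmod (cinner e z))\<^sup>2) has_sum (norm z)\<^sup>2) ((\<lambda>(d, g). t d g) ` (D \<times> G))"
    by (rule parseval_norm[OF is_onb_tensor(1)[OF D G]])
  then have "((\<lambda>(d, g). (cmod (cinner (t d g) z))\<^sup>2) has_sum (norm z)\<^sup>2) (D \<times> G)"
    unfolding has_sum_reindex[OF is_onb_tensor(2)[OF D G]] by (simp add: o_def case_prod_unfold)
  then show ?thesis
  proof (rule has_sum_SigmaD)
    fix d
    show "((\<lambda>g. case (d, g) of (d, g) \<Rightarrow> (cmod (cinner (t d g) z))\<^sup>2) has_sum (norm (contract1 t d z))\<^sup>2) G"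
      using parseval_norm[OF G, of "contract1 t d z"] by (simp add: cinner_contract1)
  qed
qed

lemma contract1_parseval_nn:
  assumes D: "is_onb D"
  shows "(\<integral>\<^sup>+ d. ennreal ((norm (contract1 t d z))\<^sup>2) \<partial>count_space D) = ennreal ((norm z)\<^sup>2)"
  by (rule has_sum_imp_nn_integral[OF contract1_parseval[OF D]]) simp

end

context
  fixes t :: "'a::separable_chilbert \<Rightarrow> 'b::separable_chilbert \<Rightarrow> 'c::separable_chilbert"
  assumes t: "hilbert_tensor t"
begin

lemmas contract2_parseval = contract1_parseval[OF tensor_flip[OF t], unfolded contract1_flip]
lemma contract2_bessel_upto:
  assumes "orthonormal_upto n e"
  shows "(\<Sum>i<n. (norm (contract2 t (e i) z))\<^sup>2) \<le> (norm z)\<^sup>2"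
proof -
  obtain C where C: "e ` {..<n} \<subseteq> C" "is_onb C"
    using orthonormal_extend[OF orthonormal_upto_image(1)[OF assms]] .
  have "(\<Sum>i<n. (norm (contract2 t (e i) z))\<^sup>2) = (\<Sum>g\<in>e ` {..<n}. (norm (contract2 t g z))\<^sup>2)"
    by (simp add: sum.reindex[OF orthonormal_upto_image(2)[OF assms]])
  also have "\<dots> \<le> (norm z)\<^sup>2"
    by (rule finite_sum_le_has_sum[OF contract2_parseval[OF C(2)] _ C(1)]) auto
  finally show ?thesis .
qed

subsection \<open>Partial traces\<close>

text \<open>The partial trace is an \<open>infsum\<close> in operator norm and would silently be 0
  without summability. The norm of each block is nearly a matrix element between unit vectors u d
  and v d. The vectors d \<otimes> u d, and likewise d \<otimes> v d, are orthonormal for any choice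
  of these, so the matrix elements add up to at most the trace norm.\<close>

lemma block2_abs_summable:
  assumes D: "is_onb D" and S: "trace_class S"
  shows "(\<lambda>d. norm (block2 t d d S)) summable_on D"
proof (rule nonneg_bdd_above_summable_on, simp, rule bdd_aboveI2[where M = "enn2real (trace_norm S)"])
  fix J assume "J \<in> {F. F \<subseteq> D \<and> finite F}"
  then have J: "finite J" "J \<subseteq> D" by auto
  let ?R = "\<lambda>d. block2 t d d S"
  \<comment> \<open>A zero block contributes nothing, and for it unit vectors in the second factor
    need not exist.\<close>
  define J' where "J' = {d\<in>J. ?R d \<noteq> 0}"
  have J': "finite J'" "J' \<subseteq> D" using J by (auto simp: J'_def)
  have "(\<Sum>d\<in>J'. norm (?R d)) \<le> enn2real (trace_norm S) + \<epsilon>" if "\<epsilon> > 0" for \<epsilon>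
  proof -
    \<comment> \<open>The errors of all blocks together stay below \<epsilon>; the summand 1 covers
      an empty J'.\<close>
    define \<delta> where "\<delta> = \<epsilon> / (1 + card J')"
    have \<delta>: "\<delta> > 0" "card J' * \<delta> \<le> \<epsilon>" using that by (auto simp: \<delta>_def field_simps)
    have "\<forall>d\<in>J'. \<exists>u v. norm u = 1 \<and> norm v = 1 \<and> norm (?R d) - \<delta> \<le> cmod (cinner u (?R d v))"
      using approx_norm_blinfun \<delta>(1) by (auto simp: J'_def)
    then obtain u v where uv: "\<And>d. d \<in> J' \<Longrightarrow> norm (u d) = 1" "\<And>d. d \<in> J' \<Longrightarrow> norm (v d) = 1"
      "\<And>d. d \<in> J' \<Longrightarrow> norm (?R d) - \<delta> \<le> cmod (cinner (u d) (?R d (v d)))" by metis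
    obtain h where h: "bij_betw h {0..<card J'} J'" using ex_bij_betw_nat_finite[OF J'(1)] by blast
    then have h: "bij_betw h {..<card J'} J'" by (simp add: atLeast0LessThan)
    have ons: "orthonormal_upto (card J') (\<lambda>i. t (h i) (w (h i)))"
      if w: "\<And>d. d \<in> J' \<Longrightarrow> norm (w d) = 1" for w
      unfolding orthonormal_upto_def
    proof (intro allI impI)
      fix i j assume ij: "i < card J'" "j < card J'"
      then have hJ: "h i \<in> J'" "h j \<in> J'" using h by (auto simp: bij_betw_def)
      have "h i = h j \<longleftrightarrow> i = j" using h ij by (auto simp: bij_betw_def inj_on_def)
      moreover have "cinner (h i) (h j) = (if h i = h j then 1 else 0)"
        using hJ J' orthonormal_cinner[OF is_onb_orthonormal[OF D]] by blast
      moreover have "cinner (w (h j)) (w (h j)) = 1" using w[OF hJ(2)] by (simp add: cinner_self)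
      ultimately show "cinner (t (h i) (w (h i))) (t (h j) (w (h j))) = (if i = j then 1 else 0)"
        by (simp add: tensor_cinner[OF t])
    qed
    have "(\<Sum>d\<in>J'. cmod (cinner (u d) (?R d (v d)))) =
        (\<Sum>i<card J'. cmod (cinner (t (h i) (u (h i))) (S (t (h i) (v (h i))))))"
      by (subst sum.reindex_bij_betw[OF h, symmetric])
        (simp add: blinfun_apply_block2[OF t] cinner_contract1[OF t])
    also have "ennreal \<dots> \<le> trace_norm S"
      using sum_le_trace_norm[OF ons[OF uv(1)] ons[OF uv(2)], where A = S] by simp
    finally have le: "ennreal (\<Sum>d\<in>J'. cmod (cinner (u d) (?R d (v d)))) \<le> trace_norm S" .
    have "trace_norm S < top" using S by (simp add: trace_class_def)
    from enn2real_mono[OF le this]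
    have "(\<Sum>d\<in>J'. cmod (cinner (u d) (?R d (v d)))) \<le> enn2real (trace_norm S)"
      by (simp add: sum_nonneg)
    moreover have "(\<Sum>d\<in>J'. norm (?R d) - \<delta>) \<le> (\<Sum>d\<in>J'. cmod (cinner (u d) (?R d (v d))))"
      by (rule sum_mono) (rule uv(3))
    moreover have "(\<Sum>d\<in>J'. norm (?R d) - \<delta>) = (\<Sum>d\<in>J'. norm (?R d)) - card J' * \<delta>"
      by (simp add: sum_subtractf)
    ultimately show ?thesis using \<delta>(2) by linarith
  qed
  then have "(\<Sum>d\<in>J'. norm (?R d)) \<le> enn2real (trace_norm S)" by (rule field_le_epsilon)
  moreover have "(\<Sum>d\<in>J'. norm (?R d)) = (\<Sum>d\<in>J. norm (?R d))"
    unfolding J'_def by (rule sum.mono_neutral_left) (use J in auto)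
  ultimately show "(\<Sum>d\<in>J. norm (?R d)) \<le> enn2real (trace_norm S)" by simp
qed

lemma ptrace_fst_has_sum:
  assumes S: "trace_class S"
  shows "((\<lambda>d. cinner k (contract1 t d (S (t d l)))) has_sum cinner k (ptrace_fst t S l)) (SOME D. is_onb D)"
proof -
  have "((\<lambda>d. block2 t d d S) has_sum ptrace_fst t S) (SOME D. is_onb D)"
    unfolding ptrace_fst_def
    by (rule has_sum_infsum[OF abs_summable_summable[OF block2_abs_summable[OF is_onb_some S]]])
  from has_sum_bounded_linear[OF bounded_linear_compose[OF cinner.bounded_linear_right blinfun.bounded_linear_left] this]
  show ?thesis by (simp add: blinfun_apply_block2[OF t])
qed

lemma clinear_op_ptrace_fst:
  assumes S: "trace_class S"
  shows "clinear_op (ptrace_fst t S)"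
  unfolding clinear_op_def
proof (intro allI cinner_eqI)
  fix c l k
  have "clinear_op S" using S by (simp add: trace_class_def)
  then have "((\<lambda>d. c * cinner k (contract1 t d (S (t d l)))) has_sum cinner k (ptrace_fst t S (c *\<^sub>C l))) (SOME D. is_onb D)"
    using ptrace_fst_has_sum[OF S, of k "c *\<^sub>C l"]
    by (simp add: clinear_opD tensor_scaleC_right[OF t] contract1_scaleC[OF t] cinner_scaleC_right)
  moreover have "((\<lambda>d. c * cinner k (contract1 t d (S (t d l)))) has_sum c * cinner k (ptrace_fst t S l)) (SOME D. is_onb D)"
    by (intro has_sum_cmult_right ptrace_fst_has_sum S)
  ultimately show "cinner k (ptrace_fst t S (c *\<^sub>C l)) = cinner k (c *\<^sub>C ptrace_fst t S l)"
    by (simp add: cinner_scaleC_right has_sum_unique)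
qed

text \<open>The reduced operator of a vector is the Gram matrix of its contractions. The two
  contractions appear in reversed order because they are conjugate-linear in k and l.\<close>

lemma cinner_ptrace_ketbra:
  "cinner k (ptrace_fst t (ketbra \<phi> \<phi>) l) = cinner (contract2 t l \<phi>) (contract2 t k \<phi>)"
proof -
  have "((\<lambda>d. cinner k (contract1 t d (ketbra \<phi> \<phi> (t d l))))
      has_sum cinner k (ptrace_fst t (ketbra \<phi> \<phi>) l)) (SOME D. is_onb D)"
    by (rule ptrace_fst_has_sum[OF trace_class_ketbra])
  moreover have "((\<lambda>d. cinner k (contract1 t d (ketbra \<phi> \<phi> (t d l))))
      has_sum cinner (contract2 t l \<phi>) (contract2 t k \<phi>)) (SOME D. is_onb D)"
    using parseval[OF is_onb_some, of "contract2 t l \<phi>" "contract2 t k \<phi>"]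
    by (simp add: blinfun_apply_ketbra cinner_contract1[OF t] cinner_contract2[OF t]
        cinner_contract2_left[OF t] contract1_scaleC[OF t] cinner_scaleC_right)
  ultimately show ?thesis by (rule has_sum_unique)
qed

lemma ptrace_ketbra_apply: "ptrace_fst t (ketbra \<phi> \<phi>) l = contract1 t (contract2 t l \<phi>) \<phi>"
  by (rule cinner_eqI) (simp add: cinner_ptrace_ketbra cinner_contract1[OF t] cinner_contract2[OF t])

lemma trace_norm_ptrace_ketbra: "trace_norm (ptrace_fst t (ketbra \<phi> \<phi>)) \<le> ennreal ((norm \<phi>)\<^sup>2)"
proof (rule trace_norm_leI)
  fix n and e f :: "nat \<Rightarrow> 'b" assume e: "orthonormal_upto n e" and f: "orthonormal_upto n f"
  let ?J = "\<lambda>k. contract2 t k \<phi>"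
  have "(\<Sum>i<n. cmod (cinner (e i) (ptrace_fst t (ketbra \<phi> \<phi>) (f i))))
      \<le> (\<Sum>i<n. norm (?J (f i)) * norm (?J (e i)))"
    by (intro sum_mono) (simp add: cinner_ptrace_ketbra cmod_cinner_le)
  also have "\<dots> \<le> (\<Sum>i<n. ((norm (?J (f i)))\<^sup>2 + (norm (?J (e i)))\<^sup>2) / 2)"
    by (intro sum_mono mult_le_half_squares)
  also have "\<dots> \<le> (norm \<phi>)\<^sup>2"
    using contract2_bessel_upto[OF e, of \<phi>] contract2_bessel_upto[OF f, of \<phi>]
    by (simp add: sum.distrib sum_divide_distrib[symmetric])
  finally show "(\<Sum>i<n. ennreal (cmod (cinner (e i) (ptrace_fst t (ketbra \<phi> \<phi>) (f i)))))
     \<le> ennreal ((norm \<phi>)\<^sup>2)"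
    by (simp add: sum_ennreal ennreal_leI)
qed

lemma positive_op_ptrace_ketbra: "positive_op (ptrace_fst t (ketbra \<phi> \<phi>))"
  by (simp add: positive_op_def clinear_op_ptrace_fst trace_class_ketbra cinner_ptrace_ketbra cinner_self)

lemma trace_class_ptrace_ketbra: "trace_class (ptrace_fst t (ketbra \<phi> \<phi>))"
  unfolding trace_class_def infinity_ennreal_def
  by (intro conjI clinear_op_ptrace_fst[OF trace_class_ketbra]
    order.strict_trans1[OF trace_norm_ptrace_ketbra ennreal_less_top])

lemma trace_ptrace_ketbra: "trace (ptrace_fst t (ketbra \<phi> \<phi>)) = of_real ((norm \<phi>)\<^sup>2)"
  unfolding trace_def cinner_ptrace_ketbra cinner_self
  by (rule infsumI) (intro has_sum_of_real contract2_parseval is_onb_some)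

lemma is_state_ptrace_ketbra: "norm \<phi> = 1 \<Longrightarrow> is_state (ptrace_fst t (ketbra \<phi> \<phi>))"
  by (simp add: is_state_def positive_op_ptrace_ketbra trace_class_ptrace_ketbra trace_ptrace_ketbra)

end

lemma ptrace_snd_flip: "ptrace_snd t = ptrace_fst (\<lambda>b a. t a b)"
  by (simp add: ptrace_snd_def ptrace_fst_def block1_def block2_def fun_eq_iff)

section \<open>Spectral theorem\<close>

lemma positive_op_clinear: "positive_op A \<Longrightarrow> clinear_op A"
  by (simp add: positive_op_def)

lemma positive_op_expval:
  assumes "positive_op A"
  shows "cinner x (A x) = of_real (expval A x)" "0 \<le> expval A x"
proof -
  have "cinner x (A x) \<in> \<real>\<^sub>\<ge>\<^sub>0" using assms by (simp add: positive_op_def)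
  then show "cinner x (A x) = of_real (expval A x)" "0 \<le> expval A x"
    by (auto simp: expval_def complex_nonneg_Reals_iff complex_eq_iff)
qed

text \<open>Polarization: the quadratic form is real at x + y and at x + i y, which fixes the
  imaginary and the real part of the sesquilinear form.\<close>

lemma positive_op_hermitian:
  assumes "positive_op A"
  shows "cinner (A x) y = cinner x (A y)"
proof -
  let ?q = "\<lambda>x y. cinner x (A y)"
  have A: "clinear_op A" using assms by (rule positive_op_clinear)
  have im: "Im (?q z z) = 0" for z by (simp add: positive_op_expval(1)[OF assms])
  have "?q (x + y) (x + y) = ?q x x + ?q y y + (?q x y + ?q y x)"
    by (simp add: blinfun.add_right cinner_add_left cinner_add_right)
  from arg_cong[OF this, of Im] have 1: "Im (?q x y) = - Im (?q y x)" by (simp add: im)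
  have "?q (x + \<i> *\<^sub>C y) (x + \<i> *\<^sub>C y) = ?q x x + ?q y y + (\<i> * ?q x y - \<i> * ?q y x)"
    by (simp add: blinfun.add_right cinner_add_left cinner_add_right clinear_opD[OF A]
        cinner_scaleC_left cinner_scaleC_right algebra_simps)
  from arg_cong[OF this, of Im] have 2: "Re (?q x y) = Re (?q y x)" by (simp add: im)
  have "?q x y = cnj (?q y x)" using 1 2 by (simp add: complex_eq_iff)
  then show ?thesis using cinner_commute[of "A x" y] by simp
qed

text \<open>The quadratic form is nonnegative at x - s y, where s is a real multiple r of the
  conjugate of \<open>cinner x (A y)\<close>; the inequality is the minimum over r.\<close>

lemma positive_op_cauchy_schwarz:
  assumes A: "positive_op A"
  shows "(cmod (cinner x (A y)))\<^sup>2 \<le> expval A x * expval A y"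
proof -
  let ?c = "cinner x (A y)"
  let ?n = "(cmod ?c)\<^sup>2"
  have key: "0 \<le> expval A x - 2 * r * ?n + r\<^sup>2 * ?n * expval A y" for r
  proof -
    let ?s = "of_real r * cnj ?c"
    have "cinner (x - ?s *\<^sub>C y) (A (x - ?s *\<^sub>C y))
      = of_real (expval A x) - ?s * ?c - cnj ?s * cnj ?c + ?s * cnj ?s * of_real (expval A y)"
      using cinner_commute[of y "A x"] positive_op_hermitian[OF A, of x y]
      by (simp add: blinfun.diff_right cinner.diff_left cinner.diff_right cinner_scaleC_left
          cinner_scaleC_right clinear_opD[OF positive_op_clinear[OF A]] positive_op_expval(1)[OF A] algebra_simps)
    also have "?s * ?c = of_real (r * ?n)"
      by (simp add: complex_norm_square mult_ac del: of_real_power)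
    also have "cnj ?s * cnj ?c = of_real (r * ?n)"
      by (simp add: complex_norm_square mult_ac del: of_real_power)
    also have "?s * cnj ?s = of_real (r\<^sup>2 * ?n)"
      unfolding of_real_mult complex_norm_square by (simp add: power2_eq_square mult_ac)
    finally have "expval A (x - ?s *\<^sub>C y) = expval A x - 2 * r * ?n + r\<^sup>2 * ?n * expval A y"
      by (simp add: expval_def)
    then show ?thesis using positive_op_expval(2)[OF A] by metis
  qed
  note nx = positive_op_expval(2)[OF A, of x] and ny = positive_op_expval(2)[OF A, of y]
  show ?thesis
  proof (cases "expval A y = 0")
    case True
    have "?n = 0"
    proof (rule ccontr)
      assume "?n \<noteq> 0"
      then have "?n > 0" by simp
      \<comment> \<open>With \<open>expval A y = 0\<close> the bound is affine in r, and this r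
        makes it equal to -1.\<close>
      then show False using key[of "(expval A x + 1) / (2 * ?n)"] True by simp
    qed
    then show ?thesis using True by simp
  next
    case False
    with ny have pos: "expval A y > 0" by simp
    have "0 \<le> expval A x - ?n / expval A y"
      using key[of "1 / expval A y"] pos by (simp add: power2_eq_square)
    then show ?thesis using pos by (simp add: field_simps)
  qed
qed

lemma expval_le_norm:
  assumes "positive_op A"
  shows "expval A x \<le> norm A * (norm x)\<^sup>2"
proof -
  have "expval A x \<le> cmod (cinner x (A x))"
    unfolding expval_def by (rule complex_Re_le_cmod)
  also have "\<dots> \<le> norm x * norm (A x)" by (rule cmod_cinner_le)
  also have "\<dots> \<le> norm x * (norm A * norm x)" by (intro mult_left_mono norm_blinfun) simp
  finally show ?thesis by (simp add: power2_eq_square mult_ac)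
qed

lemma sum_diagonal_le_trace_norm:
  assumes B: "orthonormal B" and A: "trace_class A" and J: "finite J" "J \<subseteq> B"
  shows "(\<Sum>e\<in>J. cmod (cinner e (A e))) \<le> enn2real (trace_norm A)"
proof -
  obtain h where "bij_betw h {0..<card J} J" using ex_bij_betw_nat_finite[OF J(1)] by blast
  then have h: "bij_betw h {..<card J} J" by (simp add: atLeast0LessThan)
  have "orthonormal_upto (card J) h"
    unfolding orthonormal_upto_def
  proof (intro allI impI)
    fix i j assume ij: "i < card J" "j < card J"
    then have "h i \<in> B" "h j \<in> B" "h i = h j \<longleftrightarrow> i = j"
      using h J(2) by (auto simp: bij_betw_def inj_on_def)
    then show "cinner (h i) (h j) = (if i = j then 1 else 0)" using orthonormal_cinner[OF B] by simp
  qed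
  then have "(\<Sum>i<card J. ennreal (cmod (cinner (h i) (A (h i))))) \<le> trace_norm A"
    by (intro sum_le_trace_norm)
  then have le: "ennreal (\<Sum>e\<in>J. cmod (cinner e (A e))) \<le> trace_norm A"
    by (subst sum.reindex_bij_betw[OF h, symmetric]) simp
  have "trace_norm A < top" using A by (simp add: trace_class_def)
  from enn2real_mono[OF le this] show ?thesis by (simp add: sum_nonneg)
qed

lemma trace_class_diag_summable:
  assumes "orthonormal B" "trace_class A"
  shows "(\<lambda>e. cmod (cinner e (A e))) summable_on B"
  by (rule nonneg_bdd_above_summable_on)
    (auto intro!: bdd_aboveI2[where M = "enn2real (trace_norm A)"] sum_diagonal_le_trace_norm[OF assms])

section \<open>Compactness of positive trace-class operators\<close>

lemma compact_coefficients:
  assumes "finite J"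
  shows "\<exists>C. compact C \<and> (\<forall>c. (\<forall>d\<in>J. cmod (c d) \<le> M) \<longrightarrow> (\<Sum>d\<in>J. c d *\<^sub>C (d::'a::separable_chilbert)) \<in> C)"
  using assms
proof induction
  case empty
  show ?case by (rule exI[of _ "{0}"]) simp
next
  case (insert d J)
  then obtain C where C: "compact C" "\<And>c. (\<forall>d\<in>J. cmod (c d) \<le> M) \<Longrightarrow> (\<Sum>d\<in>J. c d *\<^sub>C d) \<in> C"
    by blast
  let ?D = "(\<lambda>a. a *\<^sub>C d) ` cball 0 M"
  have "compact ?D"
    by (intro compact_continuous_image linear_continuous_on scaleC.bounded_linear_left compact_cball)
  then have "compact {x + y |x y. x \<in> ?D \<and> y \<in> C}" using C(1) by (rule compact_sums)
  moreover have "(\<Sum>d\<in>insert d J. c d *\<^sub>C d) \<in> {x + y |x y. x \<in> ?D \<and> y \<in> C}"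
    if "\<forall>d\<in>insert d J. cmod (c d) \<le> M" for c
  proof -
    have "c d *\<^sub>C d \<in> ?D" using that by (intro imageI) simp
    moreover have "(\<Sum>d\<in>J. c d *\<^sub>C d) \<in> C" using that by (intro C(2)) simp
    ultimately show ?thesis using insert.hyps by (auto simp: sum.insert)
  qed
  ultimately show ?case by blast
qed

text \<open>For z in the unit ball, Cauchy-Schwarz bounds the squared coordinate of A z at d by
  \<open>expval A d * norm A\<close>, and the diagonal is summable. Up to a uniformly small error, A
  z is thus a combination of finitely many d with bounded coefficients, and these combinations lie
  in a compact set.\<close>

lemma compact_positive_trace_class:
  assumes A: "positive_op A" "trace_class A"
  shows "compact (closure (blinfun_apply A ` cball 0 1))"
  unfolding compact_eq_totally_bounded
proof (intro conjI allI impI)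
  show "complete (closure (blinfun_apply A ` cball 0 1))" by (simp add: complete_eq_closed)
  fix \<epsilon> :: real assume \<epsilon>: "\<epsilon> > 0"
  obtain D :: "'a set" where D: "is_onb D" using is_onb_some by blast
  note oD = is_onb_orthonormal[OF D]
  let ?a = "\<lambda>d. expval A d"
  have summ: "?a summable_on D"
    using trace_class_diag_summable[OF oD A(2)] positive_op_expval[OF A(1)] by simp
  \<comment> \<open>Adding 1 keeps the quotient defined for \<open>A = 0\<close>. A quarter of
    \<epsilon> is spent on each of the cut-off, the finite net and the closure.\<close>
  define \<delta> where "\<delta> = (\<epsilon>/4)\<^sup>2 / (norm A + 1)"
  have \<delta>: "\<delta> > 0" "norm A * \<delta> \<le> (\<epsilon>/4)\<^sup>2"
    using \<epsilon> by (auto simp: \<delta>_def field_simps add_pos_nonneg)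
  obtain J where J: "finite J" "J \<subseteq> D" "dist (sum ?a J) (infsum ?a D) \<le> \<delta>"
    using infsum_finite_approximation[OF summ \<delta>(1)] by auto
  have near: "norm (A z - (\<Sum>d\<in>J. cinner d (A z) *\<^sub>C d)) \<le> \<epsilon> / 4"
    if z: "norm z \<le> 1" for z
  proof -
    let ?y = "A z - (\<Sum>d\<in>J. cinner d (A z) *\<^sub>C d)"
    have c: "(cmod (cinner d ?y))\<^sup>2 = (if d \<in> J then 0 else (cmod (cinner d (A z)))\<^sup>2)" if "d \<in> D" for d
      using that by (simp add: cinner.diff_right cinner_sum_orthonormal[OF oD J(1,2)])
    have "(\<Sum>d\<in>F. (cmod (cinner d ?y))\<^sup>2) \<le> norm A * \<delta>" if F: "finite F" "F \<subseteq> D" for F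
    proof -
      have "(\<Sum>d\<in>F. (cmod (cinner d ?y))\<^sup>2) = (\<Sum>d\<in>F - J. (cmod (cinner d (A z)))\<^sup>2)"
        using F by (intro sum.mono_neutral_cong_right) (auto simp: c subset_iff)
      also have "\<dots> \<le> (\<Sum>d\<in>F - J. ?a d * norm A)"
      proof (rule sum_mono)
        fix d
        have "(cmod (cinner d (A z)))\<^sup>2 \<le> ?a d * expval A z"
          by (rule positive_op_cauchy_schwarz[OF A(1)])
        also have "expval A z \<le> norm A * (norm z)\<^sup>2" by (rule expval_le_norm[OF A(1)])
        also have "\<dots> \<le> norm A * 1" using z by (intro mult_left_mono) (auto simp: power_le_one)
        finally show "(cmod (cinner d (A z)))\<^sup>2 \<le> ?a d * norm A"
          by (simp add: mult_left_mono positive_op_expval(2)[OF A(1)])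
      qed
      also have "\<dots> = norm A * (sum ?a (F \<union> J) - sum ?a J)"
      proof -
        have "sum ?a (F \<union> J) = sum ?a (F - J) + sum ?a J"
          using F J by (subst sum.union_disjoint[symmetric]) (auto intro!: sum.cong)
        then show ?thesis by (simp add: sum_distrib_left mult.commute)
      qed
      also have "\<dots> \<le> norm A * \<delta>"
      proof (rule mult_left_mono)
        have "sum ?a (F \<union> J) \<le> infsum ?a D"
          using F J by (intro finite_sum_le_infsum[OF summ]) (auto simp: positive_op_expval(2)[OF A(1)])
        then show "sum ?a (F \<union> J) - sum ?a J \<le> \<delta>" using J(3) unfolding dist_real_def by linarith
      qed simp
      finally show ?thesis .
    qed
    then have "(norm ?y)\<^sup>2 \<le> norm A * \<delta>"
      by (intro has_sum_le_finite_sums[OF parseval_norm[OF D, of ?y]])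
    then have "(norm ?y)\<^sup>2 \<le> (\<epsilon>/4)\<^sup>2" using \<delta>(2) by linarith
    then show ?thesis by (rule power2_le_imp_le) (use \<epsilon> in simp)
  qed
  obtain C where C: "compact C"
    "\<And>c. (\<forall>d\<in>J. cmod (c d) \<le> norm A) \<Longrightarrow> (\<Sum>d\<in>J. c d *\<^sub>C d) \<in> C"
    using compact_coefficients[OF J(1), of "norm A"] by blast
  obtain k where k: "finite k" "C \<subseteq> (\<Union>x\<in>k. ball x (\<epsilon>/4))"
  proof -
    have "\<forall>\<epsilon>>0. \<exists>k. finite k \<and> C \<subseteq> (\<Union>x\<in>k. ball x \<epsilon>)"
      using C(1) unfolding compact_eq_totally_bounded by (rule conjunct2)
    moreover have "\<epsilon>/4 > 0" using \<epsilon> by simp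
    ultimately show ?thesis using that by blast
  qed
  have "closure (blinfun_apply A ` cball 0 1) \<subseteq> (\<Union>x\<in>k. ball x \<epsilon>)"
  proof
    fix y assume "y \<in> closure (blinfun_apply A ` cball 0 1)"
    then obtain z where z: "norm z \<le> 1" "dist (A z) y < \<epsilon> / 4"
    proof -
      have "\<epsilon>/4 > 0" using \<epsilon> by simp
      then obtain v where "v \<in> blinfun_apply A ` cball 0 1" "dist v y < \<epsilon>/4"
        using \<open>y \<in> _\<close> unfolding closure_approachable by blast
      then show ?thesis using that by auto
    qed
    let ?p = "\<Sum>d\<in>J. cinner d (A z) *\<^sub>C d"
    have "cmod (cinner d (A z)) \<le> norm A" if "d \<in> J" for d
    proof -
      have "cmod (cinner d (A z)) \<le> norm d * norm (A z)" by (rule cmod_cinner_le)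
      also have "\<dots> = norm (A z)" using that J(2) orthonormal_norm[OF oD, of d] by auto
      also have "\<dots> \<le> norm A * norm z" by (rule norm_blinfun)
      also have "\<dots> \<le> norm A * 1" using z by (intro mult_left_mono) auto
      finally show ?thesis by simp
    qed
    then have "?p \<in> C" by (intro C(2)) simp
    then obtain x where x: "x \<in> k" "dist x ?p < \<epsilon> / 4" using k(2) by auto
    have "dist x y \<le> dist x ?p + dist ?p (A z) + dist (A z) y"
      using dist_triangle[of x y ?p] dist_triangle[of ?p y "A z"] by linarith
    moreover have "dist ?p (A z) \<le> \<epsilon> / 4"
      using near[OF z(1)] by (simp add: dist_norm norm_minus_commute)
    ultimately have "dist x y < \<epsilon>" using x(2) z(2) \<epsilon> by linarith
    then show "y \<in> (\<Union>x\<in>k. ball x \<epsilon>)" using x(1) by auto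
  qed
  then show "\<exists>k. finite k \<and> closure (blinfun_apply A ` cball 0 1) \<subseteq> (\<Union>x\<in>k. ball x \<epsilon>)"
    using k(1) by blast
qed

text \<open>Take a maximizing sequence y of the quadratic form on the unit vectors of M, with
  supremum l. The estimate \<open>contr\<close> forces A y - l y to tend to 0, compactness makes A y
  converge along a subsequence, and for positive l the vectors y converge with it.\<close>

lemma eigenvector_in_invariant_subspace:
  fixes A :: "'a::separable_chilbert \<Rightarrow>\<^sub>L 'a"
  assumes A: "positive_op A" "trace_class A"
    and M: "closed M" "\<And>r x. x \<in> M \<Longrightarrow> r *\<^sub>R x \<in> M" "\<And>x. x \<in> M \<Longrightarrow> A x \<in> M"
    and x: "x \<in> M" "x \<noteq> 0"
  shows "\<exists>y c. y \<in> M \<and> norm y = 1 \<and> A y = c *\<^sub>C y"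
proof -
  let ?V = "expval A ` {y \<in> M. norm y = 1}"
  define l where "l = Sup ?V"
  have "(1 / norm x) *\<^sub>R x \<in> {y \<in> M. norm y = 1}" using x M(2) by simp
  then have ne: "?V \<noteq> {}" by blast
  have bdd: "bdd_above ?V"
  proof (rule bdd_aboveI2)
    fix y assume "y \<in> {y \<in> M. norm y = 1}"
    then show "expval A y \<le> norm A" using expval_le_norm[OF A(1), of y] by simp
  qed
  have le: "expval A y \<le> l" if "y \<in> M" "norm y = 1" for y
    unfolding l_def by (rule cSup_upper[OF _ bdd]) (use that in auto)
  have le2: "expval A y \<le> l * (norm y)\<^sup>2" if "y \<in> M" for y
  proof (cases "y = 0")
    case False
    have "expval A ((1 / norm y) *\<^sub>R y) = expval A y / (norm y)\<^sup>2"
      by (simp add: expval_def blinfun.scaleR_right cinner_scaleR_left cinner_scaleR_right power2_eq_square)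
    moreover have "expval A ((1 / norm y) *\<^sub>R y) \<le> l" using False that M(2) by (intro le) auto
    ultimately show ?thesis using False by (simp add: divide_le_eq)
  qed (simp add: expval_def)
  have l0: "0 \<le> l"
    using ne le positive_op_expval(2)[OF A(1)] by (metis (mono_tags, lifting) all_not_in_conv image_iff mem_Collect_eq order_trans)
  \<comment> \<open>Cauchy-Schwarz for the pair A y, y, combined with \<open>le2\<close> at A y,
    which lies in M by invariance.\<close>
  have contr: "(norm (A y))\<^sup>2 \<le> l * expval A y" if "y \<in> M" for y
  proof -
    let ?z = "A y"
    have "cmod (cinner ?z ?z) = (norm ?z)\<^sup>2" unfolding cinner_self norm_of_real by simp
    then have "((norm ?z)\<^sup>2)\<^sup>2 \<le> expval A ?z * expval A y"
      using positive_op_cauchy_schwarz[OF A(1), of ?z y] by simp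
    also have "\<dots> \<le> (l * (norm ?z)\<^sup>2) * expval A y"
      by (intro mult_right_mono le2 M(3) that positive_op_expval(2)[OF A(1)])
    finally have "(norm ?z)\<^sup>2 * (norm ?z)\<^sup>2 \<le> (norm ?z)\<^sup>2 * (l * expval A y)"
      by (simp add: power2_eq_square mult_ac)
    note * = this
    show ?thesis
    proof (cases "?z = 0")
      case True
      then show ?thesis using l0 positive_op_expval(2)[OF A(1), of y] by simp
    next
      case False
      then have "0 < (norm ?z)\<^sup>2" by simp
      with * show ?thesis by (rule mult_left_le_imp_le)
    qed
  qed
  have "\<exists>y. \<forall>n. y n \<in> M \<and> norm (y n) = 1 \<and> l - inverse (real (Suc n)) < expval A (y n)"
  proof (rule choice, rule allI)
    fix n
    have "l - inverse (real (Suc n)) < Sup ?V" by (simp add: l_def)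
    then obtain v where "v \<in> ?V" "l - inverse (real (Suc n)) < v" using less_cSup_iff[OF ne bdd] by blast
    then show "\<exists>y. y \<in> M \<and> norm y = 1 \<and> l - inverse (real (Suc n)) < expval A y" by blast
  qed
  then obtain y where y: "\<And>n. y n \<in> M" "\<And>n. norm (y n) = 1"
    "\<And>n. l - inverse (real (Suc n)) < expval A (y n)" by blast
  have res: "(norm (A (y n) - l *\<^sub>R y n))\<^sup>2 \<le> l * inverse (real (Suc n))" for n
  proof -
    have "(norm (A (y n) - l *\<^sub>R y n))\<^sup>2
      = (norm (A (y n)))\<^sup>2 - 2 * l * expval A (y n) + l\<^sup>2"
    proof -
      let ?u = "A (y n)"
      have "inner (y n) (y n) = 1" using y(2)[of n] by (simp add: dot_square_norm)
      moreover have "inner (y n) ?u = expval A (y n)" by (simp add: expval_def Re_cinner)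
      moreover have "(norm (?u - l *\<^sub>R y n))\<^sup>2
        = (norm ?u)\<^sup>2 - 2 * l * inner (y n) ?u + l\<^sup>2 * inner (y n) (y n)"
        unfolding power2_norm_eq_inner power2_eq_square[of l]
        by (simp add: inner_diff_left inner_diff_right inner_commute[of ?u "y n"] algebra_simps)
      ultimately show ?thesis by simp
    qed
    also have "\<dots> \<le> l * expval A (y n) - 2 * l * expval A (y n) + l\<^sup>2"
      using contr[OF y(1)[of n]] by simp
    also have "\<dots> = l * (l - expval A (y n))" by (simp add: power2_eq_square algebra_simps)
    also have "\<dots> \<le> l * inverse (real (Suc n))"
      using y(3)[of n] l0 by (intro mult_left_mono) auto
    finally show ?thesis .
  qed
  show ?thesis
  proof (cases "l = 0")
    \<comment> \<open>If l = 0, then \<open>contr\<close> makes A vanish on M, and any unit vector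
      of M is an eigenvector with eigenvalue 0.\<close>
    case True
    have "(norm (A (y 0)))\<^sup>2 \<le> 0" using contr[OF y(1)[of 0]] True by simp
    then have "A (y 0) = 0 *\<^sub>C y 0" by simp
    then show ?thesis using y(1,2) by blast
  next
    case False
    then have l: "l > 0" using l0 by simp
    have "seq_compact (closure (blinfun_apply A ` cball 0 1))"
      using compact_positive_trace_class[OF A] by (simp add: compact_eq_seq_compact_metric)
    moreover have "\<And>n. A (y n) \<in> closure (blinfun_apply A ` cball 0 1)"
      using y(2) by (intro subsetD[OF closure_subset] imageI) simp
    ultimately obtain w r where r: "strict_mono (r :: nat \<Rightarrow> nat)"
      "((\<lambda>n. A (y n)) \<circ> r) \<longlonglongrightarrow> w"
      unfolding seq_compact_def by metis
    have "(\<lambda>n. (norm (A (y n) - l *\<^sub>R y n))\<^sup>2) \<longlonglongrightarrow> 0"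
    proof (rule Lim_null_comparison)
      show "\<forall>\<^sub>F n in sequentially. norm ((norm (A (y n) - l *\<^sub>R y n))\<^sup>2) \<le> l * inverse (real (Suc n))"
        using res by simp
      show "(\<lambda>n. l * inverse (real (Suc n))) \<longlonglongrightarrow> 0"
        using tendsto_mult_right_zero[OF LIMSEQ_inverse_real_of_nat] by simp
    qed
    then have "(\<lambda>n. A (y n) - l *\<^sub>R y n) \<longlonglongrightarrow> 0"
      by (simp add: tendsto_norm_zero_iff)
    then have "((\<lambda>n. A (y n) - l *\<^sub>R y n) \<circ> r) \<longlonglongrightarrow> 0"
      using r(1) by (rule LIMSEQ_subseq_LIMSEQ)
    from tendsto_diff[OF r(2) this] have "(\<lambda>n. l *\<^sub>R y (r n)) \<longlonglongrightarrow> w" by (simp add: o_def)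
    from tendsto_scaleR[OF tendsto_const[of "inverse l"] this]
    have lim: "(\<lambda>n. y (r n)) \<longlonglongrightarrow> inverse l *\<^sub>R w" using l by simp
    let ?y = "inverse l *\<^sub>R w"
    have "?y \<in> M" by (rule closed_sequentially[OF M(1) _ lim]) (simp add: y(1))
    moreover have "norm ?y = 1"
      using tendsto_norm[OF lim] unfolding y(2) LIMSEQ_const_iff by simp
    moreover have "A ?y = w"
    proof -
      have "(\<lambda>n. A (y (r n))) \<longlonglongrightarrow> A ?y"
        by (intro tendsto_intros lim)
      then show ?thesis by (rule LIMSEQ_unique[OF _ r(2)[unfolded o_def]])
    qed
    moreover have "of_real l *\<^sub>C ?y = w" using l by (simp add: scaleC_of_real)
    ultimately have "?y \<in> M \<and> norm ?y = 1 \<and> A ?y = of_real l *\<^sub>C ?y" by (simp only: simp_thms)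
    then show ?thesis by blast
  qed
qed

text \<open>The orthogonal complement of a maximal orthonormal system of eigenvectors is invariant
  because A is Hermitian. Were it nonzero, it would contain a unit eigenvector, against
  maximality.\<close>

lemma spectral_theorem:
  fixes A :: "'a::separable_chilbert \<Rightarrow>\<^sub>L 'a"
  assumes A: "positive_op A" "trace_class A"
  shows "\<exists>B. is_onb B \<and> (\<forall>e\<in>B. \<exists>c. A e = c *\<^sub>C e)"
proof -
  let ?Q = "{x. \<exists>c. A x = c *\<^sub>C x}"
  obtain B where B: "orthonormal B" "B \<subseteq> ?Q"
    and mx: "\<And>x. x \<in> ?Q \<Longrightarrow> norm x = 1 \<Longrightarrow> \<exists>e\<in>B. cinner e x \<noteq> 0"
    using maximal_orthonormal[of "{}" ?Q] by (auto simp: orthonormal_def)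
  let ?M = "{y. \<forall>e\<in>B. cinner e y = 0}"
  have "x = 0" if x: "\<forall>e\<in>B. cinner e x = 0" for x
  proof (rule ccontr)
    assume "x \<noteq> 0"
    have "\<exists>y c. y \<in> ?M \<and> norm y = 1 \<and> A y = c *\<^sub>C y"
    proof (rule eigenvector_in_invariant_subspace[OF A])
      have "?M = (\<Inter>e\<in>B. {y. cinner e y = 0})" by blast
      also have "closed \<dots>"
        by (intro closed_INT ballI closed_Collect_eq continuous_on_const linear_continuous_on cinner.bounded_linear_right)
      finally show "closed ?M" .
      show "A y \<in> ?M" if "y \<in> ?M" for y
      proof (rule CollectI, rule ballI)
        fix e assume e: "e \<in> B"
        then obtain c where "A e = c *\<^sub>C e" using B(2) by blast
        then have "cinner e (A y) = cnj c * cinner e y"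
          by (simp add: positive_op_hermitian[OF A(1), symmetric] cinner_scaleC_left)
        then show "cinner e (A y) = 0" using that e by simp
      qed
    qed (use x \<open>x \<noteq> 0\<close> in \<open>auto simp: cinner_scaleR_right\<close>)
    then obtain y c where "y \<in> ?M" "norm y = 1" "A y = c *\<^sub>C y" by blast
    then show False using mx[of y] by blast
  qed
  then have "is_onb B" using B(1) unfolding is_onb_def orthonormal_def by blast
  then show ?thesis using B(2) by blast
qed

section \<open>Eigenbases and traces of positive operators\<close>

lemma eigenbasis_props:
  assumes A: "positive_op A" "trace_class A"
  shows "is_onb (eigenbasis A)"
    and "\<And>e. e \<in> eigenbasis A \<Longrightarrow> A e = of_real (expval A e) *\<^sub>C e"
proof -
  have *: "is_onb (eigenbasis A) \<and> (\<forall>e\<in>eigenbasis A. \<exists>c. A e = c *\<^sub>C e)"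
    unfolding eigenbasis_def by (rule someI_ex[OF spectral_theorem[OF A]])
  then show "is_onb (eigenbasis A)" by blast
  fix e assume e: "e \<in> eigenbasis A"
  then obtain c where c: "A e = c *\<^sub>C e" using * by blast
  have "cinner e e = 1" using orthonormal_cinner[OF is_onb_orthonormal] * e by metis
  then have "of_real (expval A e) = c"
    using positive_op_expval(1)[OF A(1), of e] by (simp add: c cinner_scaleC_right)
  then show "A e = of_real (expval A e) *\<^sub>C e" using c by simp
qed

lemma is_state_D: "is_state A \<Longrightarrow> positive_op A" "is_state A \<Longrightarrow> trace_class A"
  by (simp_all add: is_state_def)

lemma expval_eigenbasis_expand:
  assumes A: "positive_op A" "trace_class A"
  shows "(\<integral>\<^sup>+ e. ennreal (expval A e) * ennreal ((cmod (cinner e x))\<^sup>2) \<partial>count_space (eigenbasis A))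
    = ennreal (expval A x)"
proof -
  note E = eigenbasis_props[OF A]
  have "((\<lambda>e. Re (cinner x e * cinner e (A x))) has_sum expval A x) (eigenbasis A)"
    unfolding expval_def by (intro has_sum_Re parseval E(1))
  moreover have "Re (cinner x e * cinner e (A x)) = expval A e * (cmod (cinner e x))\<^sup>2"
    if "e \<in> eigenbasis A" for e
  proof -
    have "cinner e (A x) = of_real (expval A e) * cinner e x"
      by (simp add: positive_op_hermitian[OF A(1), symmetric] E(2)[OF that] cinner_scaleC_left)
    then have "cinner x e * cinner e (A x) = of_real (expval A e * (cmod (cinner e x))\<^sup>2)"
      using cinner_mult_swap[of x e] by (simp add: mult_ac)
    then show ?thesis by simp
  qed
  ultimately have "((\<lambda>e. expval A e * (cmod (cinner e x))\<^sup>2) has_sum expval A x) (eigenbasis A)"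
    using has_sum_cong by (metis (no_types, lifting))
  from has_sum_imp_nn_integral[OF this] show ?thesis
    by (simp add: positive_op_expval(2)[OF A(1)] ennreal_mult)
qed

text \<open>Basis independence of the trace: insert the spectral expansion of each diagonal entry
  and sum over the basis B first, where Parseval gives 1.\<close>

lemma trace_nn:
  assumes A: "positive_op A" "trace_class A" and B: "is_onb B"
  shows "(\<integral>\<^sup>+ e. ennreal (expval A e) \<partial>count_space B)
    = (\<integral>\<^sup>+ e. ennreal (expval A e) \<partial>count_space (eigenbasis A))"
proof -
  note E = eigenbasis_props[OF A]
  have "(\<integral>\<^sup>+ e. ennreal (expval A e) \<partial>count_space B)
    = (\<integral>\<^sup>+ b. \<integral>\<^sup>+ e. ennreal (expval A e) * ennreal ((cmod (cinner e b))\<^sup>2) \<partial>count_space (eigenbasis A) \<partial>count_space B)"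
    by (simp add: expval_eigenbasis_expand[OF A])
  also have "\<dots> = (\<integral>\<^sup>+ e. \<integral>\<^sup>+ b. ennreal (expval A e) * ennreal ((cmod (cinner e b))\<^sup>2) \<partial>count_space B \<partial>count_space (eigenbasis A))"
    by (rule nn_integral_count_space_nn_integral)
      (auto intro: orthonormal_countable is_onb_orthonormal E(1))
  also have "\<dots> = (\<integral>\<^sup>+ e. ennreal (expval A e) \<partial>count_space (eigenbasis A))"
  proof (rule nn_integral_cong)
    fix e assume "e \<in> space (count_space (eigenbasis A))"
    then have "norm e = 1" using orthonormal_norm[OF is_onb_orthonormal[OF E(1)]] by simp
    then show "(\<integral>\<^sup>+ b. ennreal (expval A e) * ennreal ((cmod (cinner e b))\<^sup>2) \<partial>count_space B) = ennreal (expval A e)"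
      by (subst nn_integral_cmult) (simp_all add: cmod_cinner_commute[of e] parseval_nn[OF B])
  qed
  finally show ?thesis .
qed

text \<open>\<open>trace\<close> is an \<open>infsum\<close> over one chosen basis, so summability
  has to be known before its value 1 says anything about the diagonal entries.\<close>

lemma is_state_trace_nn:
  assumes A: "is_state A" and B: "is_onb B"
  shows "(\<integral>\<^sup>+ e. ennreal (expval A e) \<partial>count_space B) = 1"
proof -
  note A' = is_state_D[OF A]
  let ?D = "SOME B. is_onb (B :: 'a set)"
  have D: "is_onb ?D" by (rule is_onb_some)
  have "(\<lambda>e. cinner e (A e)) summable_on ?D"
    using trace_class_diag_summable[OF is_onb_orthonormal[OF D] A'(2)] by (rule abs_summable_summable)
  then have "((\<lambda>e. cinner e (A e)) has_sum 1) ?D"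
    using A unfolding is_state_def trace_def by (metis has_sum_infsum)
  from has_sum_Re[OF this] have "(expval A has_sum 1) ?D" by (simp add: expval_def[abs_def])
  from has_sum_imp_nn_integral[OF this]
  have "(\<integral>\<^sup>+ e. ennreal (expval A e) \<partial>count_space ?D) = 1" by (simp add: positive_op_expval(2)[OF A'(1)])
  then show ?thesis using trace_nn[OF A' B] trace_nn[OF A' D] by simp
qed


section \<open>Isospectrality of the two reduced states\<close>

text \<open>The logarithm is split off as a nonnegative weight, so that the remaining eigenvalue can
  be expanded as a sum. For an eigenvalue above 1 both sides are truncated to 0.\<close>

lemma entropy_alt:
  assumes "positive_op A"
  shows "entropy A = (\<integral>\<^sup>+ e. ennreal (- ln (expval A e)) * ennreal (expval A e) \<partial>count_space (eigenbasis A))"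
  unfolding entropy_def
proof (rule nn_integral_cong)
  fix e
  show "ennreal (- (expval A e * ln (expval A e))) = ennreal (- ln (expval A e)) * ennreal (expval A e)"
  proof (cases "0 \<le> - ln (expval A e)")
    case True
    then show ?thesis using positive_op_expval(2)[OF assms, of e]
      by (simp add: ennreal_mult[symmetric] mult.commute)
  next
    case False
    then have "- (expval A e * ln (expval A e)) \<le> 0" using positive_op_expval(2)[OF assms, of e] by simp
    then show ?thesis using False by (simp add: ennreal_neg)
  qed
qed

context
  fixes t :: "'a::separable_chilbert \<Rightarrow> 'b::separable_chilbert \<Rightarrow> 'c::separable_chilbert"
  assumes t: "hilbert_tensor t"
begin

lemma expval_ptrace_ketbra: "expval (ptrace_fst t (ketbra \<phi> \<phi>)) k = (norm (contract2 t k \<phi>))\<^sup>2"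
  by (simp add: expval_def cinner_ptrace_ketbra[OF t] cinner_self)

text \<open>An eigenvalue of the second reduced operator is the squared norm of a contraction,
  expanded here in the eigenbasis of the first one. The weights become the squared amplitudes of
  \<phi> in the product of both eigenbases, which are symmetric in the two factors.\<close>

lemma entropy_double_sum:
  "entropy (ptrace_fst t (ketbra \<phi> \<phi>)) =
    (\<integral>\<^sup>+ g. \<integral>\<^sup>+ e. ennreal (- ln (expval (ptrace_fst t (ketbra \<phi> \<phi>)) g)) * ennreal ((cmod (cinner (t e g) \<phi>))\<^sup>2)
      \<partial>count_space (eigenbasis (ptrace_snd t (ketbra \<phi> \<phi>))) \<partial>count_space (eigenbasis (ptrace_fst t (ketbra \<phi> \<phi>))))"
proof -
  let ?E = "eigenbasis (ptrace_snd t (ketbra \<phi> \<phi>))"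
  have E: "is_onb ?E"
    unfolding ptrace_snd_flip[of t]
    by (rule eigenbasis_props(1)[OF positive_op_ptrace_ketbra[OF tensor_flip[OF t]]
          trace_class_ptrace_ketbra[OF tensor_flip[OF t]]])
  have "ennreal (expval (ptrace_fst t (ketbra \<phi> \<phi>)) g)
      = (\<integral>\<^sup>+ e. ennreal ((cmod (cinner (t e g) \<phi>))\<^sup>2) \<partial>count_space ?E)" for g
    unfolding expval_ptrace_ketbra using parseval_nn[OF E, of "contract2 t g \<phi>"]
    by (simp add: cinner_contract2[OF t])
  then show ?thesis
    unfolding entropy_alt[OF positive_op_ptrace_ketbra[OF t]]
    by (simp add: nn_integral_cmult)
qed

end

context
  fixes t :: "'a::separable_chilbert \<Rightarrow> 'b::separable_chilbert \<Rightarrow> 'c::separable_chilbert"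
  assumes t: "hilbert_tensor t"
begin

lemmas ptrace_snd_ketbra_apply =
  ptrace_ketbra_apply[OF tensor_flip[OF t], folded ptrace_snd_flip[of t], unfolded contract1_flip[of t] contract2_flip[of t]]
lemmas positive_op_ptrace_snd_ketbra = positive_op_ptrace_ketbra[OF tensor_flip[OF t], folded ptrace_snd_flip[of t]]
lemmas trace_class_ptrace_snd_ketbra = trace_class_ptrace_ketbra[OF tensor_flip[OF t], folded ptrace_snd_flip[of t]]
lemmas is_state_ptrace_snd_ketbra = is_state_ptrace_ketbra[OF tensor_flip[OF t], folded ptrace_snd_flip[of t]]
lemmas cinner_ptrace_snd_ketbra =
  cinner_ptrace_ketbra[OF tensor_flip[OF t], folded ptrace_snd_flip[of t], unfolded contract2_flip[of t]]

text \<open>Writing \<open>J\<close> and \<open>J'\<close> for the antilinear contractions of the vector with the second and the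
  first factor, the reduced operators are \<open>J J'\<close> and \<open>J' J\<close>, and \<open>(J J') J = J (J' J)\<close>.\<close>

lemma eigenvalues_ptrace_ketbra:
  assumes e: "e \<in> eigenbasis (ptrace_snd t (ketbra \<phi> \<phi>))" and g: "g \<in> eigenbasis (ptrace_fst t (ketbra \<phi> \<phi>))"
    and ne: "cinner (t e g) \<phi> \<noteq> 0"
  shows "expval (ptrace_snd t (ketbra \<phi> \<phi>)) e = expval (ptrace_fst t (ketbra \<phi> \<phi>)) g"
proof -
  let ?A = "ptrace_snd t (ketbra \<phi> \<phi>)" and ?C = "ptrace_fst t (ketbra \<phi> \<phi>)" and ?J = "\<lambda>k. contract2 t k \<phi>"
  note A = positive_op_ptrace_snd_ketbra[of \<phi>] trace_class_ptrace_snd_ketbra[of \<phi>]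
  note C = positive_op_ptrace_ketbra[OF t, of \<phi>] trace_class_ptrace_ketbra[OF t, of \<phi>]
  have "?A (?J g) = ?J (?C g)"
    by (simp add: ptrace_snd_ketbra_apply ptrace_ketbra_apply[OF t])
  also have "\<dots> = of_real (expval ?C g) *\<^sub>C ?J g"
    by (simp add: eigenbasis_props(2)[OF C g] contract2_scaleC_left[OF t])
  finally have "cinner e (?A (?J g)) = of_real (expval ?C g) * cinner (t e g) \<phi>"
    by (simp add: cinner_scaleC_right cinner_contract2[OF t])
  moreover have "cinner e (?A (?J g)) = of_real (expval ?A e) * cinner (t e g) \<phi>"
    by (simp add: positive_op_hermitian[OF A(1), symmetric] eigenbasis_props(2)[OF A e] cinner_scaleC_left
        cinner_contract2[OF t] tensor_scaleC_left[OF t])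
  ultimately show ?thesis using ne by simp
qed

text \<open>Both entropies are sums over the product of the two eigenbases with the same squared
  amplitudes. Wherever an amplitude is nonzero the two eigenvalues agree, so the logarithms may be
  exchanged, without any matching of multiplicities.\<close>

lemma entropy_ptrace_snd_eq_fst:
  "entropy (ptrace_snd t (ketbra \<phi> \<phi>)) = entropy (ptrace_fst t (ketbra \<phi> \<phi>))"
proof -
  let ?A = "ptrace_snd t (ketbra \<phi> \<phi>)" and ?C = "ptrace_fst t (ketbra \<phi> \<phi>)"
  note A = positive_op_ptrace_snd_ketbra[of \<phi>] trace_class_ptrace_snd_ketbra[of \<phi>]
  have "entropy ?A = (\<integral>\<^sup>+ e. \<integral>\<^sup>+ g. ennreal (- ln (expval ?A e)) * ennreal ((cmod (cinner (t e g) \<phi>))\<^sup>2)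
      \<partial>count_space (eigenbasis ?C) \<partial>count_space (eigenbasis ?A))"
    by (rule entropy_double_sum[OF tensor_flip[OF t], of \<phi>, folded ptrace_snd_flip[of t],
        unfolded ptrace_snd_flip[of "\<lambda>b a. t a b"]])
  also have "\<dots> = (\<integral>\<^sup>+ e. \<integral>\<^sup>+ g. ennreal (- ln (expval ?C g)) * ennreal ((cmod (cinner (t e g) \<phi>))\<^sup>2)
      \<partial>count_space (eigenbasis ?C) \<partial>count_space (eigenbasis ?A))"
  proof (intro nn_integral_cong)
    fix e g assume "e \<in> space (count_space (eigenbasis ?A))" "g \<in> space (count_space (eigenbasis ?C))"
    then show "ennreal (- ln (expval ?A e)) * ennreal ((cmod (cinner (t e g) \<phi>))\<^sup>2)
      = ennreal (- ln (expval ?C g)) * ennreal ((cmod (cinner (t e g) \<phi>))\<^sup>2)"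
      using eigenvalues_ptrace_ketbra[of e \<phi> g] by (cases "cinner (t e g) \<phi> = 0") auto
  qed
  also have "\<dots> = (\<integral>\<^sup>+ g. \<integral>\<^sup>+ e. ennreal (- ln (expval ?C g)) * ennreal ((cmod (cinner (t e g) \<phi>))\<^sup>2)
      \<partial>count_space (eigenbasis ?A) \<partial>count_space (eigenbasis ?C))"
    by (rule nn_integral_count_space_nn_integral[symmetric])
      (auto intro: orthonormal_countable is_onb_orthonormal eigenbasis_props(1)[OF A])
  also have "\<dots> = entropy ?C" by (rule entropy_double_sum[OF t, symmetric])
  finally show ?thesis .
qed

end

section \<open>Integrals of families of vectors and operators\<close>

text \<open>Unconditional sums converge along the filter of finite subsets, whereas measurability of
  limits and dominated convergence are about sequences.\<close>

lemma countable_exhaustion: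
  assumes "countable B"
  obtains F :: "nat \<Rightarrow> 'a set"
  where "\<And>n. finite (F n)" "\<And>n. F n \<subseteq> B" "filterlim F (finite_subsets_at_top B) sequentially"
proof (cases "B = {}")
  case True
  have "filterlim (\<lambda>_. {}) (finite_subsets_at_top B) sequentially"
    unfolding filterlim_iff eventually_finite_subsets_at_top using True by auto
  then show ?thesis using that[of "\<lambda>_. {}"] by simp
next
  case False
  let ?F = "\<lambda>n. from_nat_into B ` {..n}"
  have r: "range (from_nat_into B) = B" using assms False by simp
  have "filterlim ?F (finite_subsets_at_top B) sequentially"
    unfolding filterlim_iff
  proof (intro allI impI)
    fix P assume "eventually P (finite_subsets_at_top B)"
    then obtain X where X0: "finite X \<and> X \<subseteq> B \<and> (\<forall>Y. finite Y \<and> X \<subseteq> Y \<and> Y \<subseteq> B \<longrightarrow> P Y)"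
      unfolding eventually_finite_subsets_at_top by (elim exE)
    have X: "finite X" "X \<subseteq> B" "\<And>Y. finite Y \<Longrightarrow> X \<subseteq> Y \<Longrightarrow> Y \<subseteq> B \<Longrightarrow> P Y"
      using X0 by simp_all
    obtain C where C: "finite C" "X = from_nat_into B ` C"
    proof -
      have "X \<subseteq> from_nat_into B ` UNIV" using X(2) r by simp
      from finite_subset_image[OF X(1) this] show ?thesis using that by blast
    qed
    obtain m where m: "C \<subseteq> {..m}" using C(1) finite_nat_iff_bounded_le by blast
    have "P (?F n)" if "n \<ge> m" for n
    proof (rule X(3))
      show "X \<subseteq> ?F n" unfolding C(2) using m that by (intro image_mono) auto
      show "?F n \<subseteq> B" using r by blast
    qed simp
    then show "eventually (\<lambda>n. P (?F n)) sequentially"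
      unfolding eventually_sequentially by blast
  qed
  then show ?thesis using that[of ?F] r by blast
qed

lemma borel_measurable_has_sum:
  fixes f :: "'i \<Rightarrow> 'x \<Rightarrow> 'b::{second_countable_topology, real_normed_vector}"
  assumes "countable B" "\<And>b. b \<in> B \<Longrightarrow> f b \<in> borel_measurable M"
    and "\<And>x. x \<in> space M \<Longrightarrow> ((\<lambda>b. f b x) has_sum g x) B"
  shows "g \<in> borel_measurable M"
proof -
  obtain F where F: "\<And>n. finite (F n)" "\<And>n. F n \<subseteq> B" "filterlim F (finite_subsets_at_top B) sequentially"
    using countable_exhaustion[OF assms(1)] by blast
  show ?thesis
  proof (rule borel_measurable_LIMSEQ_metric)
    show "(\<lambda>x. \<Sum>b\<in>F n. f b x) \<in> borel_measurable M" for n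
      using F(2)[of n] by (intro borel_measurable_sum assms(2)) auto
    fix x assume "x \<in> space M"
    from assms(3)[OF this] show "(\<lambda>n. \<Sum>b\<in>F n. f b x) \<longlonglongrightarrow> g x"
      unfolding has_sum_def by (rule filterlim_compose[OF _ F(3)])
  qed
qed

text \<open>Dominated convergence for unconditional sums, with w dominating all finite sums of
  norms. The sum of the integrals then converges absolutely, and its value is found along an
  exhausting sequence of finite sets.\<close>

lemma has_sum_integral:
  fixes f :: "'i \<Rightarrow> 'x \<Rightarrow> 'b::{banach, second_countable_topology}"
  assumes D: "countable D" and f: "\<And>d. d \<in> D \<Longrightarrow> f d \<in> borel_measurable N"
    and w: "integrable N w"
    and bound: "\<And>x F. x \<in> space N \<Longrightarrow> finite F \<Longrightarrow> F \<subseteq> D \<Longrightarrow> (\<Sum>d\<in>F. norm (f d x)) \<le> w x"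
    and g: "\<And>x. x \<in> space N \<Longrightarrow> ((\<lambda>d. f d x) has_sum g x) D"
  shows "((\<lambda>d. \<integral>x. f d x \<partial>N) has_sum (\<integral>x. g x \<partial>N)) D" "integrable N g" "\<And>d. d \<in> D \<Longrightarrow> integrable N (f d)"
proof -
  show int: "integrable N (f d)" if "d \<in> D" for d
  proof (rule Bochner_Integration.integrable_bound[OF w f[OF that]], rule AE_I2)
    fix x assume "x \<in> space N"
    then show "norm (f d x) \<le> norm (w x)" using bound[of x "{d}"] that by auto
  qed
  obtain F where F: "\<And>n. finite (F n)" "\<And>n. F n \<subseteq> D" "filterlim F (finite_subsets_at_top D) sequentially"
    using countable_exhaustion[OF D] by blast
  have mg: "g \<in> borel_measurable N" by (rule borel_measurable_has_sum[OF D f g])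
  have mF: "(\<lambda>x. \<Sum>d\<in>F n. f d x) \<in> borel_measurable N" for n
    using F(2)[of n] by (intro borel_measurable_sum f) auto
  have lim: "AE x in N. (\<lambda>n. \<Sum>d\<in>F n. f d x) \<longlonglongrightarrow> g x"
    using g unfolding has_sum_def by (intro AE_I2 filterlim_compose[OF _ F(3)]) auto
  have bd: "AE x in N. norm (\<Sum>d\<in>F n. f d x) \<le> w x" for n
  proof (rule AE_I2)
    fix x assume "x \<in> space N"
    then show "norm (\<Sum>d\<in>F n. f d x) \<le> w x"
      using order_trans[OF norm_sum bound[OF _ F(1) F(2)]] by blast
  qed
  show "integrable N g" by (rule integrable_dominated_convergence[OF mg mF w lim bd])
  have l1: "(\<lambda>n. \<integral>x. (\<Sum>d\<in>F n. f d x) \<partial>N) \<longlonglongrightarrow> (\<integral>x. g x \<partial>N)"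
    by (rule integral_dominated_convergence[OF mg mF w lim bd])
  have "(\<lambda>d. norm (\<integral>x. f d x \<partial>N)) summable_on D"
  proof (rule nonneg_bdd_above_summable_on, simp, rule bdd_aboveI2[where M = "\<integral>x. w x \<partial>N"])
    fix J assume "J \<in> {F. F \<subseteq> D \<and> finite F}"
    then have J: "finite J" "J \<subseteq> D" by auto
    have "(\<Sum>d\<in>J. norm (\<integral>x. f d x \<partial>N)) \<le> (\<Sum>d\<in>J. \<integral>x. norm (f d x) \<partial>N)"
      by (intro sum_mono integral_norm_bound)
    also have "\<dots> = (\<integral>x. (\<Sum>d\<in>J. norm (f d x)) \<partial>N)"
      using J by (intro Bochner_Integration.integral_sum[symmetric] integrable_norm int) auto
    also have "\<dots> \<le> (\<integral>x. w x \<partial>N)"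
      using J by (intro integral_mono w Bochner_Integration.integrable_sum integrable_norm int bound) auto
    finally show "(\<Sum>d\<in>J. norm (\<integral>x. f d x \<partial>N)) \<le> (\<integral>x. w x \<partial>N)" .
  qed
  then have hs: "((\<lambda>d. \<integral>x. f d x \<partial>N) has_sum (\<Sum>\<^sub>\<infinity>d\<in>D. \<integral>x. f d x \<partial>N)) D"
    by (rule has_sum_infsum[OF abs_summable_summable])
  then have "(\<lambda>n. \<Sum>d\<in>F n. \<integral>x. f d x \<partial>N) \<longlonglongrightarrow> (\<Sum>\<^sub>\<infinity>d\<in>D. \<integral>x. f d x \<partial>N)"
    unfolding has_sum_def by (rule filterlim_compose[OF _ F(3)])
  moreover have "(\<Sum>d\<in>F n. \<integral>x. f d x \<partial>N) = (\<integral>x. (\<Sum>d\<in>F n. f d x) \<partial>N)" for n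
    using F(2)[of n] by (intro Bochner_Integration.integral_sum[symmetric] int) auto
  ultimately have "(\<Sum>\<^sub>\<infinity>d\<in>D. \<integral>x. f d x \<partial>N) = (\<integral>x. g x \<partial>N)"
    using LIMSEQ_unique l1 by simp
  then show "((\<lambda>d. \<integral>x. f d x \<partial>N) has_sum (\<integral>x. g x \<partial>N)) D" using hs by simp
qed

lemma borel_measurable_nn_integral_count_space:
  fixes f :: "'i \<Rightarrow> 'a \<Rightarrow> ennreal"
  assumes "countable I" and [measurable]: "\<And>i. i \<in> I \<Longrightarrow> f i \<in> borel_measurable M"
  shows "(\<lambda>x. \<integral>\<^sup>+i. f i x \<partial>count_space I) \<in> borel_measurable M"
proof (cases "finite I")
  case True
  then show ?thesis by (simp add: nn_integral_count_space_finite)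
next
  case False
  then have [simp]: "I \<noteq> {}" by auto
  note * = bij_betw_from_nat_into[OF assms(1) False]
  have "(\<integral>\<^sup>+i. f i x \<partial>count_space I) = (\<Sum>n. f (from_nat_into I n) x)" for x
    by (simp add: nn_integral_bij_count_space[symmetric, OF *] nn_integral_count_space_nat)
  moreover have "f (from_nat_into I n) \<in> borel_measurable M" for n by (simp add: from_nat_into)
  ultimately show ?thesis by simp
qed

section \<open>Measurable families of vectors\<close>

lemma borel_measurable_cinner:
  fixes f g :: "'x \<Rightarrow> 'a::separable_chilbert"
  assumes "f \<in> borel_measurable M" "g \<in> borel_measurable M"
  shows "(\<lambda>x. cinner (f x) (g x)) \<in> borel_measurable M"
proof -
  have "continuous_on UNIV (\<lambda>z::'a \<times> 'a. cinner (fst z) (snd z))"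
    by (intro cinner.continuous_on continuous_intros)
  then have "(\<lambda>z::'a \<times> 'a. cinner (fst z) (snd z)) \<in> borel_measurable borel"
    by (rule borel_measurable_continuous_onI)
  from borel_measurable_continuous_Pair[OF assms, of cinner] this show ?thesis
    using \<open>continuous_on UNIV _\<close> by blast
qed

text \<open>By separability the basis is countable, and the vector is the pointwise limit of its
  expansion.\<close>

lemma borel_measurable_weak:
  fixes f :: "'x \<Rightarrow> 'a::separable_chilbert"
  assumes B: "is_onb B" and f: "\<And>b. b \<in> B \<Longrightarrow> (\<lambda>x. cinner b (f x)) \<in> borel_measurable M"
  shows "f \<in> borel_measurable M"
proof (rule borel_measurable_has_sum[OF orthonormal_countable[OF is_onb_orthonormal[OF B]]])
  show "(\<lambda>x. cinner b (f x) *\<^sub>C b) \<in> borel_measurable M" if "b \<in> B" for b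
    by (rule measurable_compose[OF f[OF that] borel_measurable_continuous_onI])
      (rule linear_continuous_on[OF scaleC.bounded_linear_left])
  show "((\<lambda>b. cinner b (f x) *\<^sub>C b) has_sum f x) B" for x by (rule onb_expand[OF B])
qed

lemma borel_measurable_bounded_linear:
  fixes f :: "'x \<Rightarrow> 'a::{real_normed_vector, second_countable_topology}"
  assumes "f \<in> borel_measurable M" "bounded_linear h"
  shows "(\<lambda>x. h (f x) :: 'b::real_normed_vector) \<in> borel_measurable M"
  by (rule measurable_compose[OF assms(1) borel_measurable_continuous_onI[OF linear_continuous_on[OF assms(2)]]])

lemma integral_cinner_right:
  fixes f :: "'x \<Rightarrow> 'a::separable_chilbert"
  assumes "integrable M f"
  shows "cinner u (\<integral>x. f x \<partial>M) = (\<integral>x. cinner u (f x) \<partial>M)"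
  by (rule integral_bounded_linear[OF cinner.bounded_linear_right assms, symmetric])

section \<open>Weak integrals of rank-one operators\<close>

context
  fixes N :: "'x measure" and \<xi> :: "'x \<Rightarrow> 'c::separable_chilbert"
  assumes m: "\<xi> \<in> borel_measurable N" and int: "integrable N (\<lambda>x. (norm (\<xi> x))\<^sup>2)"
begin

lemma integrable_cinner_mult:
  "integrable N (\<lambda>x. cinner u (\<xi> x) * cinner (\<xi> x) v)"
proof (rule Bochner_Integration.integrable_bound)
  show "integrable N (\<lambda>x. norm u * norm v * (norm (\<xi> x))\<^sup>2)" using int by simp
  show "(\<lambda>x. cinner u (\<xi> x) * cinner (\<xi> x) v) \<in> borel_measurable N"
    by (intro borel_measurable_times borel_measurable_cinner m borel_measurable_const)
  show "AE x in N. norm (cinner u (\<xi> x) * cinner (\<xi> x) v) \<le> norm (norm u * norm v * (norm (\<xi> x))\<^sup>2)"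
  proof (rule AE_I2)
    fix x
    have "norm (cinner u (\<xi> x) * cinner (\<xi> x) v) \<le> (norm u * norm (\<xi> x)) * (norm (\<xi> x) * norm v)"
      unfolding norm_mult by (intro mult_mono cmod_cinner_le) auto
    then show "norm (cinner u (\<xi> x) * cinner (\<xi> x) v) \<le> norm (norm u * norm v * (norm (\<xi> x))\<^sup>2)"
      by (simp add: power2_eq_square mult_ac)
  qed
qed

text \<open>The mixture of the operators |\<xi> x><\<xi> x| is formed vector by vector, as a Bochner
  integral in the Hilbert space. The trace norm estimate for a single rank-one operator, taken under
  the integral, makes it trace class.\<close>

lemma weak_integral_ketbra:
  "\<exists>S. trace_class S \<and> (\<forall>u v. cinner u (S v) = (\<integral>x. cinner u (\<xi> x) * cinner (\<xi> x) v \<partial>N))"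
proof -
  let ?g = "\<lambda>v x. cinner (\<xi> x) v *\<^sub>C \<xi> x"
  have mg: "?g v \<in> borel_measurable N" for v
  proof -
    have "continuous_on UNIV (\<lambda>z::'c. cinner z v *\<^sub>C z)"
      by (intro scaleC.continuous_on continuous_on_id linear_continuous_on cinner.bounded_linear_left)
    from measurable_compose[OF m borel_measurable_continuous_onI[OF this]] show ?thesis .
  qed
  have bg: "norm (?g v x) \<le> norm v * (norm (\<xi> x))\<^sup>2" for v x
    using mult_right_mono[OF cmod_cinner_le[of "\<xi> x" v], of "norm (\<xi> x)"]
    by (simp add: norm_scaleC power2_eq_square mult_ac)
  have ig: "integrable N (?g v)" for v
  proof (rule Bochner_Integration.integrable_bound[OF _ mg])
    show "integrable N (\<lambda>x. norm v * (norm (\<xi> x))\<^sup>2)" using int by simp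
    show "AE x in N. norm (?g v x) \<le> norm (norm v * (norm (\<xi> x))\<^sup>2)" using bg by simp
  qed
  define S where "S = Blinfun (\<lambda>v. \<integral>x. ?g v x \<partial>N)"
  have bl: "bounded_linear (\<lambda>v. \<integral>x. ?g v x \<partial>N)"
  proof (rule bounded_linear_intro[where K = "\<integral>x. (norm (\<xi> x))\<^sup>2 \<partial>N"])
    show "(\<integral>x. ?g (u + v) x \<partial>N) = (\<integral>x. ?g u x \<partial>N) + (\<integral>x. ?g v x \<partial>N)" for u v
      by (simp add: cinner_add_right scaleC_add_left Bochner_Integration.integral_add[OF ig ig])
    show "(\<integral>x. ?g (r *\<^sub>R v) x \<partial>N) = r *\<^sub>R (\<integral>x. ?g v x \<partial>N)" for r v
      by (simp add: cinner_scaleR_right scaleC.scaleR_left)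
    show "norm (\<integral>x. ?g v x \<partial>N) \<le> norm v * (\<integral>x. (norm (\<xi> x))\<^sup>2 \<partial>N)" for v
    proof -
      have "norm (\<integral>x. ?g v x \<partial>N) \<le> (\<integral>x. norm (?g v x) \<partial>N)" by (rule integral_norm_bound)
      also have "\<dots> \<le> (\<integral>x. norm v * (norm (\<xi> x))\<^sup>2 \<partial>N)"
        using int by (intro integral_mono integrable_norm ig bg) simp
      finally show ?thesis by simp
    qed
  qed
  have S: "cinner u (S v) = (\<integral>x. cinner u (\<xi> x) * cinner (\<xi> x) v \<partial>N)" for u v
    unfolding S_def bounded_linear_Blinfun_apply[OF bl] integral_cinner_right[OF ig]
    by (simp add: cinner_scaleC_right mult.commute)
  have "clinear_op S"
    unfolding clinear_op_def by (intro allI cinner_eqI)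
      (simp add: S cinner_scaleC_right mult.left_commute)
  moreover have "trace_norm S \<le> ennreal (\<integral>x. (norm (\<xi> x))\<^sup>2 \<partial>N)"
  proof (rule trace_norm_leI)
    fix n and e f :: "nat \<Rightarrow> 'c" assume e: "orthonormal_upto n e" and f: "orthonormal_upto n f"
    have "(\<Sum>i<n. cmod (cinner (e i) (S (f i))))
        \<le> (\<Sum>i<n. \<integral>x. cmod (cinner (e i) (\<xi> x) * cinner (\<xi> x) (f i)) \<partial>N)"
      unfolding S by (intro sum_mono integral_norm_bound)
    also have "\<dots> = (\<integral>x. (\<Sum>i<n. cmod (cinner (e i) (\<xi> x) * cinner (\<xi> x) (f i))) \<partial>N)"
      by (intro Bochner_Integration.integral_sum[symmetric] integrable_norm integrable_cinner_mult)
    also have "\<dots> \<le> (\<integral>x. (norm (\<xi> x))\<^sup>2 \<partial>N)"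
    proof (intro integral_mono int Bochner_Integration.integrable_sum integrable_norm integrable_cinner_mult)
      fix x
      have "(\<Sum>i<n. cmod (cinner (e i) (\<xi> x) * cinner (\<xi> x) (f i)))
          \<le> (\<Sum>i<n. ((cmod (cinner (e i) (\<xi> x)))\<^sup>2 + (cmod (cinner (f i) (\<xi> x)))\<^sup>2) / 2)"
        unfolding norm_mult cmod_cinner_commute[of "\<xi> x"] by (intro sum_mono mult_le_half_squares)
      also have "\<dots> \<le> (norm (\<xi> x))\<^sup>2"
        using bessel_upto[OF e, of "\<xi> x"] bessel_upto[OF f, of "\<xi> x"]
        by (simp add: sum.distrib sum_divide_distrib[symmetric])
      finally show "(\<Sum>i<n. cmod (cinner (e i) (\<xi> x) * cinner (\<xi> x) (f i))) \<le> (norm (\<xi> x))\<^sup>2" .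
    qed
    finally show "(\<Sum>i<n. ennreal (cmod (cinner (e i) (S (f i))))) \<le> ennreal (\<integral>x. (norm (\<xi> x))\<^sup>2 \<partial>N)"
      by (simp add: sum_ennreal ennreal_leI)
  qed
  then have "trace_norm S < \<infinity>" using order.strict_trans1 ennreal_less_top by (metis infinity_ennreal_def)
  ultimately show ?thesis using S unfolding trace_class_def by blast
qed

context
  fixes t :: "'a::separable_chilbert \<Rightarrow> 'b::separable_chilbert \<Rightarrow> 'c"
  assumes t: "hilbert_tensor t"
begin

lemma borel_measurable_contract2: "(\<lambda>x. contract2 t k (\<xi> x)) \<in> borel_measurable N"
  by (rule borel_measurable_bounded_linear[OF m bounded_linear_contract2[OF t]])

text \<open>The partial trace is an infinite sum that has to be exchanged with the integral;
  Bessel's inequality for the two contractions supplies the dominating function.\<close>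

lemma cinner_ptrace_weak_integral:
  assumes S: "trace_class S" "\<And>u v. cinner u (S v) = (\<integral>x. cinner u (\<xi> x) * cinner (\<xi> x) v \<partial>N)"
  shows "cinner k (ptrace_fst t S l) = (\<integral>x. cinner k (ptrace_fst t (ketbra (\<xi> x) (\<xi> x)) l) \<partial>N)"
proof -
  let ?D = "SOME D. is_onb (D :: 'a set)"
  have D: "is_onb ?D" by (rule is_onb_some)
  let ?f = "\<lambda>d x. cinner (t d k) (\<xi> x) * cinner (\<xi> x) (t d l)"
  have "((\<lambda>d. \<integral>x. ?f d x \<partial>N) has_sum (\<integral>x. cinner k (ptrace_fst t (ketbra (\<xi> x) (\<xi> x)) l) \<partial>N)) ?D"
  proof (rule has_sum_integral(1))
    show "countable ?D" by (rule orthonormal_countable[OF is_onb_orthonormal[OF D]])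
    show "?f d \<in> borel_measurable N" for d
      by (intro borel_measurable_times borel_measurable_cinner m borel_measurable_const)
    show "integrable N (\<lambda>x. ((norm k)\<^sup>2 + (norm l)\<^sup>2) / 2 * (norm (\<xi> x))\<^sup>2)" using int by simp
    show "((\<lambda>d. ?f d x) has_sum cinner k (ptrace_fst t (ketbra (\<xi> x) (\<xi> x)) l)) ?D" for x
      using parseval[OF D, of "contract2 t l (\<xi> x)" "contract2 t k (\<xi> x)"]
      by (simp add: cinner_ptrace_ketbra[OF t] cinner_contract2[OF t] cinner_contract2_left[OF t] mult.commute)
    fix x F assume F: "finite F" "F \<subseteq> ?D"
    have "(\<Sum>d\<in>F. norm (?f d x)) \<le> (\<Sum>d\<in>F. ((cmod (cinner d (contract2 t k (\<xi> x))))\<^sup>2 + (cmod (cinner d (contract2 t l (\<xi> x))))\<^sup>2) / 2)"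
      unfolding norm_mult cmod_cinner_commute[of "\<xi> x"] cinner_contract2[OF t]
      by (intro sum_mono mult_le_half_squares)
    also have "\<dots> \<le> ((norm (contract2 t k (\<xi> x)))\<^sup>2 + (norm (contract2 t l (\<xi> x)))\<^sup>2) / 2"
      using bessel_finite[OF is_onb_orthonormal[OF D] F, of "contract2 t k (\<xi> x)"]
        bessel_finite[OF is_onb_orthonormal[OF D] F, of "contract2 t l (\<xi> x)"]
      by (simp add: sum.distrib sum_divide_distrib[symmetric])
    also have "\<dots> \<le> ((norm k * norm (\<xi> x))\<^sup>2 + (norm l * norm (\<xi> x))\<^sup>2) / 2"
      by (intro divide_right_mono add_mono power_mono norm_contract2_le[OF t]) auto
    finally show "(\<Sum>d\<in>F. norm (?f d x)) \<le> ((norm k)\<^sup>2 + (norm l)\<^sup>2) / 2 * (norm (\<xi> x))\<^sup>2"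
      by (simp add: power_mult_distrib algebra_simps)
  qed
  moreover have "((\<lambda>d. \<integral>x. ?f d x \<partial>N) has_sum cinner k (ptrace_fst t S l)) ?D"
    using ptrace_fst_has_sum[OF t S(1), of k l] by (simp add: cinner_contract1[OF t] S(2))
  ultimately show ?thesis using has_sum_unique by blast
qed

text \<open>This is the bound of (I \<otimes> A) z by \<open>norm A * norm z\<close>, written in
  contractions so that I \<otimes> A is never constructed. After expansion in a basis D of the first
  factor, Bessel's inequality applies to the vectors \<open>A (contract1 t d z)\<close>.\<close>

lemma contract2_adj_bessel:
  assumes G: "orthonormal G" and A: "clinear_op A" and F: "finite F" "F \<subseteq> G"
  shows "(\<Sum>g\<in>F. (norm (contract2 t (blinfun_apply (adj A) g) z))\<^sup>2) \<le> (norm A)\<^sup>2 * (norm z)\<^sup>2"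
proof -
  obtain D :: "'a set" where D: "is_onb D" using is_onb_some by blast
  let ?J = "\<lambda>g. contract2 t (blinfun_apply (adj A) g) z"
  have "ennreal (\<Sum>g\<in>F. (norm (?J g))\<^sup>2) = (\<Sum>g\<in>F. \<integral>\<^sup>+ d. ennreal ((cmod (cinner d (?J g)))\<^sup>2) \<partial>count_space D)"
    by (simp add: parseval_nn[OF D])
  also have "\<dots> = (\<integral>\<^sup>+ d. (\<Sum>g\<in>F. ennreal ((cmod (cinner d (?J g)))\<^sup>2)) \<partial>count_space D)"
    by (rule nn_integral_sum[symmetric]) simp
  also have "\<dots> \<le> (\<integral>\<^sup>+ d. ennreal ((norm A)\<^sup>2) * ennreal ((norm (contract1 t d z))\<^sup>2) \<partial>count_space D)"
  proof (rule nn_integral_mono)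
    fix d
    let ?y = "A (contract1 t d z)"
    have "cinner d (?J g) = cinner g ?y" for g
      by (simp add: cinner_contract2[OF t] cinner_contract1[OF t, symmetric] cinner_adj_left[OF A])
    then have "(\<Sum>g\<in>F. (cmod (cinner d (?J g)))\<^sup>2) \<le> (norm ?y)\<^sup>2"
      using bessel_finite[OF G F, of ?y] by simp
    also have "\<dots> \<le> (norm A * norm (contract1 t d z))\<^sup>2"
      by (intro power_mono norm_blinfun) simp
    finally have "(\<Sum>g\<in>F. (cmod (cinner d (?J g)))\<^sup>2) \<le> (norm A)\<^sup>2 * (norm (contract1 t d z))\<^sup>2"
      by (simp add: power_mult_distrib)
    then show "(\<Sum>g\<in>F. ennreal ((cmod (cinner d (?J g)))\<^sup>2)) \<le> ennreal ((norm A)\<^sup>2) * ennreal ((norm (contract1 t d z))\<^sup>2)"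
      by (simp add: sum_ennreal ennreal_mult[symmetric] ennreal_leI)
  qed
  also have "\<dots> = ennreal ((norm A)\<^sup>2 * (norm z)\<^sup>2)"
    by (simp add: nn_integral_cmult contract1_parseval_nn[OF t D] ennreal_mult)
  finally show ?thesis by simp
qed

text \<open>The matrix elements of T determine its trace against every bounded A. The diagonal terms
  are inner products of the contractions with g and with \<open>adj A g\<close>, whose finite sums
  are dominated by Bessel bounds for both families.\<close>

lemma trace_weak_integral:
  assumes A: "clinear_op A"
    and T: "\<And>k l. cinner k (blinfun_apply T l) = (\<integral>x. cinner k (ptrace_fst t (ketbra (\<xi> x) (\<xi> x)) l) \<partial>N)"
  shows "trace (A o\<^sub>L T) = (\<integral>x. trace (A o\<^sub>L ptrace_fst t (ketbra (\<xi> x) (\<xi> x))) \<partial>N)"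
    and "integrable N (\<lambda>x. trace (A o\<^sub>L ptrace_fst t (ketbra (\<xi> x) (\<xi> x))))"
proof -
  let ?R = "\<lambda>x. ptrace_fst t (ketbra (\<xi> x) (\<xi> x))"
  let ?G = "SOME D. is_onb (D :: 'b set)"
  have G: "is_onb ?G" by (rule is_onb_some)
  note oG = is_onb_orthonormal[OF G]
  let ?f = "\<lambda>g x. cinner g (blinfun_apply (A o\<^sub>L ?R x) g)"
  have f: "?f g x = cinner (contract2 t g (\<xi> x)) (contract2 t (blinfun_apply (adj A) g) (\<xi> x))" for g x
    by (simp add: cinner_adj_left[OF A, symmetric] cinner_ptrace_ketbra[OF t])
  have bd: "(\<Sum>g\<in>F. norm (?f g x)) \<le> (1 + (norm A)\<^sup>2) / 2 * (norm (\<xi> x))\<^sup>2" if F: "finite F" "F \<subseteq> ?G" for F x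
  proof -
    have "(\<Sum>g\<in>F. norm (?f g x)) \<le> (\<Sum>g\<in>F. norm (contract2 t g (\<xi> x)) * norm (contract2 t (blinfun_apply (adj A) g) (\<xi> x)))"
      unfolding f by (intro sum_mono cmod_cinner_le)
    also have "\<dots> \<le> (\<Sum>g\<in>F. ((norm (contract2 t g (\<xi> x)))\<^sup>2 + (norm (contract2 t (blinfun_apply (adj A) g) (\<xi> x)))\<^sup>2) / 2)"
      by (intro sum_mono mult_le_half_squares)
    also have "\<dots> \<le> ((norm (\<xi> x))\<^sup>2 + (norm A)\<^sup>2 * (norm (\<xi> x))\<^sup>2) / 2"
      using finite_sum_le_has_sum[OF contract2_parseval[OF t G, of "\<xi> x"] F(1) F(2)]
        contract2_adj_bessel[OF oG A F, of "\<xi> x"]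
      by (simp add: sum.distrib sum_divide_distrib[symmetric])
    finally show ?thesis by (simp add: algebra_simps)
  qed
  have hs: "((\<lambda>g. ?f g x) has_sum trace (A o\<^sub>L ?R x)) ?G" for x
    unfolding trace_def
  proof (rule has_sum_infsum[OF abs_summable_summable])
    show "(\<lambda>g. norm (?f g x)) summable_on ?G"
      by (rule nonneg_bdd_above_summable_on, simp, rule bdd_aboveI2, rule bd) auto
  qed
  have mf: "?f g \<in> borel_measurable N" for g
    unfolding f by (intro borel_measurable_cinner borel_measurable_contract2)
  have w: "integrable N (\<lambda>x. (1 + (norm A)\<^sup>2) / 2 * (norm (\<xi> x))\<^sup>2)" using int by simp
  note sums = has_sum_integral[OF orthonormal_countable[OF oG] mf w bd hs]
  show "integrable N (\<lambda>x. trace (A o\<^sub>L ?R x))" by (rule sums(2))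
  have "cinner g (blinfun_apply (A o\<^sub>L T) g) = (\<integral>x. ?f g x \<partial>N)" for g
    by (simp add: cinner_adj_left[OF A, symmetric] T)
  then show "trace (A o\<^sub>L T) = (\<integral>x. trace (A o\<^sub>L ?R x) \<partial>N)"
    unfolding trace_def[of "A o\<^sub>L T"] using infsumI[OF sums(1)] by simp
qed

end
end


section \<open>Measurability of the entropy\<close>

text \<open>Allows the operators to be iterated on vectors that themselves depend on x, as
  \<open>borel_measurable_entropy\<close> does.\<close>

lemma borel_measurable_apply:
  fixes A :: "'x \<Rightarrow> ('a::separable_chilbert \<Rightarrow>\<^sub>L 'a)"
  assumes B: "is_onb B" and A: "\<And>x. positive_op (A x)"
    and mA: "\<And>b c. b \<in> B \<Longrightarrow> c \<in> B \<Longrightarrow> (\<lambda>x. cinner b (blinfun_apply (A x) c)) \<in> borel_measurable M"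
    and y: "y \<in> borel_measurable M"
  shows "(\<lambda>x. blinfun_apply (A x) (y x)) \<in> borel_measurable M"
proof (rule borel_measurable_weak[OF B])
  fix b assume b: "b \<in> B"
  show "(\<lambda>x. cinner b (blinfun_apply (A x) (y x))) \<in> borel_measurable M"
  proof (rule borel_measurable_has_sum[OF orthonormal_countable[OF is_onb_orthonormal[OF B]]])
    show "(\<lambda>x. cinner b (blinfun_apply (A x) c) * cinner c (y x)) \<in> borel_measurable M" if "c \<in> B" for c
      by (intro borel_measurable_times mA b that borel_measurable_cinner borel_measurable_const y)
    show "((\<lambda>c. cinner b (blinfun_apply (A x) c) * cinner c (y x)) has_sum cinner b (blinfun_apply (A x) (y x))) B" for x
      using parseval[OF B, of "blinfun_apply (A x) b" "y x"] by (simp add: positive_op_hermitian[OF A])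
  qed
qed

text \<open>The logarithm series in powers of 1 - a, multiplied by a. On [0,1] all terms are
  nonnegative, and the factor a extends the identity to a = 0.\<close>

lemma minus_x_ln_x_series:
  fixes a :: real
  assumes "0 \<le> a" "a \<le> 1"
  shows "ennreal (- (a * ln a)) = (\<Sum>n. ennreal (1 / real (Suc n)) * ennreal (a * (1 - a) ^ Suc n))"
proof (cases "a = 0")
  case False
  with assms have a: "0 < a" "a \<le> 1" by auto
  let ?f = "\<lambda>n. 1 / real (Suc n) * (a * (1 - a) ^ Suc n)"
  have s: "summable (\<lambda>n. (1 - a) ^ Suc n)"
    using a by (subst summable_Suc_iff) (auto intro: summable_geometric)
  have summ: "summable ?f"
  proof (rule summable_comparison_test'[OF s, of 0])
    fix n
    have "1 / real (Suc n) * (a * (1 - a) ^ Suc n) \<le> 1 * (1 * (1 - a) ^ Suc n)"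
      using a by (intro mult_mono) auto
    then show "norm (?f n) \<le> (1 - a) ^ Suc n" using a by simp
  qed
  have "ln a = (\<Sum>n. (-1)^n * (1 / real (n + 1)) * (a - 1)^(Suc n))"
    using a by (intro ln_series) auto
  also have "(\<lambda>n. (-1)^n * (1 / real (n + 1)) * (a - 1)^(Suc n)) = (\<lambda>n. (- 1 / a) * ?f n)"
  proof
    fix n
    have "(-1)^n * (a - 1)^n = (1 - a)^n" by (simp flip: power_mult_distrib)
    then have p: "(-1)^n * (a - 1)^Suc n = - ((1 - a)^Suc n)"
      by (metis minus_diff_eq mult.assoc mult_minus_right power_Suc2)
    have "(-1)^n * (1 / real (n + 1)) * (a - 1)^(Suc n) = (1 / real (n + 1)) * ((-1)^n * (a - 1)^Suc n)"
      by (simp only: mult_ac)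
    also have "\<dots> = (- 1 / a) * ?f n" unfolding p using a by simp
    finally show "(-1)^n * (1 / real (n + 1)) * (a - 1)^(Suc n) = (- 1 / a) * ?f n" .
  qed
  also have "(\<Sum>n. (- 1 / a) * ?f n) = (- 1 / a) * (\<Sum>n. ?f n)" by (rule suminf_mult[OF summ])
  finally have "- (a * ln a) = (\<Sum>n. ?f n)" using a by (simp add: field_simps)
  also have "ennreal \<dots> = (\<Sum>n. ennreal (?f n))"
    by (rule suminf_ennreal2[symmetric, OF _ summ]) (use a in auto)
  also have "\<dots> = (\<Sum>n. ennreal (1 / real (Suc n)) * ennreal (a * (1 - a) ^ Suc n))"
    using a by (intro suminf_cong ennreal_mult) auto
  finally show ?thesis .
qed simp

lemma is_state_expval_le_1:
  assumes A: "is_state A" and e: "is_onb B" "e \<in> B"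
  shows "expval A e \<le> 1"
proof -
  have "ennreal (expval A e) = (\<integral>\<^sup>+ e. ennreal (expval A e) \<partial>count_space {e})"
    by (simp add: nn_integral_count_space_finite)
  also have "\<dots> \<le> (\<integral>\<^sup>+ e. ennreal (expval A e) \<partial>count_space B)"
    using e by (intro nn_integral_count_space_subset_mono) simp
  also have "\<dots> = 1" by (rule is_state_trace_nn[OF A e(1)])
  finally show ?thesis by (simp flip: ennreal_1)
qed

lemma eigenbasis_apply:
  assumes A: "positive_op A" "trace_class A" and e: "e \<in> eigenbasis A"
  shows "cinner e (A x) = of_real (expval A e) * cinner e x"
  by (simp add: positive_op_hermitian[OF A(1), symmetric] eigenbasis_props(2)[OF A e] cinner_scaleC_left)

text \<open>The entropy is rewritten as \<open>\<Sum>\<^sub>n (1/n) Tr A (1 - A)\<^sup>n\<close>, in which the eigenbasis no longer occurs.\<close>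

lemma entropy_series:
  assumes A: "is_state A" and B: "is_onb B"
  shows "entropy A = (\<Sum>n. ennreal (1 / real (Suc n)) *
    (\<integral>\<^sup>+ b. ennreal (Re (cinner b (A (((\<lambda>v. v - A v) ^^ Suc n) b)))) \<partial>count_space B))"
proof -
  note A' = is_state_D[OF A]
  note E = eigenbasis_props[OF A']
  let ?a = "expval A" and ?T = "\<lambda>v. v - A v"
  have iter: "cinner e ((?T ^^ k) x) = of_real ((1 - ?a e) ^ k) * cinner e x" if "e \<in> eigenbasis A" for e k x
    by (induction k) (simp_all add: cinner.diff_right eigenbasis_apply[OF A' that] algebra_simps)
  have tm: "ennreal (Re (cinner b (A ((?T ^^ k) b))))
     = (\<integral>\<^sup>+ e. ennreal (?a e * (1 - ?a e) ^ k) * ennreal ((cmod (cinner e b))\<^sup>2) \<partial>count_space (eigenbasis A))" for b k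
  proof -
    let ?v = "A ((?T ^^ k) b)"
    have "((\<lambda>e. Re (cinner b e * cinner e ?v)) has_sum Re (cinner b ?v)) (eigenbasis A)"
      by (intro has_sum_Re parseval E(1))
    moreover have "Re (cinner b e * cinner e ?v) = ?a e * (1 - ?a e) ^ k * (cmod (cinner e b))\<^sup>2"
      if "e \<in> eigenbasis A" for e
    proof -
      have "cinner b e * cinner e ?v = of_real (?a e * (1 - ?a e) ^ k) * (cinner b e * cinner e b)"
        by (simp add: eigenbasis_apply[OF A' that] iter[OF that] mult_ac)
      also have "\<dots> = of_real (?a e * (1 - ?a e) ^ k * (cmod (cinner e b))\<^sup>2)"
        by (simp only: cinner_mult_swap of_real_mult)
      finally show ?thesis by simp
    qed
    ultimately have "((\<lambda>e. ?a e * (1 - ?a e) ^ k * (cmod (cinner e b))\<^sup>2) has_sum Re (cinner b ?v)) (eigenbasis A)"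
      by (simp cong: has_sum_cong)
    moreover have nn: "0 \<le> ?a e * (1 - ?a e) ^ k" if "e \<in> eigenbasis A" for e
      using positive_op_expval(2)[OF A'(1), of e] is_state_expval_le_1[OF A E(1) that] by simp
    ultimately have "ennreal (Re (cinner b ?v))
      = (\<integral>\<^sup>+ e. ennreal (?a e * (1 - ?a e) ^ k * (cmod (cinner e b))\<^sup>2) \<partial>count_space (eigenbasis A))"
      by (intro has_sum_imp_nn_integral[symmetric]) auto
    also have "\<dots> = (\<integral>\<^sup>+ e. ennreal (?a e * (1 - ?a e) ^ k) * ennreal ((cmod (cinner e b))\<^sup>2) \<partial>count_space (eigenbasis A))"
      by (intro nn_integral_cong ennreal_mult) (auto simp: nn)
    finally show ?thesis .
  qed
  have tr: "(\<integral>\<^sup>+ b. ennreal (Re (cinner b (A ((?T ^^ k) b)))) \<partial>count_space B)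
      = (\<integral>\<^sup>+ e. ennreal (?a e * (1 - ?a e) ^ k) \<partial>count_space (eigenbasis A))" for k
  proof -
    have "(\<integral>\<^sup>+ b. ennreal (Re (cinner b (A ((?T ^^ k) b)))) \<partial>count_space B)
      = (\<integral>\<^sup>+ e. \<integral>\<^sup>+ b. ennreal (?a e * (1 - ?a e) ^ k) * ennreal ((cmod (cinner e b))\<^sup>2) \<partial>count_space B \<partial>count_space (eigenbasis A))"
      unfolding tm by (rule nn_integral_count_space_nn_integral)
        (auto intro: orthonormal_countable is_onb_orthonormal E(1))
    also have "\<dots> = (\<integral>\<^sup>+ e. ennreal (?a e * (1 - ?a e) ^ k) \<partial>count_space (eigenbasis A))"
    proof (rule nn_integral_cong)
      fix e assume "e \<in> space (count_space (eigenbasis A))"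
      then have "norm e = 1" using orthonormal_norm[OF is_onb_orthonormal[OF E(1)]] by simp
      then show "(\<integral>\<^sup>+ b. ennreal (?a e * (1 - ?a e) ^ k) * ennreal ((cmod (cinner e b))\<^sup>2) \<partial>count_space B) = ennreal (?a e * (1 - ?a e) ^ k)"
        by (subst nn_integral_cmult) (simp_all add: cmod_cinner_commute[of e] parseval_nn[OF B])
    qed
    finally show ?thesis .
  qed
  have "entropy A = (\<integral>\<^sup>+ e. (\<Sum>n. ennreal (1 / real (Suc n)) * ennreal (?a e * (1 - ?a e) ^ Suc n)) \<partial>count_space (eigenbasis A))"
    unfolding entropy_def
    by (intro nn_integral_cong minus_x_ln_x_series positive_op_expval(2)[OF A'(1)] is_state_expval_le_1[OF A E(1)]) simp
  also have "\<dots> = (\<Sum>n. ennreal (1 / real (Suc n)) * (\<integral>\<^sup>+ e. ennreal (?a e * (1 - ?a e) ^ Suc n) \<partial>count_space (eigenbasis A)))"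
    by (simp add: nn_integral_suminf nn_integral_cmult)
  finally show ?thesis unfolding tr[symmetric] by simp
qed

lemma borel_measurable_entropy:
  fixes A :: "'x \<Rightarrow> ('a::separable_chilbert \<Rightarrow>\<^sub>L 'a)"
  assumes B: "is_onb B" and A: "\<And>x. is_state (A x)"
    and mA: "\<And>b c. b \<in> B \<Longrightarrow> c \<in> B \<Longrightarrow> (\<lambda>x. cinner b (blinfun_apply (A x) c)) \<in> borel_measurable M"
  shows "(\<lambda>x. entropy (A x)) \<in> borel_measurable M"
proof -
  have ap: "(\<lambda>x. blinfun_apply (A x) (y x)) \<in> borel_measurable M" if "y \<in> borel_measurable M" for y
    by (rule borel_measurable_apply[OF B is_state_D(1)[OF A] mA that])
  have iter: "(\<lambda>x. ((\<lambda>v. v - blinfun_apply (A x) v) ^^ k) b) \<in> borel_measurable M" for k b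
    by (induction k) (auto intro!: borel_measurable_diff ap)
  have "(\<lambda>x. Re (cinner b (blinfun_apply (A x) (((\<lambda>v. v - blinfun_apply (A x) v) ^^ k) b)))) \<in> borel_measurable M" for k b
    by (rule borel_measurable_bounded_linear[OF borel_measurable_cinner[OF borel_measurable_const ap[OF iter]]
          bounded_linear_Re])
  note m = measurable_compose[OF this measurable_ennreal]
  show ?thesis
    unfolding entropy_series[OF A B]
    by (intro borel_measurable_suminf_order borel_measurable_times_ennreal borel_measurable_const
        borel_measurable_nn_integral_count_space m orthonormal_countable[OF is_onb_orthonormal[OF B]])
qed

section \<open>Relative entropy and Klein's inequality\<close>

lemma expval_scaleR: "expval (r *\<^sub>R A) x = r * expval A x"
  by (simp add: expval_def scaleR_blinfun.rep_eq cinner_scaleR_right)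

text \<open>Both sides choose by \<open>SOME\<close> under equivalent conditions, so the very same
  basis is chosen and sums over it can be compared term by term.\<close>

lemma eigenbasis_scaleR:
  assumes "r \<noteq> 0"
  shows "eigenbasis (r *\<^sub>R A) = eigenbasis A"
proof -
  have "(\<exists>c. blinfun_apply (r *\<^sub>R A) e = c *\<^sub>C e) \<longleftrightarrow> (\<exists>c. A e = c *\<^sub>C e)" for e
  proof
    assume "\<exists>c. blinfun_apply (r *\<^sub>R A) e = c *\<^sub>C e"
    then obtain c where "r *\<^sub>R A e = c *\<^sub>C e" by (auto simp: scaleR_blinfun.rep_eq)
    then have "inverse r *\<^sub>R (r *\<^sub>R A e) = inverse r *\<^sub>R (c *\<^sub>C e)" by (rule arg_cong)
    then have "A e = (of_real (inverse r) * c) *\<^sub>C e"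
      using assms by (simp add: scaleR_scaleC scaleC_scaleC)
    then show "\<exists>c. A e = c *\<^sub>C e" ..
  next
    assume "\<exists>c. A e = c *\<^sub>C e"
    then obtain c where "A e = c *\<^sub>C e" ..
    then have "blinfun_apply (r *\<^sub>R A) e = (of_real r * c) *\<^sub>C e"
      by (simp add: scaleR_blinfun.rep_eq scaleR_scaleC scaleC_scaleC)
    then show "\<exists>c. blinfun_apply (r *\<^sub>R A) e = c *\<^sub>C e" ..
  qed
  then show ?thesis unfolding eigenbasis_def by simp
qed

lemma supp_scaleR: "r \<noteq> 0 \<Longrightarrow> supp (r *\<^sub>R A) = supp A"
  by (simp add: supp_def scaleR_blinfun.rep_eq)

lemma positive_op_kernel:
  assumes A: "positive_op A" and "expval A y = 0"
  shows "A y = 0"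
proof -
  have "(cmod (cinner (A y) (A y)))\<^sup>2 \<le> 0"
    using positive_op_cauchy_schwarz[OF A, of "A y" y] assms(2) by simp
  then show ?thesis by (simp add: cinner_self)
qed

section \<open>Relative entropy of states with nested kernels\<close>

context
  fixes A B :: "'a::separable_chilbert \<Rightarrow>\<^sub>L 'a"
  assumes A: "is_state A" and B: "is_state B"
    and ker: "\<And>g. g \<in> eigenbasis B \<Longrightarrow> expval B g = 0 \<Longrightarrow> expval A g = 0"
begin

private lemmas A' = is_state_D[OF A]
private lemmas B' = is_state_D[OF B]
private lemmas EA = eigenbasis_props[OF A']
private lemmas EB = eigenbasis_props[OF B']

text \<open>A vector in the kernel of B expands in eigenvectors of B with eigenvalue 0, and
  \<open>ker\<close> puts these into the kernel of A. The supports are the orthogonal complements of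
  the kernels.\<close>

lemma supp_subset: "supp A \<subseteq> supp B"
proof -
  have "A y = 0" if y: "B y = 0" for y
  proof -
    have "((\<lambda>g. A (cinner g y *\<^sub>C g)) has_sum A y) (eigenbasis B)"
      by (rule has_sum_bounded_linear[OF blinfun.bounded_linear_right onb_expand[OF EB(1)]])
    moreover have "A (cinner g y *\<^sub>C g) = 0" if g: "g \<in> eigenbasis B" for g
    proof (cases "cinner g y = 0")
      case False
      have "of_real (expval B g) * cinner g y = 0"
        using eigenbasis_apply[OF B' g, of y] y by simp
      then have "expval B g = 0" using False by simp
      then have "A g = 0" by (intro positive_op_kernel[OF A'(1)] ker g)
      then show ?thesis by (simp add: clinear_opD[OF positive_op_clinear[OF A'(1)]])
    qed simp
    then have "((\<lambda>g. A (cinner g y *\<^sub>C g)) has_sum 0) (eigenbasis B)"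
      by (rule has_sum_0)
    ultimately show ?thesis by (rule has_sum_unique)
  qed
  then show ?thesis unfolding supp_def by blast
qed


private abbreviation "pos_part \<equiv> {j \<in> eigenbasis B. 0 < expval B j}"

text \<open>An eigenvector of A with positive eigenvalue is orthogonal to the kernel of B, so the
  restriction to positive eigenvalues of B made in \<open>log_form\<close> drops only zero
  terms.\<close>

private lemma restrict_pos_part:
  assumes e: "e \<in> eigenbasis A" "expval A e > 0"
    and f: "\<And>j. j \<in> eigenbasis B \<Longrightarrow> cinner j e = 0 \<Longrightarrow> f j = 0"
  shows "(\<integral>\<^sup>+ j. f j \<partial>count_space pos_part) = (\<integral>\<^sup>+ j. f j \<partial>count_space (eigenbasis B))"
proof (rule nn_integral_count_space_eq)
  fix j assume "j \<in> eigenbasis B - pos_part"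
  then have j: "j \<in> eigenbasis B" "expval B j = 0" using positive_op_expval(2)[OF B'(1), of j] by auto
  then have "A j = 0" by (intro positive_op_kernel[OF A'(1)] ker)
  then have "cinner j (A e) = 0" by (simp add: positive_op_hermitian[OF A'(1), symmetric])
  then have "cinner j e = 0" using e by (simp add: EA(2) cinner_scaleC_right)
  then show "f j = 0" using f j by blast
qed auto

private lemma sum_weights:
  assumes e: "e \<in> eigenbasis A" "expval A e > 0"
  shows "(\<integral>\<^sup>+ j. ennreal ((cmod (cinner j e))\<^sup>2) \<partial>count_space pos_part) = 1"
  using restrict_pos_part[OF e, of "\<lambda>j. ennreal ((cmod (cinner j e))\<^sup>2)"] parseval_nn[OF EB(1), of e]
    orthonormal_norm[OF is_onb_orthonormal[OF EA(1)] e(1)] by simp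

text \<open>The number -<e|log B|e> in [0,\<infinity>]. Eigenvalues of a state are at most 1, so
  \<open>ennreal\<close> truncates nothing; eigenvectors in the kernel of B contribute 0 because
  \<open>ln 0 = 0\<close>.\<close>

private abbreviation cross_term :: "'a \<Rightarrow> ennreal" where
  "cross_term e \<equiv> (\<integral>\<^sup>+ j. ennreal (- ln (expval B j)) * ennreal ((cmod (cinner j e))\<^sup>2) \<partial>count_space (eigenbasis B))"

text \<open>In substance log (p B) = ln p + log B. But scaling moves terms between the positive and
  the negative sum of \<open>log_form\<close>, and the latter may be infinite. So an identity
  between nonnegative quantities is proved first and rearranged only when all of them are
  finite.\<close>

private lemma log_form_scaleR:
  assumes e: "e \<in> eigenbasis A" "expval A e > 0" and p: "p > 0"
  shows "log_form (p *\<^sub>R B) e = ereal (ln p) - enn2ereal (cross_term e)"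
proof -
  let ?w = "\<lambda>j. (cmod (cinner j e))\<^sup>2" and ?k = "expval B"
  let ?P = "\<integral>\<^sup>+ j. ennreal (ln (p * ?k j) * ?w j) \<partial>count_space pos_part"
  let ?N = "\<integral>\<^sup>+ j. ennreal (- ln (p * ?k j) * ?w j) \<partial>count_space pos_part"
  let ?C = "\<integral>\<^sup>+ j. ennreal (- ln (?k j)) * ennreal (?w j) \<partial>count_space pos_part"
  have C: "?C = cross_term e" by (rule restrict_pos_part[OF e]) simp
  have set: "{j \<in> eigenbasis (p *\<^sub>R B). 0 < expval (p *\<^sub>R B) j} = pos_part"
    using p by (simp add: eigenbasis_scaleR expval_scaleR zero_less_mult_iff)
  have lf: "log_form (p *\<^sub>R B) e = enn2ereal ?P - enn2ereal ?N"
    unfolding log_form_def set by (simp only: expval_scaleR)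
  have W: "(\<integral>\<^sup>+ j. c * ennreal (?w j) \<partial>count_space pos_part) = c" for c
    by (subst nn_integral_cmult) (simp_all add: sum_weights[OF e])
  have k1: "0 \<le> - ln (?k j)" if "j \<in> pos_part" for j
    using that is_state_expval_le_1[OF B EB(1), of j] by simp
  \<comment> \<open>Termwise this is ln (p k) = ln p + ln k, with each number split into positive
    and negative part and the negative parts moved to the other side.\<close>
  have "?P + ?C + ennreal (- ln p) =
      (\<integral>\<^sup>+ j. ennreal (ln (p * ?k j) * ?w j) + ennreal (- ln (?k j)) * ennreal (?w j) + ennreal (- ln p) * ennreal (?w j) \<partial>count_space pos_part)"
    by (simp add: nn_integral_add W)
  also have "\<dots> = (\<integral>\<^sup>+ j. ennreal (- ln (p * ?k j) * ?w j) + ennreal (ln p) * ennreal (?w j) \<partial>count_space pos_part)"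
  proof (rule nn_integral_cong)
    fix j assume "j \<in> space (count_space pos_part)"
    then have j: "j \<in> pos_part" by simp
    have ln: "ln (p * ?k j) = ln p + ln (?k j)" using j p by (simp add: ln_mult)
    have "ennreal (ln p + ln (?k j)) + ennreal (- ln (?k j)) + ennreal (- ln p)
        = ennreal (- (ln p + ln (?k j))) + ennreal (ln p)"
      using k1[OF j] by (cases "0 \<le> ln p + ln (?k j)"; cases "0 \<le> ln p")
        (auto simp: ennreal_neg ennreal_plus[symmetric] simp del: ennreal_plus)
    then show "ennreal (ln (p * ?k j) * ?w j) + ennreal (- ln (?k j)) * ennreal (?w j) + ennreal (- ln p) * ennreal (?w j)
      = ennreal (- ln (p * ?k j) * ?w j) + ennreal (ln p) * ennreal (?w j)"
      unfolding ln ennreal_mult''[OF zero_le_power2] distrib_right[symmetric] by simp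
  qed
  also have "\<dots> = ?N + ennreal (ln p)" by (simp add: nn_integral_add W)
  finally have eq: "?P + ?C + ennreal (- ln p) = ?N + ennreal (ln p)" .
  \<comment> \<open>Since the eigenvalues of B are at most 1, the positive sum is bounded by the
    positive part of ln p and is finite even when \<open>?C\<close> is not.\<close>
  have "?P \<le> (\<integral>\<^sup>+ j. ennreal (ln p) * ennreal (?w j) \<partial>count_space pos_part)"
  proof (rule nn_integral_mono)
    fix j assume "j \<in> space (count_space pos_part)"
    then have j: "j \<in> pos_part" by simp
    have "ln (p * ?k j) \<le> ln p" using j p k1[OF j] by (simp add: ln_mult)
    then have "ennreal (ln (p * ?k j) * ?w j) \<le> ennreal (max 0 (ln p) * ?w j)"
      by (intro ennreal_leI mult_right_mono) auto
    also have "\<dots> = ennreal (ln p) * ennreal (?w j)" by (simp add: ennreal_mult max_def ennreal_neg)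
    finally show "ennreal (ln (p * ?k j) * ?w j) \<le> ennreal (ln p) * ennreal (?w j)" .
  qed
  then have "?P \<le> ennreal (ln p)" by (simp add: W)
  then have "?P < top" using ennreal_less_top by (rule le_less_trans)
  then obtain P where P: "?P = ennreal P" "P \<ge> 0" by (cases ?P) auto
  show ?thesis
  proof (cases ?C)
    case top
    have "?N + ennreal (ln p) = top" unfolding eq[symmetric] top by simp
    then have "?N = top" unfolding ennreal_add_eq_top by simp
    then show ?thesis unfolding lf C[symmetric] P(1) top using P(2) by simp
  next
    case (real c)
    have "?N + ennreal (ln p) \<noteq> top" unfolding eq[symmetric] P(1) real(2) by simp
    then have "?N \<noteq> top" unfolding ennreal_add_eq_top by simp
    then obtain n where n: "?N = ennreal n" "n \<ge> 0" by (cases ?N) auto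
    have "P + c + max 0 (- ln p) = n + max 0 (ln p)"
    proof -
      have "ennreal (P + c + max 0 (- ln p)) = ennreal (n + max 0 (ln p))"
      proof -
        have m: "ennreal x = ennreal (max 0 x)" for x by (simp add: max_def ennreal_neg)
        have "ennreal P + ennreal c + ennreal (max 0 (- ln p)) = ennreal n + ennreal (max 0 (ln p))"
          using eq unfolding P(1) real(2) n(1) m[symmetric] .
        then show ?thesis
          using P(2) real(1) n(2) by (simp only: ennreal_plus add_nonneg_nonneg max.cobounded1)
      qed
      then show ?thesis using P(2) real(1) n(2) by (subst (asm) ennreal_inj) auto
    qed
    then have "P - n = ln p - c" by (simp add: max_def split: if_splits)
    then show ?thesis unfolding lf C[symmetric] P(1) real(2) n(1) using P(2) n(2) real(1)
      by (simp add: enn2ereal_ennreal)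
  qed
qed

text \<open>From a ln (k/a) \<le> k - a, averaged over the eigenvalues k of B with the weights of e
  in the eigenbasis of B, whose sum is 1. This makes the summands of \<open>rel_entropy\<close>
  nonnegative, so that \<open>e2ennreal\<close> truncates nothing.\<close>

lemma klein_inequality:
  assumes e: "e \<in> eigenbasis A"
  shows "ennreal (expval A e) + ennreal (- (expval A e * ln (expval A e)))
     \<le> ennreal (expval A e) * cross_term e + ennreal (expval B e)"
proof (cases "expval A e = 0")
  case False
  let ?a = "expval A e" and ?k = "expval B" and ?w = "\<lambda>j. (cmod (cinner j e))\<^sup>2"
  have a: "?a > 0" using False positive_op_expval(2)[OF A'(1), of e] by simp
  have a1: "- (?a * ln ?a) \<ge> 0" using a is_state_expval_le_1[OF A EA(1) e] by (simp add: mult_le_0_iff)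
  have W: "(\<integral>\<^sup>+ j. c * ennreal (?w j) \<partial>count_space pos_part) = c" for c
    by (subst nn_integral_cmult) (simp_all add: sum_weights[OF e a])
  have "ennreal ?a + ennreal (- (?a * ln ?a)) = (\<integral>\<^sup>+ j. ennreal (?a - ?a * ln ?a) * ennreal (?w j) \<partial>count_space pos_part)"
    proof -
    have "ennreal (?a + - (?a * ln ?a)) = ennreal ?a + ennreal (- (?a * ln ?a))"
      using a a1 by (intro ennreal_plus) auto
    then show ?thesis unfolding W by simp
  qed
  also have "\<dots> \<le> (\<integral>\<^sup>+ j. ennreal ?a * (ennreal (- ln (?k j)) * ennreal (?w j)) + ennreal (?k j) * ennreal (?w j) \<partial>count_space pos_part)"
  proof (rule nn_integral_mono)
    fix j assume "j \<in> space (count_space pos_part)"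
    then have j: "j \<in> eigenbasis B" "?k j > 0" by auto
    have l: "0 \<le> - ln (?k j)" using j is_state_expval_le_1[OF B EB(1) j(1)] by simp
    have "ln (?k j / ?a) \<le> ?k j / ?a - 1" using j a by (intro ln_le_minus_one) simp
    then have "?a * ln (?k j / ?a) \<le> ?a * (?k j / ?a - 1)" using a by (intro mult_left_mono) auto
    then have "?a - ?a * ln ?a \<le> ?a * (- ln (?k j)) + ?k j"
      using a j by (simp add: ln_div right_diff_distrib)
    then have "(?a - ?a * ln ?a) * ?w j \<le> (?a * (- ln (?k j)) + ?k j) * ?w j"
      by (intro mult_right_mono) auto
    then have "ennreal ((?a - ?a * ln ?a) * ?w j) \<le> ennreal (?a * (- ln (?k j) * ?w j) + ?k j * ?w j)"
      by (intro ennreal_leI) (simp add: algebra_simps)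
    moreover have "ennreal ((?a - ?a * ln ?a) * ?w j) = ennreal (?a - ?a * ln ?a) * ennreal (?w j)"
      by (rule ennreal_mult''[OF zero_le_power2])
    moreover have "ennreal (?a * (- ln (?k j) * ?w j) + ?k j * ?w j)
      = ennreal ?a * (ennreal (- ln (?k j)) * ennreal (?w j)) + ennreal (?k j) * ennreal (?w j)"
      using a l j by (simp only: ennreal_mult[symmetric] ennreal_plus[symmetric] mult_nonneg_nonneg zero_le_power2 less_imp_le)
    ultimately show "ennreal (?a - ?a * ln ?a) * ennreal (?w j)
       \<le> ennreal ?a * (ennreal (- ln (?k j)) * ennreal (?w j)) + ennreal (?k j) * ennreal (?w j)" by simp
  qed
  also have "\<dots> = ennreal ?a * (\<integral>\<^sup>+ j. ennreal (- ln (?k j)) * ennreal (?w j) \<partial>count_space pos_part)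
      + (\<integral>\<^sup>+ j. ennreal (?k j) * ennreal (?w j) \<partial>count_space pos_part)"
    by (simp add: nn_integral_add nn_integral_cmult)
  also have "(\<integral>\<^sup>+ j. ennreal (- ln (?k j)) * ennreal (?w j) \<partial>count_space pos_part) = cross_term e"
    by (rule restrict_pos_part[OF e a]) simp
  also have "(\<integral>\<^sup>+ j. ennreal (?k j) * ennreal (?w j) \<partial>count_space pos_part)
      = (\<integral>\<^sup>+ j. ennreal (?k j) * ennreal (?w j) \<partial>count_space (eigenbasis B))"
    by (rule restrict_pos_part[OF e a]) simp
  also have "\<dots> = ennreal (?k e)" by (rule expval_eigenbasis_expand[OF B'])
  finally show ?thesis .
qed simp

text \<open>The logarithm of p cancels between the two logarithmic terms. Entropy and trace terms of
  A are added on the left instead of being subtracted on the right, so an infinite cross term is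
  covered as well.\<close>

private lemma rel_entropy_summand:
  assumes e: "e \<in> eigenbasis A" and p: "p > 0"
  shows "e2ennreal (ereal (p * expval A e * ln (p * expval A e)) - ereal (p * expval A e) * log_form (p *\<^sub>R B) e
           + ereal (p * expval B e) - ereal (p * expval A e))
     + ennreal p * ennreal (- (expval A e * ln (expval A e))) + ennreal p * ennreal (expval A e)
    = ennreal p * (ennreal (expval A e) * cross_term e) + ennreal p * ennreal (expval B e)"
proof (cases "expval A e = 0")
  case True
  then show ?thesis using p positive_op_expval(2)[OF B'(1), of e]
    by (simp add: ennreal_mult[symmetric] flip: ennreal.abs_eq zero_ereal_def)
next
  case False
  let ?a = "expval A e" and ?b = "expval B e"
  have a: "?a > 0" using False positive_op_expval(2)[OF A'(1), of e] by simp
  have a1: "- (?a * ln ?a) \<ge> 0" using a is_state_expval_le_1[OF A EA(1) e] by (simp add: mult_le_0_iff)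
  have b: "?b \<ge> 0" by (rule positive_op_expval(2)[OF B'(1)])
  note lf = log_form_scaleR[OF e a p]
  show ?thesis
  proof (cases "cross_term e")
    case top
    then show ?thesis unfolding lf top using a p by (simp add: ennreal_mult_top)
  next
    case (real c)
    have k: "?a - ?a * ln ?a \<le> ?a * c + ?b"
    proof -
      have "ennreal (?a - ?a * ln ?a) \<le> ennreal (?a * c + ?b)"
        using klein_inequality[OF e] a a1 b real(1) unfolding real(2)
        by (simp add: ennreal_mult[symmetric] ennreal_plus[symmetric] del: ennreal_plus)
      then show ?thesis using a b real(1) by (subst (asm) ennreal_le_iff) auto
    qed
    have "ereal (p * ?a * ln (p * ?a)) - ereal (p * ?a) * log_form (p *\<^sub>R B) e + ereal (p * ?b) - ereal (p * ?a)
      = ereal (p * (?a * ln ?a + ?a * c + ?b - ?a))"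
      unfolding lf real(2) using a p real(1) by (simp add: enn2ereal_ennreal ln_mult algebra_simps)
    note T = this
    let ?X = "p * (?a * ln ?a + ?a * c + ?b - ?a)"
    have X: "0 \<le> ?X" using k p by (intro mult_nonneg_nonneg) auto
    have "ennreal ?X + ennreal p * ennreal (- (?a * ln ?a)) + ennreal p * ennreal ?a
        = ennreal ?X + ennreal (p * - (?a * ln ?a)) + ennreal (p * ?a)"
      using a a1 p by (subst (1 2) ennreal_mult) auto
    also have "\<dots> = ennreal (?X + p * - (?a * ln ?a) + p * ?a)"
    proof -
      have "0 \<le> p * - (?a * ln ?a)" "0 \<le> p * ?a" using a a1 p by (intro mult_nonneg_nonneg; simp)+
      then show ?thesis using X by (simp only: ennreal_plus[symmetric] add_nonneg_nonneg)
    qed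
    also have "?X + p * - (?a * ln ?a) + p * ?a = p * (?a * c) + p * ?b" by (simp add: algebra_simps)
    also have "ennreal \<dots> = ennreal (p * (?a * c)) + ennreal (p * ?b)"
      using a p b real(1) by (intro ennreal_plus mult_nonneg_nonneg) auto
    also have "\<dots> = ennreal p * (ennreal ?a * ennreal c) + ennreal p * ennreal ?b"
      using a p b real(1) by (simp add: ennreal_mult)
    finally show ?thesis unfolding T real(2) e2ennreal_ereal .
  qed
qed

text \<open>Both sides are - p Tr A log B, possibly infinite. The sum of the termwise identities
  lives in the eigenbasis of A and has to be carried over to that of B.\<close>

lemma rel_entropy_scaleR_add_entropy:
  assumes p: "p > 0"
  shows "rel_entropy (p *\<^sub>R A) (p *\<^sub>R B) + ennreal p * entropy A
    = ennreal p * (\<integral>\<^sup>+ j. ennreal (- ln (expval B j)) * ennreal (expval A j) \<partial>count_space (eigenbasis B))"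
proof -
  let ?T = "\<lambda>e. e2ennreal (ereal (p * expval A e * ln (p * expval A e)) - ereal (p * expval A e) * log_form (p *\<^sub>R B) e
           + ereal (p * expval B e) - ereal (p * expval A e))"
  let ?E = "count_space (eigenbasis A)"
  have R: "rel_entropy (p *\<^sub>R A) (p *\<^sub>R B) = (\<integral>\<^sup>+ e. ?T e \<partial>?E)"
    unfolding rel_entropy_def using p supp_subset by (simp add: supp_scaleR eigenbasis_scaleR expval_scaleR)
  have "rel_entropy (p *\<^sub>R A) (p *\<^sub>R B) + ennreal p * entropy A + ennreal p * (\<integral>\<^sup>+ e. ennreal (expval A e) \<partial>?E)
    = (\<integral>\<^sup>+ e. ?T e + ennreal p * ennreal (- (expval A e * ln (expval A e))) + ennreal p * ennreal (expval A e) \<partial>?E)"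
    unfolding R entropy_def by (simp add: nn_integral_add nn_integral_cmult)
  also have "\<dots> = (\<integral>\<^sup>+ e. ennreal p * (ennreal (expval A e) * cross_term e) + ennreal p * ennreal (expval B e) \<partial>?E)"
    by (intro nn_integral_cong rel_entropy_summand p) simp
  also have "\<dots> = ennreal p * (\<integral>\<^sup>+ e. ennreal (expval A e) * cross_term e \<partial>?E) + ennreal p * (\<integral>\<^sup>+ e. ennreal (expval B e) \<partial>?E)"
    by (simp add: nn_integral_add nn_integral_cmult)
  finally have "rel_entropy (p *\<^sub>R A) (p *\<^sub>R B) + ennreal p * entropy A + ennreal p
      = ennreal p * (\<integral>\<^sup>+ e. ennreal (expval A e) * cross_term e \<partial>?E) + ennreal p"
    unfolding is_state_trace_nn[OF A EA(1)] is_state_trace_nn[OF B EA(1)] by simp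
  \<comment> \<open>Both states have trace 1, which left p on either side; being finite, it
    cancels.\<close>
  then have "rel_entropy (p *\<^sub>R A) (p *\<^sub>R B) + ennreal p * entropy A
      = ennreal p * (\<integral>\<^sup>+ e. ennreal (expval A e) * cross_term e \<partial>?E)"
    unfolding add.commute[of _ "ennreal p"] ennreal_add_left_cancel by simp
  \<comment> \<open>Change of basis: Tonelli's theorem, then the spectral expansion of A at each
    eigenvector j of B.\<close>
  also have "(\<integral>\<^sup>+ e. ennreal (expval A e) * cross_term e \<partial>?E)
    = (\<integral>\<^sup>+ e. \<integral>\<^sup>+ j. ennreal (- ln (expval B j)) * (ennreal (expval A e) * ennreal ((cmod (cinner e j))\<^sup>2)) \<partial>count_space (eigenbasis B) \<partial>?E)"
    by (intro nn_integral_cong, subst nn_integral_cmult[symmetric]) (simp_all add: cmod_cinner_commute mult_ac)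
  also have "\<dots> = (\<integral>\<^sup>+ j. \<integral>\<^sup>+ e. ennreal (- ln (expval B j)) * (ennreal (expval A e) * ennreal ((cmod (cinner e j))\<^sup>2)) \<partial>?E \<partial>count_space (eigenbasis B))"
    by (rule nn_integral_count_space_nn_integral[symmetric])
      (auto intro: orthonormal_countable is_onb_orthonormal EA(1))
  also have "\<dots> = (\<integral>\<^sup>+ j. ennreal (- ln (expval B j)) * ennreal (expval A j) \<partial>count_space (eigenbasis B))"
    by (simp add: nn_integral_cmult expval_eigenbasis_expand[OF A'])
  finally show ?thesis .
qed

end

text \<open>For outcomes of density 0: every summand vanishes, whichever eigenbasis of the zero
  operator is chosen.\<close>

lemma rel_entropy_0: "rel_entropy 0 (0 *\<^sub>R B) = 0"
  by (simp add: rel_entropy_def expval_def e2ennreal_neg flip: zero_ereal_def)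

section \<open>Traces\<close>

text \<open>Extracts matrix elements from conditions that are stated as traces against bounded
  operators.\<close>

lemma trace_ketbra_compose:
  assumes T: "clinear_op T"
  shows "trace (ketbra u v o\<^sub>L T) = cinner v (T u)"
proof -
  have "((\<lambda>e. cinner v (T (cinner e u *\<^sub>C e))) has_sum cinner v (T u)) (SOME B. is_onb B)"
    by (rule has_sum_bounded_linear[OF bounded_linear_compose[OF cinner.bounded_linear_right blinfun.bounded_linear_right]
          onb_expand[OF is_onb_some]])
  then show ?thesis
    unfolding trace_def
    by (intro infsumI) (simp add: blinfun_apply_ketbra cinner_scaleC_right clinear_opD[OF T] mult.commute)
qed

lemma trace_compose_ketbra:
  assumes A: "clinear_op A"
  shows "trace (A o\<^sub>L ketbra u v) = cinner v (A u)"
  unfolding trace_def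
  using parseval[OF is_onb_some, of v "A u"]
  by (intro infsumI) (simp add: blinfun_apply_ketbra clinear_opD[OF A] cinner_scaleC_right)

lemma has_sum_integral_count_space:
  fixes g :: "'i \<Rightarrow> complex"
  assumes "integrable (count_space D) g"
  shows "(g has_sum (\<integral>x. g x \<partial>count_space D)) D"
proof -
  have a: "Infinite_Set_Sum.abs_summable_on g D"
    using assms by (simp add: Infinite_Set_Sum.abs_summable_on_def)
  have "g summable_on D" by (rule abs_summable_summable[OF iffD2[OF abs_summable_equivalent a]])
  then have "(g has_sum infsum g D) D" by (rule has_sum_infsum)
  then show ?thesis using infsetsum_infsum[OF a] by (simp add: infsetsum_def)
qed

text \<open>The reduced operator is the sum of the rank-one operators of the vectors
  \<open>contract1 t d \<psi>\<close>, so its trace against A can be computed in a basis of the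
  factor traced out. The two unconditional sums are exchanged by \<open>has_sum_integral\<close>
  with the counting measure on D.\<close>

lemma trace_ptrace_ketbra_has_sum:
  assumes t: "hilbert_tensor t" and A: "clinear_op A" and D: "is_onb D"
  shows "((\<lambda>d. cinner (contract1 t d \<psi>) (A (contract1 t d \<psi>)))
    has_sum trace (A o\<^sub>L ptrace_fst t (ketbra \<psi> \<psi>))) D"
proof -
  let ?R = "ptrace_fst t (ketbra \<psi> \<psi>)"
  let ?G = "SOME B. is_onb (B :: 'b set)"
  have G: "is_onb ?G" by (rule is_onb_some)
  note oG = is_onb_orthonormal[OF G]
  let ?w = "\<lambda>d. contract1 t d \<psi>"
  let ?f = "\<lambda>g d. cinner (?w d) g * cinner g (A (?w d))"
  have norms: "integrable (count_space D) (\<lambda>d. (norm (?w d))\<^sup>2)"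
    by (rule iffD1[OF abs_summable_equivalent iffD1[OF summable_on_iff_abs_summable_on_real
          has_sum_imp_summable[OF contract1_parseval[OF t D, of \<psi>]]], unfolded Infinite_Set_Sum.abs_summable_on_def])
  have bd: "(\<Sum>g\<in>F. norm (?f g d)) \<le> (1 + (norm A)\<^sup>2) / 2 * (norm (?w d))\<^sup>2" if F: "finite F" "F \<subseteq> ?G" for F d
  proof -
    let ?y = "A (?w d)"
    have "(\<Sum>g\<in>F. norm (?f g d)) \<le> (\<Sum>g\<in>F. ((cmod (cinner g (?w d)))\<^sup>2 + (cmod (cinner g ?y))\<^sup>2) / 2)"
      unfolding norm_mult cmod_cinner_commute[of "?w d"] by (intro sum_mono mult_le_half_squares)
    also have "\<dots> \<le> ((norm (?w d))\<^sup>2 + (norm ?y)\<^sup>2) / 2"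
      using bessel_finite[OF oG F, of "?w d"] bessel_finite[OF oG F, of ?y]
      by (simp add: sum.distrib sum_divide_distrib[symmetric])
    also have "(norm ?y)\<^sup>2 \<le> (norm A * norm (?w d))\<^sup>2" by (intro power_mono norm_blinfun) simp
    finally show ?thesis by (simp add: power_mult_distrib algebra_simps)
  qed
  have w: "integrable (count_space D) (\<lambda>d. (1 + (norm A)\<^sup>2) / 2 * (norm (?w d))\<^sup>2)" using norms by simp
  note sums = has_sum_integral[OF orthonormal_countable[OF oG] _ w bd parseval[OF G]]
  have inner: "(\<integral>d. ?f g d \<partial>count_space D) = cinner g (blinfun_apply (A o\<^sub>L ?R) g)" if g: "g \<in> ?G" for g
  proof -
    have "(?f g has_sum (\<integral>d. ?f g d \<partial>count_space D)) D"
      by (rule has_sum_integral_count_space[OF sums(3)]) (use g in simp_all)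
    moreover have "(?f g has_sum cinner g (blinfun_apply (A o\<^sub>L ?R) g)) D"
      using parseval[OF D, of "contract2 t g \<psi>" "contract2 t (blinfun_apply (adj A) g) \<psi>"]
      by (simp add: cinner_adj_left[OF A, symmetric] cinner_ptrace_ketbra[OF t] cinner_contract2[OF t]
          cinner_contract2_left[OF t] cinner_contract1[OF t] cinner_contract1_left[OF t])
    ultimately show ?thesis by (rule has_sum_unique)
  qed
  have "((\<lambda>g. \<integral>d. ?f g d \<partial>count_space D) has_sum
     (\<integral>d. cinner (?w d) (A (?w d)) \<partial>count_space D)) ?G"
    by (rule sums(1)) simp
  then have "((\<lambda>g. cinner g (blinfun_apply (A o\<^sub>L ?R) g)) has_sum
     (\<integral>d. cinner (?w d) (A (?w d)) \<partial>count_space D)) ?G"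
    by (subst has_sum_cong[OF inner[symmetric]])
  then have "trace (A o\<^sub>L ?R) = (\<integral>d. cinner (?w d) (A (?w d)) \<partial>count_space D)"
    unfolding trace_def by (rule infsumI)
  moreover have "integrable (count_space D) (\<lambda>d. cinner (?w d) (A (?w d)))"
    by (rule sums(2)) simp
  ultimately show ?thesis using has_sum_integral_count_space by simp
qed


section \<open>The density of an efficient instrument\<close>

text \<open>If T d denotes the map k \<mapsto> d \<otimes> k, then |d'><d| \<otimes> P is T d' after
  P after the adjoint of T d. This exhibits a bounded operator that satisfies the description in
  \<open>op_tensor\<close>.\<close>

lemma op_tensor_ketbra:
  assumes t: "hilbert_tensor t" and P: "clinear_op P"
  shows "blinfun_apply (op_tensor t (ketbra d' d) P) z = t d' (P (contract1 t d z))"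
    and "clinear_op (op_tensor t (ketbra d' d) P)"
proof -
  note R = blinfun_tensor_left[OF tensor_flip[OF t]]
  let ?C = "Blinfun (\<lambda>k. t d' k) o\<^sub>L P o\<^sub>L adj (Blinfun (\<lambda>k. t d k))"
  have C: "?C z = t d' (P (contract1 t d z))" for z
    by (simp add: R contract1_def)
  have lin: "clinear_op ?C" by (intro clinear_op_compose clinear_op_adj R P)
  have prod: "contract1 t d (t a b) = cinner d a *\<^sub>C b" for a b
    by (rule cinner_eqI) (simp add: cinner_contract1[OF t] tensor_cinner[OF t] cinner_scaleC_right)
  have app: "?C (t a b) = t (blinfun_apply (ketbra d' d) a) (P b)" for a b
    unfolding C prod blinfun_apply_ketbra
    by (simp add: clinear_opD[OF P] tensor_scaleC_left[OF t] tensor_scaleC_right[OF t])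
  have "op_tensor t (ketbra d' d) P = ?C"
    unfolding op_tensor_def
  proof (rule the_equality)
    fix C' assume C': "clinear_op C' \<and> (\<forall>a b. C' (t a b) = t (blinfun_apply (ketbra d' d) a) (P b))"
    show "C' = ?C" by (rule tensor_op_eqI[OF t]) (use C' lin app in auto)
  qed (use lin app in blast)
  then show "blinfun_apply (op_tensor t (ketbra d' d) P) z = t d' (P (contract1 t d z))"
    "clinear_op (op_tensor t (ketbra d' d) P)" using C lin by auto
qed

section \<open>Inner products of square-integrable functions\<close>

lemma square_integrable_cnj_mult:
  assumes "square_integrable \<nu> f" "square_integrable \<nu> g"
  shows "integrable \<nu> (\<lambda>x. cnj (f x) * g x)"
proof (rule Bochner_Integration.integrable_bound)
  show "integrable \<nu> (\<lambda>x. ((cmod (f x))\<^sup>2 + (cmod (g x))\<^sup>2) / 2)"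
    using assms by (auto simp: square_integrable_def)
  have [measurable]: "f \<in> borel_measurable \<nu>" "g \<in> borel_measurable \<nu>"
    using assms by (auto simp: square_integrable_def)
  show "(\<lambda>x. cnj (f x) * g x) \<in> borel_measurable \<nu>"
    by (intro borel_measurable_times borel_measurable_bounded_linear[OF _ bounded_linear_cnj]) measurable
  show "AE x in \<nu>. norm (cnj (f x) * g x) \<le> norm (((cmod (f x))\<^sup>2 + (cmod (g x))\<^sup>2) / 2)"
    using mult_le_half_squares by (intro AE_I2) (simp add: norm_mult)
qed

lemma square_integrable_scale: "square_integrable \<nu> f \<Longrightarrow> square_integrable \<nu> (\<lambda>x. c * f x)"
  by (auto simp: square_integrable_def norm_mult power_mult_distrib)

lemma cmod_add_squared: "(cmod (a + b))\<^sup>2 = (cmod a)\<^sup>2 + (cmod b)\<^sup>2 + 2 * Re (cnj a * b)"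
  unfolding cmod_power2 by (simp add: power2_eq_square algebra_simps)

lemma square_integrable_add:
  assumes f: "square_integrable \<nu> f" and g: "square_integrable \<nu> g"
  shows "square_integrable \<nu> (\<lambda>x. f x + g x)"
  unfolding square_integrable_def
proof
  show m: "(\<lambda>x. f x + g x) \<in> borel_measurable \<nu>"
    using f g by (auto simp: square_integrable_def)
  have "integrable \<nu> (\<lambda>x. 2 * Re (cnj (f x) * g x))"
    by (intro integrable_mult_right integrable_Re square_integrable_cnj_mult f g)
  then show "integrable \<nu> (\<lambda>x. (cmod (f x + g x))\<^sup>2)"
    unfolding cmod_add_squared using f g
    by (intro Bochner_Integration.integrable_add) (auto simp only: square_integrable_def)
qed

text \<open>The definition of \<open>L2_unitary\<close> preserves norms; polarization recovers inner
  products, the real part from f + g and the imaginary part by replacing g with -i g.\<close>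

lemma L2_unitary_cinner:
  assumes U: "L2_unitary \<nu> U" and f: "square_integrable \<nu> f" and g: "square_integrable \<nu> g"
  shows "cinner (U f) (U g) = (\<integral>x. cnj (f x) * g x \<partial>\<nu>)"
proof -
  have nrm: "(norm (U h))\<^sup>2 = (\<integral>x. (cmod (h x))\<^sup>2 \<partial>\<nu>)" if "square_integrable \<nu> h" for h
    using U that by (simp add: L2_unitary_def)
  have re: "Re (cinner (U f) (U g)) = (\<integral>x. Re (cnj (f x) * g x) \<partial>\<nu>)" if g: "square_integrable \<nu> g" for g
  proof -
    have "(norm (U f + U g))\<^sup>2 = (norm (U f))\<^sup>2 + (norm (U g))\<^sup>2 + 2 * inner (U f) (U g)"
      by (simp add: power2_norm_eq_inner inner_add inner_commute)
    moreover have "U f + U g = U (\<lambda>x. f x + g x)" using U f g by (simp add: L2_unitary_def)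
    moreover have "(\<integral>x. (cmod (f x + g x))\<^sup>2 \<partial>\<nu>)
      = (\<integral>x. (cmod (f x))\<^sup>2 \<partial>\<nu>) + (\<integral>x. (cmod (g x))\<^sup>2 \<partial>\<nu>) + 2 * (\<integral>x. Re (cnj (f x) * g x) \<partial>\<nu>)"
    proof -
      have i: "integrable \<nu> (\<lambda>x. 2 * Re (cnj (f x) * g x))"
        by (intro integrable_mult_right integrable_Re square_integrable_cnj_mult f g)
      have "integrable \<nu> (\<lambda>x. (cmod (f x))\<^sup>2)" "integrable \<nu> (\<lambda>x. (cmod (g x))\<^sup>2)"
        using f g by (auto simp: square_integrable_def)
      then show ?thesis unfolding cmod_add_squared
        by (subst Bochner_Integration.integral_add | simp only: i Bochner_Integration.integrable_add integral_mult_right_zero)+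
    qed
    ultimately show ?thesis
      by (simp add: nrm[OF f] nrm[OF g] nrm[OF square_integrable_add[OF f g]] Re_cinner)
  qed
  have "Im (cinner (U f) (U g)) = Re (cinner (U f) (U (\<lambda>x. - \<i> * g x)))"
  proof -
    have "U (\<lambda>x. - \<i> * g x) = (- \<i>) *\<^sub>C U g" using U g unfolding L2_unitary_def by blast
    then show ?thesis by (simp only: cinner_scaleC_right) simp
  qed
  also have "\<dots> = (\<integral>x. Im (cnj (f x) * g x) \<partial>\<nu>)"
    unfolding re[OF square_integrable_scale[OF g]] by (rule Bochner_Integration.integral_cong) (auto simp: algebra_simps)
  finally show ?thesis
    using re[OF g] integral_Re[OF square_integrable_cnj_mult[OF f g]] integral_Im[OF square_integrable_cnj_mult[OF f g]]
    by (intro complex_eqI) (simp_all only:)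
qed

text \<open>Here \<open>f d u\<close> represents (<d| \<otimes> I) V u in
  \<open>L\<^sub>2(\<nu>)\<close>. Testing the duality at |d'><d| turns matrix elements of
  \<open>\<MM> F T\<close> into traces of T against \<Psi>, the compression of |d'><d| \<otimes>
  P(F) by V, and multiplicity one turns P(F) into an indicator function.\<close>

lemma efficient_density:
  fixes X :: "'x measure" and t0 :: "'h::separable_chilbert \<Rightarrow> 'h0::separable_chilbert \<Rightarrow> 'hh0::separable_chilbert"
  assumes eff: "efficient t0 X \<MM>" and t0: "hilbert_tensor t0" and inst: "instrument X \<MM>"
  obtains \<nu> :: "'x measure" and f :: "'h \<Rightarrow> 'h \<Rightarrow> 'x \<Rightarrow> complex"
  where "sets \<nu> = sets X" "\<And>d u. square_integrable \<nu> (f d u)"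
    and "\<And>F d d'. F \<in> sets X \<Longrightarrow> \<exists>\<Psi>. clinear_op \<Psi> \<and>
        (\<forall>T. trace_class T \<longrightarrow> cinner d (blinfun_apply (\<MM> F T) d') = trace (\<Psi> o\<^sub>L T)) \<and>
        (\<forall>u v. cinner v (\<Psi> u) = (\<integral>x. indicator F x * (cnj (f d' v x) * f d u x) \<partial>\<nu>))"
    and "\<And>D u. is_onb D \<Longrightarrow> ((\<lambda>d. \<integral>x. (cmod (f d u x))\<^sup>2 \<partial>\<nu>) has_sum (norm u)\<^sup>2) D"
proof -
  obtain V P where V: "isometry_op V" and P: "spectral_measure X P" and mo: "multiplicity_one X P"
    and dual: "\<And>F. F \<in> sets X \<Longrightarrow> dual_map (\<MM> F) (\<lambda>A. adj V o\<^sub>L op_tensor t0 A (P F) o\<^sub>L V)"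
    using eff unfolding efficient_def by blast
  obtain \<nu> U where \<nu>: "sets \<nu> = sets X" and U: "L2_unitary \<nu> U"
    and PU: "\<And>F f. F \<in> sets X \<Longrightarrow> square_integrable \<nu> f \<Longrightarrow>
           blinfun_apply (P F) (U f) = U (\<lambda>x. indicator F x * f x)"
    using mo unfolding multiplicity_one_def by blast
  have "\<forall>y. \<exists>f. square_integrable \<nu> f \<and> U f = y" using U by (simp add: L2_unitary_def)
  then obtain rep where rep: "\<And>y. square_integrable \<nu> (rep y)" "\<And>y. U (rep y) = y" by metis
  have Vlin: "clinear_op V" using V by (simp add: isometry_op_def)
  define f where "f d u = rep (contract1 t0 d (V u))" for d u
  show ?thesis
  proof (rule that[of \<nu> f])
    show "sets \<nu> = sets X" by (rule \<nu>)
    show "square_integrable \<nu> (f d u)" for d u by (simp add: f_def rep)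
    show "((\<lambda>d. \<integral>x. (cmod (f d u x))\<^sup>2 \<partial>\<nu>) has_sum (norm u)\<^sup>2) D" if "is_onb D" for D u
    proof -
      have "(\<integral>x. (cmod (f d u x))\<^sup>2 \<partial>\<nu>) = (norm (contract1 t0 d (V u)))\<^sup>2" for d
      proof -
        have "(norm (U h))\<^sup>2 = (\<integral>x. (cmod (h x))\<^sup>2 \<partial>\<nu>)" if "square_integrable \<nu> h" for h
          using U that by (simp add: L2_unitary_def)
        from this[OF rep(1)] show ?thesis by (simp add: rep(2) f_def)
      qed
      then show ?thesis using contract1_parseval[OF t0 that, of "V u"] V
        by (simp add: isometry_op_def)
    qed
    fix F d d' assume F: "F \<in> sets X"
    have PF: "clinear_op (P F)" using P F by (simp add: spectral_measure_def projection_op_def)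
    let ?\<Psi> = "adj V o\<^sub>L op_tensor t0 (ketbra d' d) (P F) o\<^sub>L V"
    have lin: "clinear_op ?\<Psi>"
      by (intro clinear_op_compose clinear_op_adj Vlin op_tensor_ketbra(2)[OF t0 PF])
    have tr: "cinner d (blinfun_apply (\<MM> F T) d') = trace (?\<Psi> o\<^sub>L T)" if T: "trace_class T" for T
    proof -
      have "clinear_op (\<MM> F T)" using inst F T by (auto simp: instrument_def operation_def trace_class_def)
      from trace_ketbra_compose[OF this, of d' d]
      show ?thesis using dual[OF F] T clinear_op_ketbra[of d' d] unfolding dual_map_def by metis
    qed
    have "cinner v (blinfun_apply ?\<Psi> u) = (\<integral>x. indicator F x * (cnj (f d' v x) * f d u x) \<partial>\<nu>)" for u v
    proof -
      have sq: "square_integrable \<nu> (\<lambda>x. indicator F x * f d u x)"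
      proof -
        have s: "square_integrable \<nu> (f d u)" by (simp add: f_def rep)
        then have m: "f d u \<in> borel_measurable \<nu>" by (simp add: square_integrable_def)
        have Fn: "F \<in> sets \<nu>" using F \<nu> by simp
        have "(\<lambda>x. (cmod (indicator F x * f d u x))\<^sup>2) = (\<lambda>x. indicator F x *\<^sub>R (cmod (f d u x))\<^sup>2)"
          by (auto simp: indicator_def)
        moreover have "integrable \<nu> (\<lambda>x. indicator F x *\<^sub>R (cmod (f d u x))\<^sup>2)"
          using s Fn by (intro integrable_mult_indicator) (auto simp: square_integrable_def)
        moreover have "(\<lambda>x. indicator F x * f d u x) \<in> borel_measurable \<nu>"
          using m Fn by (intro borel_measurable_times borel_measurable_indicator)
        ultimately show ?thesis unfolding square_integrable_def by simp
      qed
      have "cinner v (blinfun_apply ?\<Psi> u)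
        = cinner (contract1 t0 d' (V v)) (blinfun_apply (P F) (contract1 t0 d (V u)))"
        by (simp add: cinner_adj_right[OF Vlin] op_tensor_ketbra(1)[OF t0 PF] cinner_contract1_left[OF t0])
      also have "\<dots> = cinner (U (f d' v)) (U (\<lambda>x. indicator F x * f d u x))"
        using PU[OF F, of "f d u"] by (simp add: f_def rep)
      also have "\<dots> = (\<integral>x. cnj (f d' v x) * (indicator F x * f d u x) \<partial>\<nu>)"
        by (rule L2_unitary_cinner[OF U _ sq]) (simp add: f_def rep)
      finally show ?thesis by (simp add: mult_ac)
    qed
    then show "\<exists>\<Psi>. clinear_op \<Psi> \<and>
        (\<forall>T. trace_class T \<longrightarrow> cinner d (blinfun_apply (\<MM> F T) d') = trace (\<Psi> o\<^sub>L T)) \<and>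
        (\<forall>u v. cinner v (\<Psi> u) = (\<integral>x. indicator F x * (cnj (f d' v x) * f d u x) \<partial>\<nu>))"
      using lin tr by (intro exI[of _ ?\<Psi>]) simp
  qed
qed


text \<open>In the application \<phi> is the isometry applied to the system part of \<psi>, read as
  a function of the outcome. The squares of the prescribed coordinates have total integral
  \<open>(norm \<psi>)\<^sup>2\<close>, so they are summable almost everywhere, and Riesz-Fischer
  yields the vector.\<close>

lemma vector_field_from_coordinates:
  fixes f :: "'a::separable_chilbert \<Rightarrow> 'a \<Rightarrow> 'x \<Rightarrow> complex"
    and t :: "'a \<Rightarrow> 'b::separable_chilbert \<Rightarrow> 'c::separable_chilbert"
  assumes t: "hilbert_tensor t" and D: "is_onb D" and G: "is_onb G"
    and f: "\<And>d u. square_integrable \<nu> (f d u)"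
    and sum: "\<And>u. ((\<lambda>d. \<integral>x. (cmod (f d u x))\<^sup>2 \<partial>\<nu>) has_sum (norm u)\<^sup>2) D"
  obtains \<phi> where "\<phi> \<in> borel_measurable \<nu>"
    "AE x in \<nu>. \<forall>d\<in>D. \<forall>g\<in>G. cinner (t d g) (\<phi> x) = f d (contract2 t g \<psi>) x"
    "(\<integral>\<^sup>+ x. ennreal ((norm (\<phi> x))\<^sup>2) \<partial>\<nu>) = ennreal ((norm \<psi>)\<^sup>2)"
proof -
  let ?t = "\<lambda>(d, g). t d g"
  let ?B = "?t ` (D \<times> G)"
  have B: "is_onb ?B" and inj: "inj_on ?t (D \<times> G)" using is_onb_tensor[OF t D G] by auto
  have cB: "countable ?B" by (rule orthonormal_countable[OF is_onb_orthonormal[OF B]])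
  define i where "i = the_inv_into (D \<times> G) ?t"
  define c where "c e = f (fst (i e)) (contract2 t (snd (i e)) \<psi>)" for e
  have c: "c (t d g) = f d (contract2 t g \<psi>)" if "d \<in> D" "g \<in> G" for d g
    using the_inv_into_f_f[OF inj, of "(d, g)"] that by (simp add: c_def i_def)
  have mc: "c e \<in> borel_measurable \<nu>" and ic: "integrable \<nu> (\<lambda>x. (cmod (c e x))\<^sup>2)" for e
    using f by (auto simp: c_def square_integrable_def)
  let ?a = "\<lambda>(g, d). \<integral>x. (cmod (f d (contract2 t g \<psi>) x))\<^sup>2 \<partial>\<nu>"
  have inner: "((\<lambda>d. ?a (g, d)) has_sum (norm (contract2 t g \<psi>))\<^sup>2) D" for g
    using sum[of "contract2 t g \<psi>"] by simp
  have outer: "((\<lambda>g. (norm (contract2 t g \<psi>))\<^sup>2) has_sum (norm \<psi>)\<^sup>2) G"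
    by (rule contract2_parseval[OF t G])
  have "?a summable_on G \<times> D"
    by (rule summable_on_SigmaI[OF inner has_sum_imp_summable[OF outer]]) simp
  then have "(?a has_sum (norm \<psi>)\<^sup>2) (G \<times> D)" by (rule has_sum_SigmaI[OF inner outer])
  then have "((\<lambda>(d, g). \<integral>x. (cmod (f d (contract2 t g \<psi>) x))\<^sup>2 \<partial>\<nu>) has_sum (norm \<psi>)\<^sup>2) (D \<times> G)"
    unfolding has_sum_swap[of ?a] by simp
  then have "(((\<lambda>e. \<integral>x. (cmod (c e x))\<^sup>2 \<partial>\<nu>) \<circ> ?t) has_sum (norm \<psi>)\<^sup>2) (D \<times> G)"
    by (rule iffD1[OF has_sum_cong, rotated]) (auto simp: c)
  then have "((\<lambda>e. \<integral>x. (cmod (c e x))\<^sup>2 \<partial>\<nu>) has_sum (norm \<psi>)\<^sup>2) ?B"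
    unfolding has_sum_reindex[OF inj] .
  from has_sum_imp_nn_integral[OF this]
  have tot: "(\<integral>\<^sup>+ e. ennreal (\<integral>x. (cmod (c e x))\<^sup>2 \<partial>\<nu>) \<partial>count_space ?B) = ennreal ((norm \<psi>)\<^sup>2)" by simp
  define S where "S x = (\<integral>\<^sup>+ e. ennreal ((cmod (c e x))\<^sup>2) \<partial>count_space ?B)" for x
  have me: "(\<lambda>x. ennreal ((cmod (c e x))\<^sup>2)) \<in> borel_measurable \<nu>" for e using mc[of e] by measurable
  have mS: "S \<in> borel_measurable \<nu>"
    unfolding S_def by (rule borel_measurable_nn_integral_count_space[OF cB me])
  have intS: "(\<integral>\<^sup>+ x. S x \<partial>\<nu>) = ennreal ((norm \<psi>)\<^sup>2)"
    unfolding S_def nn_integral_count_space_nn_integral[OF cB me] tot[symmetric]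
    by (intro nn_integral_cong nn_integral_eq_integral ic) simp
  have fin: "AE x in \<nu>. S x \<noteq> \<infinity>"
    by (rule nn_integral_noteq_infinite[OF mS]) (simp add: intS)
  \<comment> \<open>On the null set where the squares are not summable the value 0 keeps \<phi>
    measurable.\<close>
  define \<phi> where "\<phi> x = (if S x \<noteq> \<infinity> then (SOME z. \<forall>e\<in>?B. cinner e z = c e x) else 0)" for x
  have coord: "cinner e (\<phi> x) = (if S x \<noteq> \<infinity> then c e x else 0)" if e: "e \<in> ?B" for e x
  proof (cases "S x \<noteq> \<infinity>")
    case True
    have "\<exists>z. \<forall>e\<in>?B. cinner e z = c e x"
      by (rule riesz_fischer[OF is_onb_orthonormal[OF B]]) (use True in \<open>simp add: S_def less_top\<close>)
    from someI_ex[OF this] have "\<forall>e\<in>?B. cinner e (\<phi> x) = c e x" unfolding \<phi>_def if_P[OF True] .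
    from bspec[OF this e] show ?thesis using True by simp
  qed (simp add: \<phi>_def)
  have m: "\<phi> \<in> borel_measurable \<nu>"
  proof (rule borel_measurable_weak[OF B])
    fix e assume e: "e \<in> ?B"
    show "(\<lambda>x. cinner e (\<phi> x)) \<in> borel_measurable \<nu>"
      unfolding coord[OF e] using mS mc[of e] by measurable
  qed
  have "AE x in \<nu>. \<forall>d\<in>D. \<forall>g\<in>G. cinner (t d g) (\<phi> x) = f d (contract2 t g \<psi>) x"
    using fin
  proof eventually_elim
    case (elim x)
    show ?case
    proof (intro ballI)
      fix d g assume dg: "d \<in> D" "g \<in> G"
      then have "t d g \<in> ?B" by auto
      from coord[OF this, of x] show "cinner (t d g) (\<phi> x) = f d (contract2 t g \<psi>) x"
        using elim c[OF dg] by simp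
    qed
  qed
  moreover have "(\<integral>\<^sup>+ x. ennreal ((norm (\<phi> x))\<^sup>2) \<partial>\<nu>) = (\<integral>\<^sup>+ x. S x \<partial>\<nu>)"
  proof (rule nn_integral_cong_AE, use fin in eventually_elim)
    case (elim x)
    show "ennreal ((norm (\<phi> x))\<^sup>2) = S x"
      unfolding S_def parseval_nn[OF B, symmetric]
      by (rule nn_integral_cong) (use elim coord in simp)
  qed
  ultimately show ?thesis using that m intS by simp
qed

lemma set_integral_eq_integral_density:
  fixes h :: "'x \<Rightarrow> complex"
  assumes "h \<in> borel_measurable M" "F \<in> sets M"
  shows "(LINT x:F|M. h x) = (\<integral>x. h x \<partial>density M (indicator F))"
  using integral_density[of h M "indicator F"] assms
  by (simp add: set_lebesgue_integral_def ennreal_indicator[abs_def])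

lemma eq_on_onb:
  assumes "is_onb G" "\<And>g. g \<in> G \<Longrightarrow> cinner z g = cinner z' g"
  shows "z = z'"
  using onb_eqI[OF assms(1), of z z'] assms(2) cinner_commute by metis

text \<open>The state of the system and the reference after the outcome \<open>x\<close> is the vector \<open>\<xi> x\<close>: efficiency
  of the instrument keeps the joint state pure.\<close>

lemma efficient_pure_states:
  fixes X :: "'x measure" and t0 :: "'h::separable_chilbert \<Rightarrow> 'h0::separable_chilbert \<Rightarrow> 'hh0::separable_chilbert"
    and t :: "'h \<Rightarrow> 'k::separable_chilbert \<Rightarrow> 'hk::separable_chilbert"
  assumes eff: "efficient t0 X \<MM>" and t0: "hilbert_tensor t0" and inst: "instrument X \<MM>"
    and t: "hilbert_tensor t" and \<psi>: "norm \<psi> = 1" and G: "is_onb G"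
  defines "\<mu> \<equiv> posteriori_measure X \<MM> (ptrace_snd t (ketbra \<psi> \<psi>))"
  obtains \<xi> where "\<And>x. norm (\<xi> x) = 1" "sets \<mu> = sets X" "\<xi> \<in> borel_measurable \<mu>" "emeasure \<mu> (space \<mu>) = 1"
    and "\<And>F h h'. F \<in> sets X \<Longrightarrow> cinner h (blinfun_apply (\<MM> F (ptrace_snd t (ketbra \<psi> \<psi>))) h')
        = (\<integral>x. cinner h (ptrace_snd t (ketbra (\<xi> x) (\<xi> x)) h') \<partial>density \<mu> (indicator F))"
    and "\<And>F k l. F \<in> sets X \<Longrightarrow> cinner k (ptrace_fst t (map_tensor_id t (\<MM> F) (ketbra \<psi> \<psi>)) l)
        = (\<integral>x. cinner k (ptrace_fst t (ketbra (\<xi> x) (\<xi> x)) l) \<partial>density \<mu> (indicator F))"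
    and "\<And>g. g \<in> G \<Longrightarrow> (\<integral>\<^sup>+ x. ennreal ((norm (contract2 t g (\<xi> x)))\<^sup>2) \<partial>\<mu>) = ennreal ((norm (contract2 t g \<psi>))\<^sup>2)"
proof -
  let ?D = "SOME D. is_onb (D :: 'h set)"
  have D: "is_onb ?D" by (rule is_onb_some)
  let ?\<omega> = "ketbra \<psi> \<psi>" and ?\<psi> = "\<lambda>k. contract2 t k \<psi>"
  let ?\<rho> = "ptrace_snd t ?\<omega>"
  obtain \<nu> :: "'x measure" and f :: "'h \<Rightarrow> 'h \<Rightarrow> 'x \<Rightarrow> complex"
    where \<nu>: "sets \<nu> = sets X" and f: "\<And>d u. square_integrable \<nu> (f d u)"
    and \<Psi>: "\<And>F d d'. F \<in> sets X \<Longrightarrow> \<exists>\<Psi>. clinear_op \<Psi> \<and>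
        (\<forall>T. trace_class T \<longrightarrow> cinner d (blinfun_apply (\<MM> F T) d') = trace (\<Psi> o\<^sub>L T)) \<and>
        (\<forall>u v. cinner v (\<Psi> u) = (\<integral>x. indicator F x * (cnj (f d' v x) * f d u x) \<partial>\<nu>))"
    and fsum: "\<And>D u. is_onb D \<Longrightarrow> ((\<lambda>d. \<integral>x. (cmod (f d u x))\<^sup>2 \<partial>\<nu>) has_sum (norm u)\<^sup>2) D"
    using efficient_density[OF eff t0 inst] by blast
  obtain \<phi> where m\<phi>: "\<phi> \<in> borel_measurable \<nu>"
    and \<phi>: "AE x in \<nu>. \<forall>d\<in>?D. \<forall>g\<in>G. cinner (t d g) (\<phi> x) = f d (?\<psi> g) x"
    and n\<phi>: "(\<integral>\<^sup>+ x. ennreal ((norm (\<phi> x))\<^sup>2) \<partial>\<nu>) = ennreal ((norm \<psi>)\<^sup>2)"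
    using vector_field_from_coordinates[OF t D G f fsum[OF D]] by blast
  \<comment> \<open>Where \<phi> vanishes any unit vector serves, for instance \<psi>: the measure
    \<open>M\<close> below gives these outcomes weight 0.\<close>
  define \<xi> where "\<xi> x = (if norm (\<phi> x) = 0 then \<psi> else (1 / norm (\<phi> x)) *\<^sub>R \<phi> x)" for x
  have u\<xi>: "norm (\<xi> x) = 1" for x by (simp add: \<xi>_def \<psi>)
  have mn: "(\<lambda>x. norm (\<phi> x)) \<in> borel_measurable \<nu>" using measurable_compose[OF m\<phi> borel_measurable_norm] .
  have m\<xi>: "\<xi> \<in> borel_measurable \<nu>"
  proof -
    have p: "Measurable.pred \<nu> (\<lambda>x. norm (\<phi> x) = 0)" using mn by measurable
    have s: "(\<lambda>x. (1 / norm (\<phi> x)) *\<^sub>R \<phi> x) \<in> borel_measurable \<nu>"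
      using mn m\<phi> by (intro borel_measurable_scaleR borel_measurable_divide borel_measurable_const)
    show ?thesis unfolding \<xi>_def by (rule measurable_If[OF _ s p[unfolded pred_def]]) simp
  qed
  have \<phi>\<xi>: "(norm (\<phi> x))\<^sup>2 *\<^sub>R (cinner u (\<xi> x) * cinner (\<xi> x) v) = cinner u (\<phi> x) * cinner (\<phi> x) v" for x u v
    by (cases "\<phi> x = 0")
      (simp_all add: \<xi>_def cinner_scaleR_left cinner_scaleR_right scaleR_conv_of_real power2_eq_square)
  \<comment> \<open>This will be identified with the posteriori measure; its total mass is the
    squared norm of \<psi>.\<close>
  define M where "M = density \<nu> (\<lambda>x. ennreal ((norm (\<phi> x))\<^sup>2))"
  have sM: "sets M = sets X" by (simp add: M_def \<nu>)
  have m\<xi>M: "\<xi> \<in> borel_measurable M" using m\<xi> by (simp add: M_def)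
  have mn2: "(\<lambda>x. ennreal ((norm (\<phi> x))\<^sup>2)) \<in> borel_measurable \<nu>" using mn by measurable
  have eM: "emeasure M (space M) = 1"
    using n\<phi> \<psi> by (simp add: M_def emeasure_density mn2 cong: nn_integral_cong)
  then have fM: "finite_measure M" by (intro finite_measureI) simp
  let ?N = "\<lambda>F. density M (indicator F)"
  have m\<xi>N: "\<xi> \<in> borel_measurable (?N F)" for F using m\<xi>M by simp
  have eN: "emeasure (?N F) (space (?N F)) = emeasure M F" if "F \<in> sets X" for F
  proof -
    have F: "F \<in> sets M" using that sM by simp
    have "emeasure (?N F) (space M) = (\<integral>\<^sup>+ x. indicator F x * indicator (space M) x \<partial>M)"
      by (rule emeasure_density) (use F in auto)
    also have "\<dots> = (\<integral>\<^sup>+ x. indicator F x \<partial>M)" by (intro nn_integral_cong) simp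
    finally show ?thesis using F by simp
  qed
  have fN: "finite_measure (?N F)" if "F \<in> sets X" for F
    using eN[OF that] finite_measure.emeasure_finite[OF fM, of F] by (intro finite_measureI) simp
  have int\<xi>: "integrable (?N F) (\<lambda>x. (norm (\<xi> x))\<^sup>2)" if "F \<in> sets X" for F
    using finite_measure.integrable_const[OF fN[OF that]] by (simp add: u\<xi>)
  \<comment> \<open>The weight of \<open>M\<close> undoes the normalization of \<xi>, and on product
    basis vectors \<phi> has the prescribed coordinates.\<close>
  have basis: "(\<integral>x. cinner (t d g) (\<xi> x) * cinner (\<xi> x) (t d' g') \<partial>?N F)
      = (\<integral>x. indicator F x * (cnj (f d' (?\<psi> g') x) * f d (?\<psi> g) x) \<partial>\<nu>)"
    if F: "F \<in> sets X" and dg: "d \<in> ?D" "g \<in> G" "d' \<in> ?D" "g' \<in> G" for F d g d' g'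
  proof -
    let ?h = "\<lambda>x. cinner (t d g) (\<xi> x) * cinner (\<xi> x) (t d' g')"
    have mh: "?h \<in> borel_measurable \<nu>"
      by (intro borel_measurable_times borel_measurable_cinner borel_measurable_const m\<xi>)
    have "(\<integral>x. ?h x \<partial>?N F) = (LINT x:F|M. ?h x)"
      using mh F sM by (intro set_integral_eq_integral_density[symmetric]) (auto simp: M_def)
    also have "\<dots> = (\<integral>x. (norm (\<phi> x))\<^sup>2 *\<^sub>R (indicator F x *\<^sub>R ?h x) \<partial>\<nu>)"
      unfolding set_lebesgue_integral_def M_def
      using mh mn F \<nu> by (intro integral_density borel_measurable_scaleR borel_measurable_indicator borel_measurable_power) auto
    also have "\<dots> = (\<integral>x. indicator F x *\<^sub>R (cinner (t d g) (\<phi> x) * cinner (\<phi> x) (t d' g')) \<partial>\<nu>)"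
      unfolding \<phi>\<xi>[symmetric] by (simp only: scaleR_left_commute)
    also have "\<dots> = (\<integral>x. indicator F x * (cnj (f d' (?\<psi> g') x) * f d (?\<psi> g) x) \<partial>\<nu>)"
    proof (rule integral_cong_AE)
      show "(\<lambda>x. indicator F x *\<^sub>R (cinner (t d g) (\<phi> x) * cinner (\<phi> x) (t d' g'))) \<in> borel_measurable \<nu>"
        using F \<nu> by (intro borel_measurable_scaleR borel_measurable_indicator borel_measurable_times
            borel_measurable_cinner borel_measurable_const m\<phi>) auto
      have "f d (?\<psi> g) \<in> borel_measurable \<nu>" "f d' (?\<psi> g') \<in> borel_measurable \<nu>"
        using f by (auto simp: square_integrable_def)
      then show "(\<lambda>x. indicator F x * (cnj (f d' (?\<psi> g') x) * f d (?\<psi> g) x)) \<in> borel_measurable \<nu>"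
        using F \<nu> by (intro borel_measurable_indicator borel_measurable_times
          borel_measurable_bounded_linear[OF _ bounded_linear_cnj]) auto
      show "AE x in \<nu>. indicator F x *\<^sub>R (cinner (t d g) (\<phi> x) * cinner (\<phi> x) (t d' g'))
          = indicator F x * (cnj (f d' (?\<psi> g') x) * f d (?\<psi> g) x)"
        using \<phi>
      proof eventually_elim
        case (elim x)
        have 1: "cinner (t d g) (\<phi> x) = f d (?\<psi> g) x" using elim dg by blast
        have "cinner (t d' g') (\<phi> x) = f d' (?\<psi> g') x" using elim dg by blast
        then have 2: "cinner (\<phi> x) (t d' g') = cnj (f d' (?\<psi> g') x)"
          using cinner_commute[of "\<phi> x" "t d' g'"] by simp
        show ?case unfolding 1 2 by (simp add: indicator_def mult.commute)
      qed
    qed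
    finally show ?thesis .
  qed
  \<comment> \<open>S is the unnormalized joint operator for the event F. It is given weakly and
    identified with the output of the instrument through its blocks.\<close>
  have key: "\<exists>S. trace_class S \<and> (\<forall>u v. cinner u (S v) = (\<integral>x. cinner u (\<xi> x) * cinner (\<xi> x) v \<partial>?N F))
      \<and> map_tensor_id t (\<MM> F) ?\<omega> = S \<and> \<MM> F ?\<rho> = ptrace_snd t S" if F: "F \<in> sets X" for F
  proof -
    obtain S where S: "trace_class S" "\<And>u v. cinner u (S v) = (\<integral>x. cinner u (\<xi> x) * cinner (\<xi> x) v \<partial>?N F)"
      using weak_integral_ketbra[OF m\<xi>N int\<xi>[OF F]] by blast
    have Slin: "clinear_op S" using S(1) by (simp add: trace_class_def)
    have Mlin: "clinear_op (\<MM> F T)" if "trace_class T" for T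
      using inst F that by (auto simp: instrument_def operation_def trace_class_def)
    have blk: "block1 t k l ?\<omega> = ketbra (?\<psi> k) (?\<psi> l)" for k l
      by (rule blinfun_eqI)
        (simp add: blinfun_apply_block1[OF t] blinfun_apply_ketbra contract2_scaleC[OF t] cinner_contract2_left[OF t])
    have mat: "\<exists>\<Psi>. clinear_op \<Psi> \<and> (\<forall>T. trace_class T \<longrightarrow> cinner d (blinfun_apply (\<MM> F T) d') = trace (\<Psi> o\<^sub>L T))
        \<and> (\<forall>k l. cinner (t d k) (S (t d' l)) = cinner (?\<psi> l) (\<Psi> (?\<psi> k)))"
      if dd: "d \<in> ?D" "d' \<in> ?D" for d d'
    proof -
      obtain \<Psi> where \<Psi>1: "clinear_op \<Psi>"
        and \<Psi>2: "\<forall>T. trace_class T \<longrightarrow> cinner d (blinfun_apply (\<MM> F T) d') = trace (\<Psi> o\<^sub>L T)"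
        and \<Psi>3: "\<And>u v. cinner v (\<Psi> u) = (\<integral>x. indicator F x * (cnj (f d' v x) * f d u x) \<partial>\<nu>)"
        using \<Psi>[OF F, of d d'] by blast
      let ?R = "block2 t d d' S"
      have R: "cinner (t d k) (S (t d' l)) = cinner k (?R l)" for k l
        by (simp add: blinfun_apply_block2[OF t] cinner_contract1[OF t])
      have Rlin: "clinear_op ?R" by (rule clinear_op_block2[OF t Slin])
      have b: "cinner g (?R g') = cinner (?\<psi> g') (\<Psi> (?\<psi> g))" if "g \<in> G" "g' \<in> G" for g g'
        using basis[OF F dd(1) that(1) dd(2) that(2)] by (simp add: R[symmetric] S(2) \<Psi>3)
      \<comment> \<open>The functions f need not be linear in their vector argument pointwise, but
        both sides of \<open>b\<close> are linear or conjugate-linear in each argument. So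
        \<open>b\<close> is extended from G one argument at a time, by recognizing a contraction of
        \<psi>.\<close>
      have b1: "cinner g (?R l) = cinner (?\<psi> l) (\<Psi> (?\<psi> g))" if g: "g \<in> G" for g l
      proof -
        have "blinfun_apply (adj ?R) g = contract1 t (\<Psi> (?\<psi> g)) \<psi>"
          by (rule eq_on_onb[OF G])
            (simp add: cinner_adj_left[OF Rlin] b[OF g] cinner_contract2_left[OF t] cinner_contract1_left[OF t])
        then show ?thesis
          by (simp add: cinner_adj_left[OF Rlin, symmetric] cinner_contract2_left[OF t] cinner_contract1_left[OF t])
      qed
      have b2: "cinner k (?R l) = cinner (?\<psi> l) (\<Psi> (?\<psi> k))" for k l
      proof -
        have "?R l = contract1 t (blinfun_apply (adj \<Psi>) (?\<psi> l)) \<psi>"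
          by (rule onb_eqI[OF G])
            (simp add: b1 cinner_contract1[OF t] cinner_contract2[OF t, symmetric] cinner_adj_left[OF \<Psi>1])
        then show ?thesis
          by (simp add: cinner_contract1[OF t] cinner_contract2[OF t, symmetric] cinner_adj_left[OF \<Psi>1])
      qed
      show ?thesis using \<Psi>1 \<Psi>2 b2 R by (intro exI[of _ \<Psi>]) simp
    qed
    have blocks: "block1 t k l S = \<MM> F (block1 t k l ?\<omega>)" for k l
      unfolding blk
    proof (rule clinear_op_eqI[OF D D])
      show "clinear_op (block1 t k l S)"
        using clinear_op_block2[OF tensor_flip[OF t] Slin] by (simp add: block2_flip[OF tensor_flip[OF t]])
      show "clinear_op (\<MM> F (ketbra (?\<psi> k) (?\<psi> l)))" by (rule Mlin[OF trace_class_ketbra])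
      fix d' d assume dd: "d' \<in> ?D" "d \<in> ?D"
      obtain \<Psi> where \<Psi>1: "clinear_op \<Psi>"
        and \<Psi>2: "\<forall>T. trace_class T \<longrightarrow> cinner d (blinfun_apply (\<MM> F T) d') = trace (\<Psi> o\<^sub>L T)"
        and \<Psi>3: "\<forall>k l. cinner (t d k) (S (t d' l)) = cinner (?\<psi> l) (\<Psi> (?\<psi> k))"
        using mat[OF dd(2,1)] by blast
      show "cinner d (blinfun_apply (block1 t k l S) d') = cinner d (blinfun_apply (\<MM> F (ketbra (?\<psi> k) (?\<psi> l))) d')"
        by (simp add: blinfun_apply_block1[OF t] cinner_contract2[OF t] trace_compose_ketbra[OF \<Psi>1]
            \<Psi>3 \<Psi>2[rule_format, OF trace_class_ketbra])
    qed
    \<comment> \<open>The definite description also asks for uniqueness: the blocks contain all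
      matrix elements in a product basis.\<close>
    have "map_tensor_id t (\<MM> F) ?\<omega> = S"
      unfolding map_tensor_id_def
    proof (rule the_equality)
      fix S' assume S': "trace_class S' \<and> (\<forall>k l. block1 t k l S' = \<MM> F (block1 t k l ?\<omega>))"
      show "S' = S"
      proof (rule clinear_op_eqI[OF is_onb_tensor(1)[OF t D G] is_onb_tensor(1)[OF t D G] _ Slin])
        show "clinear_op S'" using S' by (simp add: trace_class_def)
        fix e e' assume "e \<in> (\<lambda>(d, g). t d g) ` (?D \<times> G)" "e' \<in> (\<lambda>(d, g). t d g) ` (?D \<times> G)"
        then obtain d g d' g' where e: "e = t d g" "e' = t d' g'" by auto
        have "block1 t g' g S' = block1 t g' g S" using S' blocks by simp
        then have "cinner d' (blinfun_apply (block1 t g' g S') d) = cinner d' (blinfun_apply (block1 t g' g S) d)" by simp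
        then show "cinner e' (S' e) = cinner e' (S e)"
          by (simp add: e blinfun_apply_block1[OF t] cinner_contract2[OF t])
      qed
    qed (use S(1) blocks in blast)
    \<comment> \<open>Both matrix elements equal the sum of
      \<open>cinner (?\<psi> k) (\<Psi> (?\<psi> k))\<close> over k, once as a trace against
      \<open>?\<rho>\<close> and once as a partial trace of S.\<close>
    moreover have "\<MM> F ?\<rho> = ptrace_snd t S"
    proof (rule clinear_op_eqI[OF D D])
      show "clinear_op (\<MM> F ?\<rho>)" by (rule Mlin[OF trace_class_ptrace_snd_ketbra[OF t]])
      show "clinear_op (ptrace_snd t S)"
        unfolding ptrace_snd_flip[of t] by (rule clinear_op_ptrace_fst[OF tensor_flip[OF t] S(1)])
      fix d' d assume dd: "d' \<in> ?D" "d \<in> ?D"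
      obtain \<Psi> where \<Psi>1: "clinear_op \<Psi>"
        and \<Psi>2: "\<forall>T. trace_class T \<longrightarrow> cinner d (blinfun_apply (\<MM> F T) d') = trace (\<Psi> o\<^sub>L T)"
        and \<Psi>3: "\<And>k l. cinner (t d k) (S (t d' l)) = cinner (?\<psi> l) (\<Psi> (?\<psi> k))"
        using mat[OF dd(2,1)] by blast
      have "((\<lambda>k. cinner (?\<psi> k) (\<Psi> (?\<psi> k))) has_sum trace (\<Psi> o\<^sub>L ?\<rho>)) (SOME K. is_onb K)"
        using trace_ptrace_ketbra_has_sum[OF tensor_flip[OF t] \<Psi>1 is_onb_some, of \<psi>]
        by (simp only: ptrace_snd_flip[of t] contract1_flip[of t])
      moreover have "((\<lambda>k. cinner (?\<psi> k) (\<Psi> (?\<psi> k))) has_sum cinner d (ptrace_snd t S d')) (SOME K. is_onb K)"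
        using ptrace_fst_has_sum[OF tensor_flip[OF t] S(1), of d d']
        by (simp add: ptrace_snd_flip[of t] contract1_flip[of t] cinner_contract2[OF t] \<Psi>3)
      ultimately have "trace (\<Psi> o\<^sub>L ?\<rho>) = cinner d (ptrace_snd t S d')" by (rule has_sum_unique)
      then show "cinner d (blinfun_apply (\<MM> F ?\<rho>) d') = cinner d (ptrace_snd t S d')"
        using \<Psi>2 trace_class_ptrace_snd_ketbra[OF t] by simp
    qed
    ultimately show ?thesis using S by blast
  qed
  have snd: "cinner h (blinfun_apply (\<MM> F ?\<rho>) h') = (\<integral>x. cinner h (ptrace_snd t (ketbra (\<xi> x) (\<xi> x)) h') \<partial>?N F)"
    if F: "F \<in> sets X" for F h h'
  proof -
    obtain S where "trace_class S" "\<And>u v. cinner u (S v) = (\<integral>x. cinner u (\<xi> x) * cinner (\<xi> x) v \<partial>?N F)"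
      and "\<MM> F ?\<rho> = ptrace_snd t S" using key[OF F] by blast
    then show ?thesis
      using cinner_ptrace_weak_integral[OF m\<xi>N int\<xi>[OF F] tensor_flip[OF t]] by (simp add: ptrace_snd_flip[of t])
  qed
  have fst: "cinner k (ptrace_fst t (map_tensor_id t (\<MM> F) ?\<omega>) l) = (\<integral>x. cinner k (ptrace_fst t (ketbra (\<xi> x) (\<xi> x)) l) \<partial>?N F)"
    if F: "F \<in> sets X" for F k l
  proof -
    obtain S where "trace_class S" "\<And>u v. cinner u (S v) = (\<integral>x. cinner u (\<xi> x) * cinner (\<xi> x) v \<partial>?N F)"
      and "map_tensor_id t (\<MM> F) ?\<omega> = S" using key[OF F] by blast
    then show ?thesis
      using cinner_ptrace_weak_integral[OF m\<xi>N int\<xi>[OF F] t] by simp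
  qed
  \<comment> \<open>Trace against the identity: the reduced states have trace 1, so the integral is
    the mass of F.\<close>
  have mu: "ennreal (Re (trace (\<MM> F ?\<rho>))) = emeasure M F" if F: "F \<in> sets X" for F
  proof -
    have "trace (id_blinfun o\<^sub>L \<MM> F ?\<rho>) = (\<integral>x. trace (id_blinfun o\<^sub>L ptrace_snd t (ketbra (\<xi> x) (\<xi> x))) \<partial>?N F)"
      unfolding ptrace_snd_flip[of t]
      by (rule trace_weak_integral(1)[OF m\<xi>N int\<xi>[OF F] tensor_flip[OF t] clinear_op_id])
        (rule snd[OF F, unfolded ptrace_snd_flip[of t]])
    moreover have "id_blinfun o\<^sub>L T = T" for T :: "'h \<Rightarrow>\<^sub>L 'h" by (rule blinfun_eqI) simp
    moreover have "trace (ptrace_snd t (ketbra (\<xi> x) (\<xi> x))) = 1" for x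
      using is_state_ptrace_snd_ketbra[OF t u\<xi>] by (simp add: is_state_def)
    ultimately have "trace (\<MM> F ?\<rho>) = of_real (measure (?N F) (space (?N F)))" by (simp add: scaleR_conv_of_real)
    then show ?thesis
      using eN[OF F] finite_measure.emeasure_eq_measure[OF fN[OF F]] by simp
  qed
  \<comment> \<open>\<open>measure_of\<close> returns its set function only if that is a measure;
    here it coincides with the measure of \<open>M\<close> on all measurable sets.\<close>
  have "\<mu> = M"
  proof -
    have "\<mu> = measure_of (space M) (sets M) (\<lambda>F. ennreal (Re (trace (\<MM> F ?\<rho>))))"
      unfolding \<mu>_def posteriori_measure_def using sM sets_eq_imp_space_eq[OF sM] by simp
    also have "\<dots> = measure_of (space M) (sets M) (emeasure M)"
      by (rule measure_of_eq[OF sets.space_closed]) (simp add: sets.sigma_sets_eq mu[unfolded sM[symmetric]])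
    finally show ?thesis by (simp add: measure_of_of_measure)
  qed
  \<comment> \<open>On average the outcome does not change the state of the reference. The squared
    contraction is a sum over d of squared densities, and \<open>fsum\<close> evaluates its
    integral.\<close>
  moreover have "(\<integral>\<^sup>+ x. ennreal ((norm (contract2 t g (\<xi> x)))\<^sup>2) \<partial>M) = ennreal ((norm (?\<psi> g))\<^sup>2)" if g: "g \<in> G" for g
  proof -
    have cD: "countable ?D" by (rule orthonormal_countable[OF is_onb_orthonormal[OF D]])
    have fm: "f d u \<in> borel_measurable \<nu>" for d u using f by (simp add: square_integrable_def)
    have "(\<lambda>x. ennreal ((norm (contract2 t g (\<xi> x)))\<^sup>2)) \<in> borel_measurable \<nu>"
      using measurable_compose[OF borel_measurable_bounded_linear[OF m\<xi> bounded_linear_contract2[OF t]] borel_measurable_norm] by measurable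
    then have "(\<integral>\<^sup>+ x. ennreal ((norm (contract2 t g (\<xi> x)))\<^sup>2) \<partial>M)
      = (\<integral>\<^sup>+ x. ennreal ((norm (\<phi> x))\<^sup>2) * ennreal ((norm (contract2 t g (\<xi> x)))\<^sup>2) \<partial>\<nu>)"
      unfolding M_def by (rule nn_integral_density[OF mn2])
    also have "\<dots> = (\<integral>\<^sup>+ x. \<integral>\<^sup>+ d. ennreal ((cmod (f d (?\<psi> g) x))\<^sup>2) \<partial>count_space ?D \<partial>\<nu>)"
    proof (rule nn_integral_cong_AE, use \<phi> in eventually_elim)
      case (elim x)
      have "(norm (\<phi> x))\<^sup>2 * (norm (contract2 t g (\<xi> x)))\<^sup>2 = (norm (contract2 t g (\<phi> x)))\<^sup>2"
      proof -
        have "\<phi> x = norm (\<phi> x) *\<^sub>R \<xi> x" by (simp add: \<xi>_def)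
        then have "contract2 t g (\<phi> x) = norm (\<phi> x) *\<^sub>R contract2 t g (\<xi> x)"
          using linear_scale[OF bounded_linear.linear[OF bounded_linear_contract2[OF t]]] by metis
        then show ?thesis by (simp add: power_mult_distrib)
      qed
      then have "ennreal ((norm (\<phi> x))\<^sup>2) * ennreal ((norm (contract2 t g (\<xi> x)))\<^sup>2) = ennreal ((norm (contract2 t g (\<phi> x)))\<^sup>2)"
        by (simp add: ennreal_mult[symmetric])
      also have "\<dots> = (\<integral>\<^sup>+ d. ennreal ((cmod (f d (?\<psi> g) x))\<^sup>2) \<partial>count_space ?D)"
        unfolding parseval_nn[OF D, symmetric]
        by (rule nn_integral_cong) (use elim g in \<open>simp add: cinner_contract2[OF t]\<close>)
      finally show ?case .
    qed
    also have "\<dots> = (\<integral>\<^sup>+ d. \<integral>\<^sup>+ x. ennreal ((cmod (f d (?\<psi> g) x))\<^sup>2) \<partial>\<nu> \<partial>count_space ?D)"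
      by (rule nn_integral_count_space_nn_integral[OF cD]) (use fm in measurable)
    also have "\<dots> = (\<integral>\<^sup>+ d. ennreal (\<integral>x. (cmod (f d (?\<psi> g) x))\<^sup>2 \<partial>\<nu>) \<partial>count_space ?D)"
      by (intro nn_integral_cong nn_integral_eq_integral) (use f in \<open>auto simp: square_integrable_def\<close>)
    also have "\<dots> = ennreal ((norm (?\<psi> g))\<^sup>2)"
      by (rule has_sum_imp_nn_integral[OF fsum[OF D]]) simp
    finally show ?thesis .
  qed
  ultimately show ?thesis
    using that[of \<xi>] u\<xi> sM m\<xi>M eM snd fst by simp
qed

section \<open>Operator densities\<close>

lemma AE_eq_of_set_integrals:
  fixes f g :: "'x \<Rightarrow> complex"
  assumes f: "integrable M f" and g: "integrable M g"
    and eq: "\<And>A. A \<in> sets M \<Longrightarrow> (LINT x:A|M. f x) = (LINT x:A|M. g x)"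
  shows "AE x in M. f x = g x"
proof -
  have Re: "(LINT x:A|M. Re (h x)) = Re (LINT x:A|M. h x)" and Im: "(LINT x:A|M. Im (h x)) = Im (LINT x:A|M. h x)"
    if h: "integrable M h" and A: "A \<in> sets M" for h :: "'x \<Rightarrow> complex" and A
    using integral_Re[OF integrable_mult_indicator[OF A h]] integral_Im[OF integrable_mult_indicator[OF A h]]
    unfolding set_lebesgue_integral_def by simp_all
  have "AE x in M. Re (f x) = Re (g x)"
    by (rule density_unique_real) (use f g eq Re in auto)
  moreover have "AE x in M. Im (f x) = Im (g x)"
    by (rule density_unique_real) (use f g eq Im in auto)
  ultimately show ?thesis by eventually_elim (simp add: complex_eq_iff)
qed

text \<open>Matrix elements are traces against rank-one operators, hence integrable functions
  determined by their set integrals, and countably many of them determine the operator. The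
  representative chosen in \<open>qc_channel_tensor_id\<close> can thus be replaced by an explicit
  one.\<close>

lemma op_density_unique:
  fixes \<sigma>1 \<sigma>2 :: "'x \<Rightarrow> ('a::separable_chilbert \<Rightarrow>\<^sub>L 'a)"
  assumes 1: "op_density M m \<sigma>1" and 2: "op_density M m \<sigma>2"
  shows "AE x in M. \<sigma>1 x = \<sigma>2 x"
proof -
  let ?D = "SOME D. is_onb (D :: 'a set)"
  have D: "is_onb ?D" by (rule is_onb_some)
  note oD = is_onb_orthonormal[OF D]
  have int: "integrable M (\<lambda>x. trace (ketbra l k o\<^sub>L \<sigma> x))" if \<sigma>: "op_density M m \<sigma>" and kl: "k \<in> ?D" "l \<in> ?D" for \<sigma> k l
  proof (rule integrableI_bounded)
    show "(\<lambda>x. trace (ketbra l k o\<^sub>L \<sigma> x)) \<in> borel_measurable M"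
      using \<sigma> clinear_op_ketbra[of l k] by (simp add: op_density_def)
    have "(\<integral>\<^sup>+ x. ennreal (norm (trace (ketbra l k o\<^sub>L \<sigma> x))) \<partial>M) \<le> (\<integral>\<^sup>+ x. trace_norm (\<sigma> x) \<partial>M)"
    proof (rule nn_integral_mono)
      fix x assume "x \<in> space M"
      then have "clinear_op (\<sigma> x)" using \<sigma> by (simp add: op_density_def trace_class_def)
      then show "ennreal (norm (trace (ketbra l k o\<^sub>L \<sigma> x))) \<le> trace_norm (\<sigma> x)"
        using cmod_cinner_le_trace_norm[OF orthonormal_norm[OF oD kl(1)] orthonormal_norm[OF oD kl(2)]]
        by (simp add: trace_ketbra_compose)
    qed
    then show "(\<integral>\<^sup>+ x. ennreal (norm (trace (ketbra l k o\<^sub>L \<sigma> x))) \<partial>M) < \<infinity>"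
      using \<sigma> unfolding op_density_def by (meson order.strict_trans1)
  qed
  have cD: "countable ?D" by (rule orthonormal_countable[OF oD])
  have "AE x in M. trace (ketbra l k o\<^sub>L \<sigma>1 x) = trace (ketbra l k o\<^sub>L \<sigma>2 x)" if "k \<in> ?D" "l \<in> ?D" for k l
  proof (rule AE_eq_of_set_integrals[OF int[OF 1 that] int[OF 2 that]])
    fix A assume "A \<in> sets M"
    then show "(LINT x:A|M. trace (ketbra l k o\<^sub>L \<sigma>1 x)) = (LINT x:A|M. trace (ketbra l k o\<^sub>L \<sigma>2 x))"
      using 1 2 clinear_op_ketbra[of l k] by (simp add: op_density_def)
  qed
  then have "AE x in M. \<forall>k\<in>?D. \<forall>l\<in>?D. trace (ketbra l k o\<^sub>L \<sigma>1 x) = trace (ketbra l k o\<^sub>L \<sigma>2 x)"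
    by (simp add: AE_ball_countable[OF cD])
  then show ?thesis
    using AE_space
  proof eventually_elim
    case (elim x)
    have lin: "clinear_op (\<sigma>1 x)" "clinear_op (\<sigma>2 x)" using 1 2 elim(2) by (auto simp: op_density_def trace_class_def)
    show ?case
      by (rule clinear_op_eqI[OF D D lin]) (use elim(1) in \<open>simp add: trace_ketbra_compose lin\<close>)
  qed
qed

text \<open>Matrix elements of m suffice because \<open>trace_weak_integral\<close> recovers the
  traces against all bounded operators. Integrability holds since the trace norm of the reduced
  operator is at most the squared norm of \<open>\<xi> x\<close>.\<close>

lemma op_density_ptrace:
  fixes t :: "'a::separable_chilbert \<Rightarrow> 'b::separable_chilbert \<Rightarrow> 'c::separable_chilbert"
  assumes t: "hilbert_tensor t" and m\<xi>: "\<xi> \<in> borel_measurable M"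
    and int: "integrable M (\<lambda>x. (norm (\<xi> x))\<^sup>2)"
    and m: "\<And>F k l. F \<in> sets M \<Longrightarrow> cinner k (blinfun_apply (m F) l)
        = (\<integral>x. cinner k (ptrace_fst t (ketbra (\<xi> x) (\<xi> x)) l) \<partial>density M (indicator F))"
  shows "op_density M m (\<lambda>x. ptrace_fst t (ketbra (\<xi> x) (\<xi> x)))"
proof -
  let ?\<sigma> = "\<lambda>x. ptrace_fst t (ketbra (\<xi> x) (\<xi> x))"
  have m\<xi>': "\<xi> \<in> borel_measurable (density M (indicator F))" for F using m\<xi> by simp
  have int': "integrable (density M (indicator F)) (\<lambda>x. (norm (\<xi> x))\<^sup>2)" if F: "F \<in> sets M" for F
  proof -
    have "integrable (density M (\<lambda>x. ennreal (indicator F x))) (\<lambda>x. (norm (\<xi> x))\<^sup>2)"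
      using F int integrable_mult_indicator[OF F int] by (subst integrable_density) auto
    then show ?thesis by (simp add: ennreal_indicator[abs_def])
  qed
  have tr: "trace (A o\<^sub>L m F) = (\<integral>x. trace (A o\<^sub>L ?\<sigma> x) \<partial>density M (indicator F))"
    "integrable (density M (indicator F)) (\<lambda>x. trace (A o\<^sub>L ?\<sigma> x))" if "clinear_op A" "F \<in> sets M" for A F
    using trace_weak_integral[OF m\<xi>' int'[OF that(2)] t that(1) m[OF that(2)]] by blast+
  have meas: "(\<lambda>x. trace (A o\<^sub>L ?\<sigma> x)) \<in> borel_measurable M" if "clinear_op A" for A
    using borel_measurable_integrable[OF tr(2)[OF that sets.top]] by simp
  have "(\<integral>\<^sup>+ x. trace_norm (?\<sigma> x) \<partial>M) \<le> (\<integral>\<^sup>+ x. ennreal ((norm (\<xi> x))\<^sup>2) \<partial>M)"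
    by (intro nn_integral_mono trace_norm_ptrace_ketbra[OF t])
  also have "\<dots> < \<infinity>" using int by (simp add: nn_integral_eq_integral)
  finally show ?thesis
    unfolding op_density_def using tr(1) meas
    by (auto simp: trace_class_ptrace_ketbra[OF t] set_integral_eq_integral_density)
qed


section \<open>Entropy reduction and mutual information\<close>

theorem corollary1:
  fixes X :: "'x measure"
    and \<mu>0 :: "'x measure"
    and \<MM> :: "'x set \<Rightarrow> ('h::separable_chilbert \<Rightarrow>\<^sub>L 'h) \<Rightarrow> ('h \<Rightarrow>\<^sub>L 'h)"
    and t0 :: "'h \<Rightarrow> 'h0::separable_chilbert \<Rightarrow> 'hh0::separable_chilbert"
    and t :: "'h \<Rightarrow> 'k::separable_chilbert \<Rightarrow> 'hk::separable_chilbert"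
    and \<rho> :: "'h \<Rightarrow>\<^sub>L 'h"
    and r :: "'x \<Rightarrow> ('h \<Rightarrow>\<^sub>L 'h)"
    and \<omega> :: "'hk \<Rightarrow>\<^sub>L 'hk"
  assumes "instrument X \<MM>"
    and "hilbert_tensor t0"
    and "efficient t0 X \<MM>"
    and "sets \<mu>0 = sets X"
    and "sigma_finite_measure \<mu>0"
    and "complete_measure \<mu>0"
    and "\<And>\<rho>'. is_state \<rho>' \<Longrightarrow> absolutely_continuous \<mu>0 (posteriori_measure X \<MM> \<rho>')"
    and "is_state \<rho>"
    and "entropy \<rho> < \<infinity>"
    and "posteriori_states X \<MM> \<rho> r"
    and "hilbert_tensor t"
    and "\<exists>W :: 'h \<Rightarrow>\<^sub>L 'k. unitary_op W"
    and "purification t \<rho> \<omega>"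
  shows "entropy_reduction X \<MM> \<rho> r = enn2ereal (mutual_information t \<mu>0 X \<MM> \<rho> \<omega>)"
proof -
  note t = \<open>hilbert_tensor t\<close>
  obtain \<psi> where \<psi>: "norm \<psi> = 1" and \<omega>: "\<omega> = ketbra \<psi> \<psi>" and \<rho>: "ptrace_snd t (ketbra \<psi> \<psi>) = \<rho>"
    using \<open>purification t \<rho> \<omega>\<close> unfolding purification_def by blast
  let ?R = "ptrace_fst t \<omega>" and ?\<mu> = "posteriori_measure X \<MM> \<rho>"
  have R: "is_state ?R" unfolding \<omega> by (rule is_state_ptrace_ketbra[OF t \<psi>])
  note R' = is_state_D[OF R]
  let ?G = "eigenbasis ?R" and ?\<kappa> = "expval ?R"
  have G: "is_onb ?G" by (rule eigenbasis_props(1)[OF R'])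
  note oG = is_onb_orthonormal[OF G]
  have cG: "countable ?G" by (rule orthonormal_countable[OF oG])
  obtain \<xi> where \<xi>: "\<And>x. norm (\<xi> x) = 1" and s\<mu>: "sets ?\<mu> = sets X" and m\<xi>: "\<xi> \<in> borel_measurable ?\<mu>"
    and e\<mu>: "emeasure ?\<mu> (space ?\<mu>) = 1"
    and snd: "\<And>F h h'. F \<in> sets X \<Longrightarrow> cinner h (blinfun_apply (\<MM> F \<rho>) h')
        = (\<integral>x. cinner h (ptrace_snd t (ketbra (\<xi> x) (\<xi> x)) h') \<partial>density ?\<mu> (indicator F))"
    and fst: "\<And>F k l. F \<in> sets X \<Longrightarrow> cinner k (ptrace_fst t (map_tensor_id t (\<MM> F) \<omega>) l)
        = (\<integral>x. cinner k (ptrace_fst t (ketbra (\<xi> x) (\<xi> x)) l) \<partial>density ?\<mu> (indicator F))"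
    and mean: "\<And>g. g \<in> ?G \<Longrightarrow> (\<integral>\<^sup>+ x. ennreal ((norm (contract2 t g (\<xi> x)))\<^sup>2) \<partial>?\<mu>) = ennreal ((norm (contract2 t g \<psi>))\<^sup>2)"
    using efficient_pure_states[OF \<open>efficient t0 X \<MM>\<close> \<open>hilbert_tensor t0\<close> \<open>instrument X \<MM>\<close> t \<psi> G]
    unfolding \<rho> \<omega> by blast
  have fin\<mu>: "finite_measure ?\<mu>" using e\<mu> by (intro finite_measureI) simp
  let ?s = "\<lambda>x. ptrace_fst t (ketbra (\<xi> x) (\<xi> x))" and ?r = "\<lambda>x. ptrace_snd t (ketbra (\<xi> x) (\<xi> x))"
  have s: "is_state (?s x)" and r: "is_state (?r x)" for x
    by (rule is_state_ptrace_ketbra[OF t \<xi>], rule is_state_ptrace_snd_ketbra[OF t \<xi>])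
  have mc1: "(\<lambda>x. contract1 t k (\<xi> x)) \<in> borel_measurable ?\<mu>" for k
    by (rule borel_measurable_bounded_linear[OF m\<xi> bounded_linear_contract1[OF t]])
  have mc2: "(\<lambda>x. contract2 t k (\<xi> x)) \<in> borel_measurable ?\<mu>" for k
    by (rule borel_measurable_bounded_linear[OF m\<xi> bounded_linear_contract2[OF t]])

  \<comment> \<open>The given family and the reduced states of \<xi> have the same integrals over
    all events. Matrix elements of states are bounded by 1, hence integrable, so they agree almost
    everywhere.\<close>
  have "AE x in ?\<mu>. r x = ?r x"
  proof -
    let ?D = "SOME D. is_onb (D :: 'h set)"
    have D: "is_onb ?D" by (rule is_onb_some)
    have cD: "countable ?D" by (rule orthonormal_countable[OF is_onb_orthonormal[OF D]])
    have st: "AE x in ?\<mu>. is_state (r x)" using \<open>posteriori_states X \<MM> \<rho> r\<close> by (simp add: posteriori_states_def)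
    have bound: "cmod (cinner d (A d')) \<le> 1" if A: "is_state A" and d: "d \<in> ?D" "d' \<in> ?D" for A d d'
    proof -
      have "(cmod (cinner d (A d')))\<^sup>2 \<le> expval A d * expval A d'"
        by (rule positive_op_cauchy_schwarz[OF is_state_D(1)[OF A]])
      also have "\<dots> \<le> 1 * 1"
        by (intro mult_mono is_state_expval_le_1[OF A D] d positive_op_expval(2)[OF is_state_D(1)[OF A]]) auto
      finally have "(cmod (cinner d (A d')))\<^sup>2 \<le> 1\<^sup>2" by simp
      then show ?thesis by (rule power2_le_imp_le) simp
    qed
    have "AE x in ?\<mu>. trace (ketbra d' d o\<^sub>L r x) = cinner d (?r x d')" if d: "d \<in> ?D" "d' \<in> ?D" for d d'
    proof (rule AE_eq_of_set_integrals)
      show "integrable ?\<mu> (\<lambda>x. trace (ketbra d' d o\<^sub>L r x))"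
      proof (rule finite_measure.integrable_const_bound[OF fin\<mu>])
        show "AE x in ?\<mu>. norm (trace (ketbra d' d o\<^sub>L r x)) \<le> 1"
          using st by eventually_elim (use bound d in \<open>simp add: trace_ketbra_compose positive_op_clinear is_state_D(1)\<close>)
        show "(\<lambda>x. trace (ketbra d' d o\<^sub>L r x)) \<in> borel_measurable ?\<mu>"
          unfolding measurable_cong_sets[OF s\<mu> refl]
          using \<open>posteriori_states X \<MM> \<rho> r\<close> clinear_op_ketbra[of d' d] by (simp add: posteriori_states_def)
      qed
      have m: "(\<lambda>x. cinner d (?r x d')) \<in> borel_measurable ?\<mu>"
        unfolding cinner_ptrace_snd_ketbra[OF t] by (intro borel_measurable_cinner mc1)
      show "integrable ?\<mu> (\<lambda>x. cinner d (?r x d'))"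
        by (rule finite_measure.integrable_const_bound[where B = 1, OF fin\<mu> _ m]) (use bound[OF r d] in simp)
      fix F assume F: "F \<in> sets ?\<mu>"
      have lin: "clinear_op (\<MM> F \<rho>)"
        using \<open>instrument X \<MM>\<close> F s\<mu> is_state_D(2)[OF \<open>is_state \<rho>\<close>]
        by (auto simp: instrument_def operation_def trace_class_def)
      have "(LINT x:F|?\<mu>. trace (ketbra d' d o\<^sub>L r x)) = trace (ketbra d' d o\<^sub>L \<MM> F \<rho>)"
        using \<open>posteriori_states X \<MM> \<rho> r\<close> clinear_op_ketbra[of d' d] F s\<mu> by (simp add: posteriori_states_def)
      also have "\<dots> = (LINT x:F|?\<mu>. cinner d (?r x d'))"
        unfolding trace_ketbra_compose[OF lin] set_integral_eq_integral_density[OF m F]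
        by (rule snd) (use F s\<mu> in simp)
      finally show "(LINT x:F|?\<mu>. trace (ketbra d' d o\<^sub>L r x)) = (LINT x:F|?\<mu>. cinner d (?r x d'))" .
    qed
    then have "AE x in ?\<mu>. \<forall>d\<in>?D. \<forall>d'\<in>?D. trace (ketbra d' d o\<^sub>L r x) = cinner d (?r x d')"
      by (simp add: AE_ball_countable[OF cD])
    then show ?thesis
      using st
    proof eventually_elim
      case (elim x)
      have lin: "clinear_op (r x)" by (rule positive_op_clinear[OF is_state_D(1)[OF elim(2)]])
      show ?case
        by (rule clinear_op_eqI[OF D D lin positive_op_clinear[OF is_state_D(1)[OF r]]])
          (use elim(1) in \<open>simp add: trace_ketbra_compose[OF lin]\<close>)
    qed
  qed
  then have "AE x in ?\<mu>. entropy (r x) = entropy (?s x)"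
    by eventually_elim (simp add: entropy_ptrace_snd_eq_fst[OF t])
  then have er: "(\<integral>\<^sup>+ x. entropy (r x) \<partial>?\<mu>) = (\<integral>\<^sup>+ x. entropy (?s x) \<partial>?\<mu>)"
    by (rule nn_integral_cong_AE)

  \<comment> \<open>The function - Tr s(x) log R, evaluated in the eigenbasis of R.\<close>
  let ?L = "\<lambda>x. \<integral>\<^sup>+ g. ennreal (- ln (?\<kappa> g)) * ennreal (expval (?s x) g) \<partial>count_space ?G"
  have \<kappa>: "?\<kappa> g = (norm (contract2 t g \<psi>))\<^sup>2" for g unfolding \<omega> by (rule expval_ptrace_ketbra[OF t])
  have ms: "(\<lambda>x. ennreal (expval (?s x) g)) \<in> borel_measurable ?\<mu>" for g
    unfolding expval_ptrace_ketbra[OF t] using measurable_compose[OF mc2 borel_measurable_norm] by measurable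
  have mL: "?L \<in> borel_measurable ?\<mu>"
    by (intro borel_measurable_nn_integral_count_space[OF cG] borel_measurable_times_ennreal borel_measurable_const ms)
  have mh: "(\<lambda>x. entropy (?s x)) \<in> borel_measurable ?\<mu>"
    by (rule borel_measurable_entropy[OF G s])
      (simp only: cinner_ptrace_ketbra[OF t], intro borel_measurable_cinner mc2)
  have intL: "(\<integral>\<^sup>+ x. ?L x \<partial>?\<mu>) = entropy \<rho>"
  proof -
    have "(\<integral>\<^sup>+ x. ?L x \<partial>?\<mu>) = (\<integral>\<^sup>+ g. \<integral>\<^sup>+ x. ennreal (- ln (?\<kappa> g)) * ennreal (expval (?s x) g) \<partial>?\<mu> \<partial>count_space ?G)"
      by (rule nn_integral_count_space_nn_integral[OF cG]) (intro borel_measurable_times_ennreal borel_measurable_const ms)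
    also have "\<dots> = (\<integral>\<^sup>+ g. ennreal (- ln (?\<kappa> g)) * ennreal (?\<kappa> g) \<partial>count_space ?G)"
    proof (rule nn_integral_cong)
      fix g assume "g \<in> space (count_space ?G)"
      then have "(\<integral>\<^sup>+ x. ennreal (expval (?s x) g) \<partial>?\<mu>) = ennreal (?\<kappa> g)"
        unfolding expval_ptrace_ketbra[OF t] \<kappa> by (intro mean) simp
      then show "(\<integral>\<^sup>+ x. ennreal (- ln (?\<kappa> g)) * ennreal (expval (?s x) g) \<partial>?\<mu>) = ennreal (- ln (?\<kappa> g)) * ennreal (?\<kappa> g)"
        by (simp add: nn_integral_cmult[OF ms])
    qed
    also have "\<dots> = entropy ?R" by (rule entropy_alt[OF R'(1), symmetric])
    also have "\<dots> = entropy \<rho>" unfolding \<omega> \<rho>[symmetric] by (rule entropy_ptrace_snd_eq_fst[OF t, symmetric])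
    finally show ?thesis .
  qed
  \<comment> \<open>Where R has eigenvalue 0, a nonnegative function has mean 0. So for almost every
    x the support of s(x) lies in that of R, which excludes the infinite branch of
    \<open>rel_entropy\<close>.\<close>
  have ker: "AE x in ?\<mu>. \<forall>g\<in>?G. ?\<kappa> g = 0 \<longrightarrow> expval (?s x) g = 0"
    unfolding AE_ball_countable[OF cG]
  proof
    fix g assume g: "g \<in> ?G"
    show "AE x in ?\<mu>. ?\<kappa> g = 0 \<longrightarrow> expval (?s x) g = 0"
    proof (cases "?\<kappa> g = 0")
      case True
      then have "(\<integral>\<^sup>+ x. ennreal (expval (?s x) g) \<partial>?\<mu>) = 0"
        unfolding expval_ptrace_ketbra[OF t] mean[OF g] using \<kappa>[of g] by simp
      then have "AE x in ?\<mu>. ennreal (expval (?s x) g) = 0" by (simp only: nn_integral_0_iff_AE[OF ms])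
      then show ?thesis by eventually_elim (simp add: expval_ptrace_ketbra[OF t])
    qed simp
  qed

  define p where "p = qc_channel \<mu>0 X \<MM> \<rho>"
  have mp: "p \<in> borel_measurable \<mu>0" unfolding p_def qc_channel_def[abs_def] by measurable
  have p0: "0 \<le> p x" for x by (simp add: p_def qc_channel_def)
  have s\<mu>0: "sets ?\<mu> = sets \<mu>0" using s\<mu> \<open>sets \<mu>0 = sets X\<close> by simp
  \<comment> \<open>The posteriori measure is finite, so its Radon-Nikodym derivative is finite
    almost everywhere and \<open>enn2real\<close> loses nothing.\<close>
  have \<mu>: "?\<mu> = density \<mu>0 (\<lambda>x. ennreal (p x))"
  proof -
    interpret \<mu>0: sigma_finite_measure \<mu>0 by fact
    interpret \<mu>: finite_measure ?\<mu> by (rule fin\<mu>)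
    have ac: "absolutely_continuous \<mu>0 ?\<mu>" by (rule assms(7)[OF \<open>is_state \<rho>\<close>])
    have "AE x in \<mu>0. RN_deriv \<mu>0 ?\<mu> x \<noteq> \<infinity>"
      by (rule \<mu>0.RN_deriv_finite[OF \<mu>.sigma_finite_measure_axioms ac s\<mu>0])
    then have "AE x in \<mu>0. RN_deriv \<mu>0 ?\<mu> x = ennreal (p x)"
      by eventually_elim (simp add: p_def qc_channel_def less_top)
    then have "density \<mu>0 (RN_deriv \<mu>0 ?\<mu>) = density \<mu>0 (\<lambda>x. ennreal (p x))"
      using mp by (intro density_cong) auto
    then show ?thesis using \<mu>0.density_RN_deriv[OF ac s\<mu>0] by simp
  qed
  have meas0: "f \<in> borel_measurable ?\<mu> \<longleftrightarrow> f \<in> borel_measurable \<mu>0" for f :: "'x \<Rightarrow> 'z::topological_space"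
    using measurable_cong_sets[OF s\<mu>0 refl] by blast

  \<comment> \<open>The square root makes p(x) s(x) the reduced operator of a field that is square
    integrable for \<mu>0, so that \<open>op_density_ptrace\<close> applies to it.\<close>
  define \<xi>' where "\<xi>' x = sqrt (p x) *\<^sub>R \<xi> x" for x
  have n\<xi>': "(norm (\<xi>' x))\<^sup>2 = p x" for x by (simp add: \<xi>'_def \<xi> power_mult_distrib p0)
  have c\<xi>': "contract2 t k (\<xi>' x) = sqrt (p x) *\<^sub>R contract2 t k (\<xi> x)" for k x
    unfolding \<xi>'_def by (rule linear_scale[OF bounded_linear.linear[OF bounded_linear_contract2[OF t]]])
  have s': "cinner k (ptrace_fst t (ketbra (\<xi>' x) (\<xi>' x)) l) = p x *\<^sub>R cinner k (?s x l)" for k l x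
    unfolding cinner_ptrace_ketbra[OF t] c\<xi>' cinner_scaleR_left cinner_scaleR_right
    by (simp add: p0)
  have \<sigma>: "ptrace_fst t (ketbra (\<xi>' x) (\<xi>' x)) = p x *\<^sub>R ?s x" for x
    by (intro blinfun_eqI cinner_eqI) (simp add: s' scaleR_blinfun.rep_eq cinner_scaleR_right)
  have m\<xi>': "\<xi>' \<in> borel_measurable \<mu>0"
    unfolding \<xi>'_def using mp m\<xi>[unfolded meas0] by measurable
  have dens: "op_density \<mu>0 (\<lambda>F. ptrace_fst t (map_tensor_id t (\<MM> F) \<omega>)) (\<lambda>x. ptrace_fst t (ketbra (\<xi>' x) (\<xi>' x)))"
  proof (rule op_density_ptrace[OF t m\<xi>'])
    show "integrable \<mu>0 (\<lambda>x. (norm (\<xi>' x))\<^sup>2)"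
      unfolding n\<xi>'
    proof (rule integrableI_nonneg)
      have "(\<integral>\<^sup>+ x. ennreal (p x) \<partial>\<mu>0) = emeasure ?\<mu> (space ?\<mu>)"
        using mp by (subst (1 2) \<mu>) (simp add: emeasure_density cong: nn_integral_cong)
      then show "(\<integral>\<^sup>+ x. ennreal (p x) \<partial>\<mu>0) < \<infinity>" by (simp add: e\<mu>)
    qed (use mp p0 in auto)
    fix F k l assume F: "F \<in> sets \<mu>0"
    have ml: "(\<lambda>x. cinner k (?s x l)) \<in> borel_measurable ?\<mu>"
      unfolding cinner_ptrace_ketbra[OF t] by (intro borel_measurable_cinner mc2)
    have ml': "(\<lambda>x. p x *\<^sub>R cinner k (?s x l)) \<in> borel_measurable \<mu>0"
      using mp ml[unfolded meas0] by (intro borel_measurable_scaleR)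
    have "cinner k (ptrace_fst t (map_tensor_id t (\<MM> F) \<omega>) l) = (LINT x:F|?\<mu>. cinner k (?s x l))"
      unfolding set_integral_eq_integral_density[OF ml F[folded s\<mu>0]] by (rule fst) (use F s\<mu> s\<mu>0 in simp)
    also have "\<dots> = (\<integral>x. p x *\<^sub>R (indicator F x *\<^sub>R cinner k (?s x l)) \<partial>\<mu>0)"
      unfolding set_lebesgue_integral_def
      by (subst \<mu>, rule integral_density)
        (use mp p0 F ml[unfolded meas0] in \<open>auto intro!: borel_measurable_scaleR\<close>)
    also have "\<dots> = (LINT x:F|\<mu>0. p x *\<^sub>R cinner k (?s x l))"
      unfolding set_lebesgue_integral_def by (simp only: scaleR_left_commute)
    also have "\<dots> = (\<integral>x. p x *\<^sub>R cinner k (?s x l) \<partial>density \<mu>0 (indicator F))"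
      by (rule set_integral_eq_integral_density[OF ml' F])
    finally show "cinner k (ptrace_fst t (map_tensor_id t (\<MM> F) \<omega>) l)
        = (\<integral>x. cinner k (ptrace_fst t (ketbra (\<xi>' x) (\<xi>' x)) l) \<partial>density \<mu>0 (indicator F))"
      unfolding s' .
  qed
  have "op_density \<mu>0 (\<lambda>F. ptrace_fst t (map_tensor_id t (\<MM> F) \<omega>)) (qc_channel_tensor_id t \<mu>0 \<MM> \<omega>)"
    unfolding qc_channel_tensor_id_def by (rule someI[of "op_density \<mu>0 _", OF dens])
  from op_density_unique[OF this dens]
  have ae\<sigma>: "AE x in \<mu>0. qc_channel_tensor_id t \<mu>0 \<MM> \<omega> x = p x *\<^sub>R ?s x" unfolding \<sigma> .
  let ?E = "\<lambda>x. rel_entropy (p x *\<^sub>R ?s x) (p x *\<^sub>R ?R)"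
  have I: "mutual_information t \<mu>0 X \<MM> \<rho> \<omega> = (\<integral>\<^sup>+ x. ?E x \<partial>\<mu>0)"
    unfolding mutual_information_def qc_rel_entropy_def p_def[symmetric]
    by (rule nn_integral_cong_AE) (use ae\<sigma> in \<open>eventually_elim, simp\<close>)

  let ?pL = "\<lambda>x. ennreal (p x) * ?L x" and ?ph = "\<lambda>x. ennreal (p x) * entropy (?s x)"
  have mpL: "?pL \<in> borel_measurable \<mu>0" and mph: "?ph \<in> borel_measurable \<mu>0"
    using mp mL[unfolded meas0] mh[unfolded meas0] by (auto intro!: borel_measurable_times_ennreal)
  have ipL: "(\<integral>\<^sup>+ x. ?pL x \<partial>\<mu>0) = entropy \<rho>" and iph: "(\<integral>\<^sup>+ x. ?ph x \<partial>\<mu>0) = (\<integral>\<^sup>+ x. entropy (?s x) \<partial>?\<mu>)"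
    using nn_integral_density[of "\<lambda>x. ennreal (p x)" \<mu>0 ?L] nn_integral_density[of "\<lambda>x. ennreal (p x)" \<mu>0 "\<lambda>x. entropy (?s x)"]
      mp mL[unfolded meas0] mh[unfolded meas0] intL unfolding \<mu>[symmetric] by simp_all
  \<comment> \<open>The kernel condition is known almost everywhere for the posteriori measure, that
    is, for almost every x with p(x) positive; where p(x) = 0 all three terms vanish.\<close>
  have sum: "AE x in \<mu>0. ?E x + ?ph x = ?pL x"
  proof -
    have "AE x in \<mu>0. 0 < ennreal (p x) \<longrightarrow> (\<forall>g\<in>?G. ?\<kappa> g = 0 \<longrightarrow> expval (?s x) g = 0)"
      using ker unfolding \<mu> using mp by (subst (asm) AE_density) auto
    then show ?thesis
    proof eventually_elim
      case (elim x)
      show ?case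
      proof (cases "p x = 0")
        case True
        then show ?thesis using rel_entropy_0[of ?R] by simp
      next
        case False
        then have "0 < p x" using p0[of x] by simp
        then show ?thesis
          using elim by (intro rel_entropy_scaleR_add_entropy[OF s R]) auto
      qed
    qed
  qed
  \<comment> \<open>Finiteness of the entropy enters here: the right-hand side of \<open>sum\<close>
    is finite almost everywhere, so the entropy term can be subtracted pointwise and then under the
    integral.\<close>
  have fin: "AE x in \<mu>0. ?pL x \<noteq> \<infinity>"
    by (rule nn_integral_noteq_infinite[OF mpL]) (use \<open>entropy \<rho> < \<infinity>\<close> ipL in auto)
  have le: "AE x in \<mu>0. ?ph x \<le> ?pL x"
    using sum
  proof eventually_elim
    case (elim x)
    show ?case unfolding elim[symmetric] by (rule add_increasing) simp_all
  qed
  then have ile: "(\<integral>\<^sup>+ x. ?ph x \<partial>\<mu>0) \<le> entropy \<rho>" unfolding ipL[symmetric] by (rule nn_integral_mono_AE)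
  then have nph: "(\<integral>\<^sup>+ x. ?ph x \<partial>\<mu>0) \<noteq> \<infinity>" using \<open>entropy \<rho> < \<infinity>\<close> by (auto simp: top_unique)
  have "(\<integral>\<^sup>+ x. ?E x \<partial>\<mu>0) = (\<integral>\<^sup>+ x. ?pL x - ?ph x \<partial>\<mu>0)"
  proof (rule nn_integral_cong_AE, use sum fin in eventually_elim)
    case (elim x)
    have "?E x + ?ph x \<noteq> top" unfolding elim(1) using elim(2) by simp
    then have "?ph x \<noteq> top" unfolding ennreal_add_eq_top by simp
    then show ?case unfolding elim(1)[symmetric] by (rule ennreal_add_diff_cancel_right[symmetric])
  qed
  also have "\<dots> = entropy \<rho> - (\<integral>\<^sup>+ x. ?ph x \<partial>\<mu>0)"
    by (subst nn_integral_diff[OF mpL mph nph le]) (simp add: ipL)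
  finally have "mutual_information t \<mu>0 X \<MM> \<rho> \<omega> = entropy \<rho> - (\<integral>\<^sup>+ x. entropy (r x) \<partial>?\<mu>)"
    unfolding I iph er .
  \<comment> \<open>Subtraction in \<open>ennreal\<close> is truncated at 0; for finite a and b
    \<le> a it agrees with that of \<open>ereal\<close>.\<close>
  moreover have "enn2ereal (a - b) = enn2ereal a - enn2ereal b" if "b \<le> a" "a < \<infinity>" for a b
  proof -
    from that have "b < top" by (simp add: order.strict_trans1)
    with that show ?thesis by (cases a; cases b) (auto simp: ennreal_minus)
  qed
  ultimately show ?thesis
    unfolding entropy_reduction_def using ile \<open>entropy \<rho> < \<infinity>\<close> unfolding iph er by simp
qed

end
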